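(* Let $\mu\ge 0$ be a Borel measure on $\overline{\mathbb{D}}^2$, the closure of the bidisc. Then the following are equivalent. (I) There is a constant $C_1>0$ such that $$\sup_{0\le r<1}\int_{\overline{\mathbb{D}}^2}|f(rz_1,rz_2)|^2\,d\mu(z_1,z_2)\le C_1\|f\|_{\mathcal{D}(\mathbb{D}^2)}^2,\qquad f\in\mathcal{D}(\mathbb{D}^2).$$ (II) There is a constant $C_2>0$ such that for all $n\ge 1$ and for all choices of arcs $J^1_1,\dots,J^1_n$ and $J^2_1,\dots,J^2_n$ on $\partial\mathbb{D}$, $$\mu\Big(\bigcup_{k=1}^n S(J^1_k\times J^2_k)\Big)\le C_2\,\mathrm{Cap}_{(\frac12,\frac12)}\Big(\bigcup_{k=1}^n J^1_k\times J^2_k\Big).$$ Moreover, the (best) constants $C_1$ and $C_2$ are comparable independently of $\mu$, i.e. there are absolute constants $0<c\le C<\infty$ with $cC_2\le C_1\le CC_2$ for all $\mu$.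
   Context: $\mathbb{D}=\{z\in\mathbb{C}:|z|<1\}$. The Dirichlet space $\mathcal{D}(\mathbb{D}^2)$ consists of the holomorphic functions $f(z_1,z_2)=\sum_{m,n\ge0}a_{mn}z_1^mz_2^n$ on $\mathbb{D}^2$ with $\|f\|^2_{\mathcal{D}(\mathbb{D}^2)}=\sum_{m,n\ge0}|a_{mn}|^2(m+1)(n+1)<\infty$. Arcs are closed arcs of $\partial\mathbb{D}$ (the whole circle allowed). For an arc $J$ of length $|J|$, the Carleson box is $S(J)=\{\rho e^{is}: e^{is}\in J,\ 1-\frac{|J|}{2\pi}\le\rho\le1\}\subset\overline{\mathbb{D}}$, and $S(J^1\times J^2)=S(J^1)\times S(J^2)\subset\overline{\mathbb{D}}^2$. Capacity: let $m$ be the normalized area measure on the torus $(\partial\mathbb{D})^2$. For $z=(e^{i\theta_1},e^{i\theta_2})$, $\zeta=(e^{i\eta_1},e^{i\eta_2})$ put $b_{(\frac12,\frac12)}(z,\zeta)=|\theta_1-\eta_1|^{-1/2}|\theta_2-\eta_2|^{-1/2}$, where the differences $\theta_i-\eta_i\in[-\pi,\pi)$ are taken modulo $2\pi$. For $h\ge0$ put $(B_{(\frac12,\frac12)}h)(z)=\int_{(\partial\mathbb{D})^2}b_{(\frac12,\frac12)}(z,\zeta)h(\zeta)\,dm(\zeta)$. For closed $E\subset(\partial\mathbb{D})^2$, $$\mathrm{Cap}_{(\frac12,\frac12)}(E)=\inf\{\|h\|^2_{L^2((\partial\mathbb{D})^2,dm)}:\ h\ge0,\ B_{(\frac12,\frac12)}h\ge1\text{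 on }E\}.$$ *)

theory Defs
  imports "HOL-Complex_Analysis.Complex_Analysis" "HOL-Probability.Probability"
begin

section \<open>The Dirichlet space on the bidisc\<close>

abbreviation bidisc :: "(complex \<times> complex) set" where
  "bidisc \<equiv> ball 0 1 \<times> ball 0 1"

abbreviation closed_bidisc :: "(complex \<times> complex) set" where
  "closed_bidisc \<equiv> cball 0 1 \<times> cball 0 1"

definition holomorphic_on_bidisc :: "(complex \<times> complex \<Rightarrow> complex) \<Rightarrow> bool" where
  "holomorphic_on_bidisc f \<longleftrightarrow>
     continuous_on bidisc f \<and>
     (\<forall>w\<in>ball 0 1. (\<lambda>z. f (z, w)) holomorphic_on ball 0 1) \<and>
     (\<forall>z\<in>ball 0 1. (\<lambda>w. f (z, w)) holomorphic_on ball 0 1)"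

definition has_bidisc_expansion ::
    "(complex \<times> complex \<Rightarrow> complex) \<Rightarrow> (nat \<Rightarrow> nat \<Rightarrow> complex) \<Rightarrow> bool" where
  "has_bidisc_expansion f a \<longleftrightarrow>
     (\<forall>z\<in>ball 0 1. \<forall>w\<in>ball 0 1. ((\<lambda>(m, n). a m n * z ^ m * w ^ n) has_sum f (z, w)) UNIV)"

text \<open>The coefficients are uniquely determined by the function on the bidisc, so the definite
  description is proper whenever an expansion exists.\<close>

definition bidisc_coeff :: "(complex \<times> complex \<Rightarrow> complex) \<Rightarrow> nat \<Rightarrow> nat \<Rightarrow> complex" where
  "bidisc_coeff f = (THE a. has_bidisc_expansion f a)"

definition dirichlet_space :: "(complex \<times> complex \<Rightarrow> complex) set" where
  "dirichlet_space =
     {f. holomorphic_on_bidisc f \<and>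
         (\<exists>a. has_bidisc_expansion f a \<and>
              (\<lambda>(m, n). (norm (a m n))\<^sup>2 * (real m + 1) * (real n + 1)) summable_on UNIV)}"

definition dirichlet_norm_sq :: "(complex \<times> complex \<Rightarrow> complex) \<Rightarrow> real" where
  "dirichlet_norm_sq f =
     (\<Sum>\<^sub>\<infinity>(m, n)\<in>UNIV. (norm (bidisc_coeff f m n))\<^sup>2 * (real m + 1) * (real n + 1))"


section \<open>Arcs and Carleson boxes\<close>

text \<open>Closed non-degenerate arcs; \<open>b = a + 2 * pi\<close> gives the whole circle.\<close>

definition circle_arcs :: "complex set set" where
  "circle_arcs = {cis ` {a..b} | a b. a < b \<and> b \<le> a + 2 * pi}"

definition arc_length :: "complex set \<Rightarrow> real" where
  "arc_length J = measure lborel {t \<in> {-pi..<pi}. cis t \<in> J}"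

definition carleson_box :: "complex set \<Rightarrow> complex set" where
  "carleson_box J =
     {rcis \<rho> s | \<rho> s. cis s \<in> J \<and> 1 - arc_length J / (2 * pi) \<le> \<rho> \<and> \<rho> \<le> 1}"


section \<open>Bi-parameter capacity on the torus\<close>

abbreviation torus :: "(complex \<times> complex) set" where
  "torus \<equiv> sphere 0 1 \<times> sphere 0 1"

text \<open>The normalized measures on the circle and the torus are realised as Borel measures on the
  ambient spaces that are carried by the circle and the torus, respectively.\<close>

definition circle_measure :: "complex measure" where
  "circle_measure = distr (uniform_measure lborel {-pi..<pi}) borel cis"

definition torus_measure :: "(complex \<times> complex) measure" where
  "torus_measure = circle_measure \<Otimes>\<^sub>M circle_measure"

text \<open>For \<open>z = cis \<theta>\<close> and \<open>w = cis \<eta>\<close> the number \<open>\<bar>Arg (z / w)\<bar>\<close> is \<open>\<bar>\<theta> - \<eta>\<bar>\<close> with the difference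
  reduced modulo \<open>2 * pi\<close>; whether the representative \<open>-pi\<close> or \<open>pi\<close> is chosen is immaterial under
  the absolute value. The inverse is taken in \<^typ>\<open>ennreal\<close>, so the kernel is infinite when one
  of the two coordinates agrees.\<close>

definition potential_kernel :: "complex \<times> complex \<Rightarrow> complex \<times> complex \<Rightarrow> ennreal" where
  "potential_kernel z \<zeta> =
     inverse (ennreal (sqrt \<bar>Arg (fst z / fst \<zeta>)\<bar>)) *
     inverse (ennreal (sqrt \<bar>Arg (snd z / snd \<zeta>)\<bar>))"

definition potential :: "(complex \<times> complex \<Rightarrow> ennreal) \<Rightarrow> complex \<times> complex \<Rightarrow> ennreal" where
  "potential h z = (\<integral>\<^sup>+ \<zeta>. potential_kernel z \<zeta> * h \<zeta> \<partial>torus_measure)"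

text \<open>Intended for closed subsets of \<^term>\<open>torus\<close>.\<close>

definition capacity :: "(complex \<times> complex) set \<Rightarrow> ennreal" where
  "capacity E =
     (INF h \<in> {h \<in> borel_measurable torus_measure. \<forall>z\<in>E. 1 \<le> potential h z}.
        \<integral>\<^sup>+ \<zeta>. (h \<zeta>)\<^sup>2 \<partial>torus_measure)"


section \<open>The two conditions\<close>

definition borel_measure_on_closed_bidisc :: "(complex \<times> complex) measure \<Rightarrow> bool" where
  "borel_measure_on_closed_bidisc \<mu> \<longleftrightarrow> sets \<mu> = sets (restrict_space borel closed_bidisc)"

definition embedding_bound :: "(complex \<times> complex) measure \<Rightarrow> real \<Rightarrow> bool" where
  "embedding_bound \<mu> C \<longleftrightarrow>
     (\<forall>f\<in>dirichlet_space.
        (SUP r\<in>{0..<1::real}.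
           \<integral>\<^sup>+ (z1, z2). ennreal ((norm (f (of_real r * z1, of_real r * z2)))\<^sup>2) \<partial>\<mu>)
        \<le> ennreal (C * dirichlet_norm_sq f))"

definition capacity_bound :: "(complex \<times> complex) measure \<Rightarrow> real \<Rightarrow> bool" where
  "capacity_bound \<mu> C \<longleftrightarrow>
     (\<forall>n\<ge>1. \<forall>J1 J2 :: nat \<Rightarrow> complex set.
        (\<forall>k\<in>{1..n}. J1 k \<in> circle_arcs \<and> J2 k \<in> circle_arcs) \<longrightarrow>
        emeasure \<mu> (\<Union>k\<in>{1..n}. carleson_box (J1 k) \<times> carleson_box (J2 k))
        \<le> ennreal C * capacity (\<Union>k\<in>{1..n}. J1 k \<times> J2 k))"

text \<open>The best constant is infinite if no constant is admissible.\<close>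

definition best_constant :: "(real \<Rightarrow> bool) \<Rightarrow> ennreal" where
  "best_constant P = Inf {ennreal C | C. 0 < C \<and> P C}"

end

theory Submission
  imports Defs
begin

text \<open>Up to equivalence of norms the Dirichlet space of the bidisc has the reproducing kernel
\<open>L (z1 * cnj w1) * L (z2 * cnj w2)\<close> with \<open>L w = 10 - Ln (1 - w)\<close>. By duality the embedding
inequality says that the quadratic form of this kernel is bounded on \<open>L\<^sup>2(\<mu>)\<close>. The imaginary part
of \<open>L\<close> is bounded and its real part \<open>log_kernel w = 10 - ln \<bar>1 - w\<bar>\<close> is at least \<open>9\<close>, so the
real part of the product of two factors is comparable to its modulus (\<open>Re_log_poly_mult_ge\<close>), and
the complex kernel may be exchanged for the positive kernel \<open>bidisc_kernel\<close>
(\<open>energy_le\<close>, \<open>energy_ge\<close>). Partial sums of \<open>L\<close> are used throughout, so that all test functions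
are polynomials.

From embedding to capacity. Let \<open>S\<close> be a union of Carleson boxes over \<open>E\<close>. Testing the embedding on
the polynomial with the (weighted) moments of \<open>\<mu>\<close> on \<open>S\<close> as coefficients bounds the energy of \<open>\<mu>\<close>
restricted to \<open>S\<close> by a multiple of \<open>\<mu>(S)\<close> (\<open>embedding_energy_le\<close>). On the other hand, if the
potential of \<open>h\<close> is at least \<open>1\<close> on \<open>E\<close>, averaging it over the arcs shows that a potential with a
truncated kernel is bounded below on all of \<open>S\<close> (\<open>one_le_potential_average\<close>). Integrating over \<open>S\<close>
and using that the truncated kernel composed with itself is dominated by the logarithmic kernel
(\<open>truncated_kernel_convolution_le\<close>), one gets \<open>\<mu>(S) \<le> C * \<integral>h\<^sup>2\<close> from Cauchy--Schwarz.

From capacity to embedding. The capacity condition is a weak-type inequality for dyadic potentials.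
Its dual form is the restricted energy condition: for every union \<open>F\<close> of cells of a dyadic grid the
tree energy of \<open>\<mu>\<close> restricted to \<open>F\<close> is at most a multiple of \<open>\<mu>(F)\<close>
(\<open>capacity_imp_restricted_energy_bound\<close>). The heart of the proof is that the restricted energy
condition implies the strong embedding on a product of two finite forests (\<open>bitree_embedding\<close>).
In one parameter this is the strong capacitary inequality of Maz'ya, Adams and Dahlberg, which rests
on the maximum principle. In two parameters the potential of a measure can be much larger off the
support than on it. The substitute is that the set where it is large is covered by the potential
of a function of small energy (\<open>potential_le_majorant\<close>, \<open>cross_energy_le\<close>); this
makes the interaction of different level sets decay (\<open>pairing_energy_decay\<close>), and the level sets can
be summed. Finally, two grids, one shifted by a third, are enough to dominate the
logarithmic kernel by the number of common dyadic ancestors (\<open>log_kernel_le_common_ancestors\<close>), and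
duality returns from the energy to the embedding.\<close>

section \<open>Sums over a finite forest\<close>

text \<open>The order relates a node to its ancestors, which form a chain. Working with the order alone
turns sums along paths into sums over \<open>up x\<close> and exchanges of summation into
\<open>sum_up_dn_swap\<close>.\<close>

locale finite_forest =
  fixes A :: "'a set" and le :: "'a \<Rightarrow> 'a \<Rightarrow> bool" (infix "\<sqsubseteq>" 50)
  assumes finite_nodes: "finite A"
    and le_refl: "a \<in> A \<Longrightarrow> a \<sqsubseteq> a"
    and le_trans: "a \<in> A \<Longrightarrow> b \<in> A \<Longrightarrow> c \<in> A \<Longrightarrow> a \<sqsubseteq> b \<Longrightarrow> b \<sqsubseteq> c \<Longrightarrow> a \<sqsubseteq> c"
    and le_antisym: "a \<in> A \<Longrightarrow> b \<in> A \<Longrightarrow> a \<sqsubseteq> b \<Longrightarrow> b \<sqsubseteq> a \<Longrightarrow> a = b"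
    and le_chain: "x \<in> A \<Longrightarrow> a \<in> A \<Longrightarrow> b \<in> A \<Longrightarrow> x \<sqsubseteq> a \<Longrightarrow> x \<sqsubseteq> b \<Longrightarrow> a \<sqsubseteq> b \<or> b \<sqsubseteq> a"
begin

definition up :: "'a \<Rightarrow> 'a set" where "up a = {b \<in> A. a \<sqsubseteq> b}"
definition dn :: "'a \<Rightarrow> 'a set" where "dn a = {b \<in> A. b \<sqsubseteq> a}"

lemma finite_up [simp]: "finite (up a)" and finite_dn [simp]: "finite (dn a)"
  using finite_nodes by (auto simp: up_def dn_def)

lemma up_sub: "up a \<subseteq> A" and dn_sub: "dn a \<subseteq> A"
  by (auto simp: up_def dn_def)

lemma self_in_up: "a \<in> A \<Longrightarrow> a \<in> up a"
  by (simp add: up_def le_refl)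

lemma up_mono: "a \<in> A \<Longrightarrow> b \<in> up a \<Longrightarrow> up b \<subseteq> up a"
  by (auto simp: up_def intro: le_trans)

lemma up_eq_restrict: "a \<in> A \<Longrightarrow> b \<in> up a \<Longrightarrow> up b = {c \<in> up a. b \<sqsubseteq> c}"
  by (auto simp: up_def intro: le_trans)

lemma sum_up_dn_swap:
  "(\<Sum>a\<in>A. \<Sum>b\<in>up a. g a b) = (\<Sum>b\<in>A. \<Sum>a\<in>dn b. g a b)"
  unfolding up_def dn_def by (rule sum.swap_restrict[OF finite_nodes finite_nodes])

text \<open>Any two nodes above \<open>x\<close> are comparable, so each term of the product of the two sums occurs on the
right, once in each order if the two nodes coincide.\<close>

lemma sum_mult_le_chain:
  fixes u v :: "'a \<Rightarrow> real"
  assumes x: "x \<in> A" and u: "\<And>a. a \<in> A \<Longrightarrow> 0 \<le> u a" and v: "\<And>a. a \<in> A \<Longrightarrow> 0 \<le> v a"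
  shows "(\<Sum>a\<in>up x. u a) * (\<Sum>a\<in>up x. v a)
       \<le> (\<Sum>a\<in>up x. u a * (\<Sum>b\<in>up a. v b)) + (\<Sum>a\<in>up x. v a * (\<Sum>b\<in>up a. u b))"
proof -
  have inA: "a \<in> A" if "a \<in> up x" for a using that by (simp add: up_def)
  have "(\<Sum>a\<in>up x. u a) * (\<Sum>a\<in>up x. v a) = (\<Sum>a\<in>up x. \<Sum>b\<in>up x. u a * v b)"
    by (rule sum_product)
  also have "\<dots> \<le> (\<Sum>a\<in>up x. \<Sum>b\<in>up x. (if a \<sqsubseteq> b then u a * v b else 0) + (if b \<sqsubseteq> a then u a * v b else 0))"
  proof (intro sum_mono)
    fix a b assume "a \<in> up x" "b \<in> up x"
    then have "a \<sqsubseteq> b \<or> b \<sqsubseteq> a" "0 \<le> u a * v b"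
      using le_chain[of x a b] x u v by (auto simp: up_def)
    then show "u a * v b \<le> (if a \<sqsubseteq> b then u a * v b else 0) + (if b \<sqsubseteq> a then u a * v b else 0)"
      by auto
  qed
  also have "\<dots> = (\<Sum>a\<in>up x. \<Sum>b\<in>up x. if a \<sqsubseteq> b then u a * v b else 0)
      + (\<Sum>b\<in>up x. \<Sum>a\<in>up x. if b \<sqsubseteq> a then u a * v b else 0)"
    by (simp add: sum.distrib) (rule sum.swap)
  also have "(\<Sum>a\<in>up x. \<Sum>b\<in>up x. if a \<sqsubseteq> b then u a * v b else 0) = (\<Sum>a\<in>up x. u a * (\<Sum>b\<in>up a. v b))"
  proof (intro sum.cong refl)
    fix a assume "a \<in> up x"
    show "(\<Sum>b\<in>up x. if a \<sqsubseteq> b then u a * v b else 0) = u a * (\<Sum>b\<in>up a. v b)"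
      by (subst up_eq_restrict[OF x \<open>a \<in> up x\<close>])
        (simp add: sum_distrib_left sum.inter_filter if_distrib[of "\<lambda>t. _ * t"] cong: if_cong)
  qed
  also have "(\<Sum>b\<in>up x. \<Sum>a\<in>up x. if b \<sqsubseteq> a then u a * v b else 0) = (\<Sum>b\<in>up x. v b * (\<Sum>a\<in>up b. u a))"
  proof (intro sum.cong refl)
    fix b assume "b \<in> up x"
    show "(\<Sum>a\<in>up x. if b \<sqsubseteq> a then u a * v b else 0) = v b * (\<Sum>a\<in>up b. u a)"
      by (subst up_eq_restrict[OF x \<open>b \<in> up x\<close>])
        (simp add: sum_distrib_left sum.inter_filter mult.commute if_distrib[of "\<lambda>t. _ * t"] cong: if_cong)
  qed
  finally show ?thesis .
qed

lemma sum_square_le_chain: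
  fixes u :: "'a \<Rightarrow> real"
  assumes "x \<in> A" and "\<And>a. a \<in> A \<Longrightarrow> 0 \<le> u a"
  shows "(\<Sum>a\<in>up x. u a)\<^sup>2 \<le> 2 * (\<Sum>a\<in>up x. u a * (\<Sum>b\<in>up a. u b))"
  using sum_mult_le_chain[of x u u] assms by (simp add: power2_eq_square)

text \<open>The next ancestor \<open>p\<close> of \<open>x\<close> is found as the node with the most ancestors among those strictly
above \<open>x\<close>.\<close>

lemma up_cases:
  assumes x: "x \<in> A"
  shows "up x = {x} \<or> (\<exists>p\<in>A. up x = insert x (up p) \<and> x \<notin> up p)"
proof (cases "up x = {x}")
  case False
  define R where "R = up x - {x}"
  have R: "finite R" "R \<noteq> {}" "R \<subseteq> A"
    using False self_in_up[OF x] up_sub by (auto simp: R_def)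
  have "Max ((\<lambda>q. card (up q)) ` R) \<in> (\<lambda>q. card (up q)) ` R" using R by simp
  then obtain p where p0: "p \<in> R" "Max ((\<lambda>q. card (up q)) ` R) = card (up p)"
    by blast
  have p: "p \<in> R" "\<And>q. q \<in> R \<Longrightarrow> card (up q) \<le> card (up p)"
    using R(1) p0(1) by (auto simp flip: p0(2))
  have pA: "p \<in> A" and px: "x \<sqsubseteq> p" "p \<noteq> x" using p R by (auto simp: R_def up_def)
  have "p \<sqsubseteq> q" if q: "q \<in> R" for q
  proof -
    have qA: "q \<in> A" and qx: "x \<sqsubseteq> q" using q by (auto simp: R_def up_def)
    show ?thesis
    proof (cases "p \<sqsubseteq> q")
      case False
      then have "q \<sqsubseteq> p" using le_chain[OF x pA qA px(1) qx] by simp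
      then have sub: "up p \<subseteq> up q" using up_mono[OF qA, of p] pA by (auto simp: up_def)
      then have "up p = up q" using p(2)[OF q] by (meson card_seteq finite_up)
      then show ?thesis using self_in_up[OF qA] by (auto simp: up_def)
    qed
  qed
  then have "R \<subseteq> up p" using R by (auto simp: up_def)
  moreover have "x \<notin> up p"
    using px le_antisym[OF x pA] by (auto simp: up_def)
  moreover have "up p \<subseteq> R"
    using up_mono[OF x, of p] p \<open>x \<notin> up p\<close> by (auto simp: R_def)
  ultimately show ?thesis using pA self_in_up[OF x] by (auto simp: R_def)
qed simp

text \<open>The discrete form of \<open>\<integral> dU / (l + U)\<^sup>2 \<le> 1 / l\<close>: along the chain above \<open>x\<close> the sums \<open>U\<close> grow in
steps \<open>u\<close>, and each term is bounded by the corresponding difference of \<open>1 / (l + U)\<close>.\<close>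

lemma sum_div_square_le:
  fixes u :: "'a \<Rightarrow> real"
  assumes l: "l > 0" and u: "\<And>a. a \<in> A \<Longrightarrow> 0 \<le> u a" and x: "x \<in> A"
  shows "(\<Sum>a\<in>up x. u a / (l + (\<Sum>b\<in>up a. u b))\<^sup>2) \<le> 1 / l - 1 / (l + (\<Sum>b\<in>up x. u b))"
  using x
proof (induction "card (up x)" arbitrary: x rule: less_induct)
  case less
  have step: "c / (s + c)\<^sup>2 \<le> 1 / s - 1 / (s + c)" if "s > 0" "c \<ge> 0" for s c :: real
  proof -
    have "c / (s + c)\<^sup>2 \<le> c / (s * (s + c))"
      using that by (intro divide_left_mono) (auto simp: power2_eq_square intro!: mult_right_mono)
    also have "\<dots> = 1 / s - 1 / (s + c)" using that by (simp add: field_simps)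
    finally show ?thesis .
  qed
  from up_cases[OF less.prems] show ?case
  proof
    assume "up x = {x}"
    then show ?thesis using step[OF l u[OF less.prems]] by simp
  next
    assume "\<exists>p\<in>A. up x = insert x (up p) \<and> x \<notin> up p"
    then obtain p where p: "p \<in> A" "up x = insert x (up p)" "x \<notin> up p" by blast
    define s where "s = l + (\<Sum>b\<in>up p. u b)"
    have s: "s > 0" using l u up_sub unfolding s_def by (intro add_pos_nonneg sum_nonneg) auto
    have "(\<Sum>a\<in>up p. u a / (l + (\<Sum>b\<in>up a. u b))\<^sup>2) \<le> 1 / l - 1 / s"
      unfolding s_def using p by (intro less.hyps) (auto simp: )
    moreover have "u x / (s + u x)\<^sup>2 \<le> 1 / s - 1 / (s + u x)"
      using step[OF s u[OF less.prems]] .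
    moreover have "(\<Sum>b\<in>up x. u b) = u x + (\<Sum>b\<in>up p. u b)"
      using p by simp
    ultimately show ?thesis
      using p(2,3) by (simp add: s_def add_ac)
  qed
qed

text \<open>One factor of \<open>u\<^sup>2\<close> is written as a sum over descendants; after exchanging the sums, the sum along
each chain of ancestors telescopes. The weight \<open>l\<close> makes the bound small for large \<open>l\<close>, which is the
source of the gain in the two-parameter estimate.\<close>

lemma sum_below_le:
  fixes \<rho> :: "'a \<Rightarrow> real"
  assumes l: "l > 0" and \<rho>: "\<And>a. a \<in> A \<Longrightarrow> 0 \<le> \<rho> a" and \<beta>: "\<beta> \<in> A"
    and u: "\<And>a. a \<in> A \<Longrightarrow> u a = (\<Sum>y\<in>dn a. \<rho> y)"
  shows "(\<Sum>a\<in>dn \<beta>. (u a)\<^sup>2 / (l + (\<Sum>b\<in>up a. u b))\<^sup>2) \<le> u \<beta> / l"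
proof -
  have u0: "0 \<le> u a" if "a \<in> A" for a
    using that \<rho> dn_sub by (auto simp: u intro!: sum_nonneg)
  define q where "q a = u a / (l + (\<Sum>b\<in>up a. u b))\<^sup>2" for a
  have q0: "0 \<le> q a" if "a \<in> A" for a using u0[OF that] by (simp add: q_def)
  have "(\<Sum>a\<in>dn \<beta>. (u a)\<^sup>2 / (l + (\<Sum>b\<in>up a. u b))\<^sup>2) = (\<Sum>a\<in>dn \<beta>. \<Sum>y\<in>dn a. \<rho> y * q a)"
  proof (intro sum.cong refl)
    fix a assume "a \<in> dn \<beta>"
    then have "a \<in> A" by (simp add: dn_def)
    have "(u a)\<^sup>2 / (l + (\<Sum>b\<in>up a. u b))\<^sup>2 = u a * q a"
      by (simp add: q_def power2_eq_square)
    also have "\<dots> = (\<Sum>y\<in>dn a. \<rho> y * q a)" 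
      by (subst u[OF \<open>a \<in> A\<close>]) (simp add: sum_distrib_right)
    finally show "(u a)\<^sup>2 / (l + (\<Sum>b\<in>up a. u b))\<^sup>2 = (\<Sum>y\<in>dn a. \<rho> y * q a)" .
  qed
  also have "\<dots> = (\<Sum>a\<in>dn \<beta>. \<Sum>y\<in>{y\<in>dn \<beta>. y \<sqsubseteq> a}. \<rho> y * q a)"
    using \<beta> by (intro sum.cong refl) (auto simp: dn_def intro: le_trans)
  also have "\<dots> = (\<Sum>y\<in>dn \<beta>. \<Sum>a\<in>{a\<in>dn \<beta>. y \<sqsubseteq> a}. \<rho> y * q a)"
    by (rule sum.swap_restrict) auto
  also have "\<dots> \<le> (\<Sum>y\<in>dn \<beta>. \<Sum>a\<in>up y. \<rho> y * q a)"
    using \<rho> q0 by (intro sum_mono sum_mono2 finite_up) (auto simp: up_def dn_def)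
  also have "\<dots> = (\<Sum>y\<in>dn \<beta>. \<rho> y * (\<Sum>a\<in>up y. q a))" by (simp add: sum_distrib_left)
  also have "\<dots> \<le> (\<Sum>y\<in>dn \<beta>. \<rho> y * (1 / l))"
  proof (intro sum_mono mult_left_mono)
    fix y assume "y \<in> dn \<beta>"
    then have y: "y \<in> A" by (simp add: dn_def)
    have "0 \<le> 1 / (l + (\<Sum>b\<in>up y. u b))"
      using l u0 up_sub by (intro divide_nonneg_nonneg add_nonneg_nonneg sum_nonneg) auto
    then show "(\<Sum>a\<in>up y. q a) \<le> 1 / l"
      using sum_div_square_le[of l u y, OF l u0 y] unfolding q_def by linarith
    show "0 \<le> \<rho> y" using \<rho> y .
  qed
  also have "\<dots> = u \<beta> / l" by (simp add: u[OF \<beta>] sum_divide_distrib)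
  finally show ?thesis .
qed

end

section \<open>The Hardy operator on a product of two forests\<close>

locale bitree = T1: finite_forest A leA + T2: finite_forest B leB
  for A :: "'a set" and leA and B :: "'b set" and leB
begin

definition pairing :: "('a \<Rightarrow> 'b \<Rightarrow> real) \<Rightarrow> ('a \<Rightarrow> 'b \<Rightarrow> real) \<Rightarrow> real" where
  "pairing f g = (\<Sum>a\<in>A. \<Sum>b\<in>B. f a b * g a b)"

text \<open>The two-parameter Hardy operator \<open>hardy\<close> sums over all pairs of ancestors; \<open>hardy1\<close> and \<open>hardy2\<close> sum in
one of the two parameters only. For a mass distribution \<open>\<nu>\<close>, the function \<open>hardy_adj \<nu>\<close> gives the mass
below a node and \<open>hardy (hardy_adj \<nu>)\<close> is the potential of \<open>\<nu>\<close> for the kernel that counts common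
ancestors.\<close>

definition hardy1 :: "('a \<Rightarrow> 'b \<Rightarrow> real) \<Rightarrow> 'a \<Rightarrow> 'b \<Rightarrow> real" where
  "hardy1 f a b = (\<Sum>a'\<in>T1.up a. f a' b)"

definition hardy2 :: "('a \<Rightarrow> 'b \<Rightarrow> real) \<Rightarrow> 'a \<Rightarrow> 'b \<Rightarrow> real" where
  "hardy2 f a b = (\<Sum>b'\<in>T2.up b. f a b')"

definition hardy :: "('a \<Rightarrow> 'b \<Rightarrow> real) \<Rightarrow> 'a \<Rightarrow> 'b \<Rightarrow> real" where
  "hardy f a b = (\<Sum>a'\<in>T1.up a. \<Sum>b'\<in>T2.up b. f a' b')"

definition hardy_adj :: "('a \<Rightarrow> 'b \<Rightarrow> real) \<Rightarrow> 'a \<Rightarrow> 'b \<Rightarrow> real" where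
  "hardy_adj f a b = (\<Sum>a'\<in>T1.dn a. \<Sum>b'\<in>T2.dn b. f a' b')"

definition nonneg :: "('a \<Rightarrow> 'b \<Rightarrow> real) \<Rightarrow> bool" where
  "nonneg f \<longleftrightarrow> (\<forall>a\<in>A. \<forall>b\<in>B. 0 \<le> f a b)"

lemma nonnegD: "nonneg f \<Longrightarrow> a \<in> A \<Longrightarrow> b \<in> B \<Longrightarrow> 0 \<le> f a b"
  by (simp add: nonneg_def)

lemma upA: "a' \<in> T1.up a \<Longrightarrow> a' \<in> A" and dnA: "a' \<in> T1.dn a \<Longrightarrow> a' \<in> A"
  and upB: "b' \<in> T2.up b \<Longrightarrow> b' \<in> B" and dnB: "b' \<in> T2.dn b \<Longrightarrow> b' \<in> B"
  by (auto simp: T1.up_def T1.dn_def T2.up_def T2.dn_def)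

lemma hardy_nonneg: "nonneg f \<Longrightarrow> nonneg (hardy f)"
  unfolding nonneg_def hardy_def by (auto intro!: sum_nonneg dest: upA upB)

lemma hardy1_nonneg: "nonneg f \<Longrightarrow> nonneg (hardy1 f)"
  unfolding nonneg_def hardy1_def by (auto intro!: sum_nonneg dest: upA upB)

lemma hardy2_nonneg: "nonneg f \<Longrightarrow> nonneg (hardy2 f)"
  unfolding nonneg_def hardy2_def by (auto intro!: sum_nonneg dest: upA upB)

lemma hardy_adj_nonneg: "nonneg f \<Longrightarrow> nonneg (hardy_adj f)"
  unfolding nonneg_def hardy_adj_def by (auto intro!: sum_nonneg dest: dnA dnB)

lemma hardy_eq12: "hardy f a b = (\<Sum>a'\<in>T1.up a. hardy2 f a' b)"
  by (simp add: hardy_def hardy2_def)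

lemma hardy_eq21: "hardy f a b = (\<Sum>b'\<in>T2.up b. hardy1 f a b')"
  unfolding hardy_def hardy1_def by (rule sum.swap)

lemma pairing_commute: "pairing f g = pairing g f"
  by (simp add: pairing_def mult.commute)

lemma pairing_mono:
  assumes "\<And>a b. a \<in> A \<Longrightarrow> b \<in> B \<Longrightarrow> f a b * g a b \<le> f' a b * g' a b"
  shows "pairing f g \<le> pairing f' g'"
  unfolding pairing_def by (intro sum_mono assms)

lemma pairing_nonneg: "nonneg f \<Longrightarrow> nonneg g \<Longrightarrow> 0 \<le> pairing f g"
  unfolding pairing_def nonneg_def by (intro sum_nonneg) auto

lemma pairing_self_nonneg: "0 \<le> pairing f f"
  unfolding pairing_def by (intro sum_nonneg) auto

lemma pairing_Cauchy_Schwarz: "(pairing f g)\<^sup>2 \<le> pairing f f * pairing g g"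
proof -
  have *: "pairing u v = (\<Sum>p\<in>A \<times> B. u (fst p) (snd p) * v (fst p) (snd p))" for u v
    unfolding pairing_def by (simp add: sum.cartesian_product case_prod_beta)
  show ?thesis unfolding *
    using Cauchy_Schwarz_ineq_sum[of "\<lambda>p. f (fst p) (snd p)" "\<lambda>p. g (fst p) (snd p)" "A \<times> B"]
    by (simp add: power2_eq_square)
qed

lemma pairing_hardy: "pairing (hardy f) g = pairing f (hardy_adj g)"
proof -
  have "pairing (hardy f) g = (\<Sum>a\<in>A. \<Sum>a'\<in>T1.up a. \<Sum>b\<in>B. \<Sum>b'\<in>T2.up b. f a' b' * g a b)"
    unfolding pairing_def hardy_def sum_distrib_right
    by (intro sum.cong refl) (rule sum.swap)
  also have "\<dots> = (\<Sum>a'\<in>A. \<Sum>a\<in>T1.dn a'. \<Sum>b\<in>B. \<Sum>b'\<in>T2.up b. f a' b' * g a b)"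
    by (rule T1.sum_up_dn_swap)
  also have "\<dots> = (\<Sum>a'\<in>A. \<Sum>a\<in>T1.dn a'. \<Sum>b'\<in>B. \<Sum>b\<in>T2.dn b'. f a' b' * g a b)"
    by (simp add: T2.sum_up_dn_swap)
  also have "\<dots> = pairing f (hardy_adj g)"
    unfolding pairing_def hardy_adj_def sum_distrib_left
    by (intro sum.cong refl) (rule sum.swap)
  finally show ?thesis .
qed

lemma hardy_mono_point:
  assumes f: "nonneg f" and "a \<in> A" "b \<in> B" "a' \<in> T1.up a" "b' \<in> T2.up b"
  shows "hardy f a' b' \<le> hardy f a b"
proof -
  have "hardy f a' b' \<le> (\<Sum>x\<in>T1.up a'. \<Sum>y\<in>T2.up b. f x y)"
    unfolding hardy_def using assms T2.up_mono[of b b']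
    by (intro sum_mono sum_mono2) (auto dest!: upA upB intro: nonnegD)
  also have "\<dots> \<le> hardy f a b"
    unfolding hardy_def using assms T1.up_mono[of a a']
    by (intro sum_mono2) (auto dest!: upA upB intro!: sum_nonneg nonnegD)
  finally show ?thesis .
qed

text \<open>In each of the two parameters a pair of ancestors can be ordered in two ways. The orderings that
agree in both parameters produce \<open>f * hardy f\<close>, the two mixed ones produce \<open>hardy1 f * hardy2 f\<close>.\<close>

lemma hardy_square_le:
  assumes f: "nonneg f" and a: "a \<in> A" and b: "b \<in> B"
  shows "(hardy f a b)\<^sup>2 \<le> 2 * hardy (\<lambda>x y. f x y * hardy f x y) a b
    + 2 * hardy (\<lambda>x y. hardy1 f x y * hardy2 f x y) a b"
proof -
  have "(hardy f a b)\<^sup>2 \<le> 2 * (\<Sum>x\<in>T1.up a. hardy2 f x b * (\<Sum>z\<in>T1.up x. hardy2 f z b))"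
    unfolding hardy_eq12 using nonnegD[OF hardy2_nonneg[OF f] _ b]
    by (intro T1.sum_square_le_chain a)
  also have "\<dots> \<le> 2 * (\<Sum>x\<in>T1.up a. (\<Sum>y\<in>T2.up b. f x y * hardy f x y)
                              + (\<Sum>y\<in>T2.up b. hardy1 f x y * hardy2 f x y))"
  proof (intro mult_left_mono sum_mono)
    fix x assume "x \<in> T1.up a"
    then have x: "x \<in> A" by (rule upA)
    have "hardy2 f x b * (\<Sum>z\<in>T1.up x. hardy2 f z b) = (\<Sum>y\<in>T2.up b. f x y) * (\<Sum>y\<in>T2.up b. hardy1 f x y)"
      unfolding hardy_eq12[symmetric] hardy_eq21 by (simp add: hardy2_def)
    also have "\<dots> \<le> (\<Sum>y\<in>T2.up b. f x y * (\<Sum>z\<in>T2.up y. hardy1 f x z))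
                 + (\<Sum>y\<in>T2.up b. hardy1 f x y * (\<Sum>z\<in>T2.up y. f x z))"
      using nonnegD[OF f x] nonnegD[OF hardy1_nonneg[OF f] x] by (intro T2.sum_mult_le_chain b)
    finally show "hardy2 f x b * (\<Sum>z\<in>T1.up x. hardy2 f z b) \<le> (\<Sum>y\<in>T2.up b. f x y * hardy f x y)
                              + (\<Sum>y\<in>T2.up b. hardy1 f x y * hardy2 f x y)"
      by (simp add: hardy_eq21 hardy2_def)
  qed auto
  finally show ?thesis by (simp add: hardy_def sum.distrib)
qed

text \<open>Conversely the mixed pairs are only some of the pairs of ancestors, so the cross term is controlled by
the square.\<close>

lemma hardy_cross_le_square:
  assumes f: "nonneg f" and a: "a \<in> A" and b: "b \<in> B"
  shows "hardy (\<lambda>x y. hardy1 f x y * hardy2 f x y) a b \<le> (hardy f a b)\<^sup>2"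
proof -
  have "hardy (\<lambda>x y. hardy1 f x y * hardy2 f x y) a b
     \<le> (\<Sum>x\<in>T1.up a. \<Sum>y\<in>T2.up b. hardy1 f x y * hardy2 f x b)"
    unfolding hardy_def
  proof (intro sum_mono mult_left_mono)
    fix x y assume "x \<in> T1.up a" "y \<in> T2.up b"
    then have xy: "x \<in> A" "y \<in> B" by (auto dest: upA upB)
    then show "0 \<le> hardy1 f x y" using nonnegD[OF hardy1_nonneg[OF f]] by simp
    show "hardy2 f x y \<le> hardy2 f x b"
      unfolding hardy2_def using T2.up_mono[OF b \<open>y \<in> T2.up b\<close>]  nonnegD[OF f] xy upB
      by (intro sum_mono2) auto
  qed
  also have "\<dots> = (\<Sum>x\<in>T1.up a. hardy f x b * hardy2 f x b)"
    by (simp add: hardy_eq21 sum_distrib_right)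
  also have "\<dots> \<le> (\<Sum>x\<in>T1.up a. hardy f a b * hardy2 f x b)"
    using nonnegD[OF hardy2_nonneg[OF f]] b T2.self_in_up[OF b]
    by (intro sum_mono mult_right_mono hardy_mono_point f a) (auto dest: upA)
  also have "\<dots> = (hardy f a b)\<^sup>2"
    by (simp add: hardy_eq12 sum_distrib_left power2_eq_square)
  finally show ?thesis .
qed

text \<open>For a fixed second coordinate, \<open>hardy2 (hardy_adj \<nu>)\<close> is again the distribution function of a mass on the
first forest. This makes the one-parameter lemma \<open>T1.sum_below_le\<close> applicable to it.\<close>

lemma hardy2_hardy_adj:
  "\<exists>\<rho>. (nonneg \<nu> \<longrightarrow> (\<forall>y\<in>A. 0 \<le> \<rho> y)) \<and> (\<forall>a\<in>A. hardy2 (hardy_adj \<nu>) a b = (\<Sum>y\<in>T1.dn a. \<rho> y))"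
proof (intro exI[of _ "\<lambda>y. \<Sum>b'\<in>T2.up b. \<Sum>b''\<in>T2.dn b'. \<nu> y b''"] conjI impI ballI)
  fix y assume "nonneg \<nu>" "y \<in> A"
  then show "0 \<le> (\<Sum>b'\<in>T2.up b. \<Sum>b''\<in>T2.dn b'. \<nu> y b'')"
    by (auto intro!: sum_nonneg nonnegD dest: dnB)
next
  fix a assume "a \<in> A"
  show "hardy2 (hardy_adj \<nu>) a b = (\<Sum>y\<in>T1.dn a. \<Sum>b'\<in>T2.up b. \<Sum>b''\<in>T2.dn b'. \<nu> y b'')"
    unfolding hardy2_def hardy_adj_def by (rule sum.swap)
qed

text \<open>The function \<open>h\<close> is the majorant of the next lemma. Its energy would only be bounded by \<open>k\<close> times the mass
if estimated by the energy of \<open>\<nu>\<close>; the denominator gains the factor \<open>k / l\<close>. One factor \<open>(hardy1 f)\<^sup>2\<close> is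
opened along chains of the first forest and the remaining sum over descendants is
telescoped by \<open>T1.sum_below_le\<close>. What is left is the cross term tested against \<open>\<nu>\<close>, which lives where the potential
is at most \<open>k\<close>.\<close>

lemma cross_energy_le:
  assumes \<nu>: "nonneg \<nu>" and l: "l > 0" and k: "k \<ge> 0"
    and bound: "\<And>a b. a \<in> A \<Longrightarrow> b \<in> B \<Longrightarrow> \<nu> a b > 0 \<Longrightarrow> hardy (hardy_adj \<nu>) a b \<le> k"
  defines "f \<equiv> hardy_adj \<nu>"
  defines "h \<equiv> \<lambda>a b. hardy1 f a b * hardy2 f a b / (l + hardy f a b)"
  shows "pairing h h \<le> 2 * k\<^sup>2 / l * pairing \<nu> (\<lambda>_ _. 1)"
proof -
  have f: "nonneg f" unfolding f_def by (rule hardy_adj_nonneg[OF \<nu>])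
  have f1: "nonneg (hardy1 f)" and f2: "nonneg (hardy2 f)" and ff: "nonneg (hardy f)"
    using f by (auto intro: hardy1_nonneg hardy2_nonneg hardy_nonneg)
  define q where "q a b = (hardy2 f a b)\<^sup>2 / (l + hardy f a b)\<^sup>2" for a b
  have "pairing h h = (\<Sum>b\<in>B. \<Sum>a\<in>A. (hardy1 f a b)\<^sup>2 * q a b)"
    unfolding pairing_def h_def q_def
    by (subst sum.swap) (simp add: power2_eq_square field_simps)
  also have "\<dots> \<le> (\<Sum>b\<in>B. \<Sum>a\<in>A. (2 * (\<Sum>x\<in>T1.up a. f x b * hardy1 f x b)) * q a b)"
  proof (intro sum_mono mult_right_mono)
    fix a b assume ab: "b \<in> B" "a \<in> A"
    show "0 \<le> q a b" by (simp add: q_def)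
    show "(hardy1 f a b)\<^sup>2 \<le> 2 * (\<Sum>x\<in>T1.up a. f x b * hardy1 f x b)"
      unfolding hardy1_def using ab by (intro T1.sum_square_le_chain nonnegD[OF f])
  qed
  also have "\<dots> = (\<Sum>b\<in>B. \<Sum>a\<in>A. \<Sum>x\<in>T1.up a. 2 * (f x b * hardy1 f x b * q a b))"
    by (simp add: sum_distrib_left sum_distrib_right mult_ac)
  also have "\<dots> = (\<Sum>b\<in>B. \<Sum>x\<in>A. \<Sum>a\<in>T1.dn x. 2 * (f x b * hardy1 f x b * q a b))"
    by (simp add: T1.sum_up_dn_swap)
  also have "\<dots> = (\<Sum>b\<in>B. \<Sum>x\<in>A. 2 * (f x b * hardy1 f x b) * (\<Sum>a\<in>T1.dn x. q a b))"
    by (simp add: sum_distrib_left mult_ac)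
  also have "\<dots> \<le> (\<Sum>b\<in>B. \<Sum>x\<in>A. 2 * (f x b * hardy1 f x b) * (hardy2 f x b / l))"
  proof (intro sum_mono mult_left_mono)
    fix x b assume xb: "b \<in> B" "x \<in> A"
    show "0 \<le> 2 * (f x b * hardy1 f x b)"
      using nonnegD[OF f] nonnegD[OF f1] xb by simp
    obtain \<rho> where \<rho>: "\<And>y. y \<in> A \<Longrightarrow> 0 \<le> \<rho> y" "\<And>a. a \<in> A \<Longrightarrow> hardy2 f a b = (\<Sum>y\<in>T1.dn a. \<rho> y)"
      using hardy2_hardy_adj[of \<nu> b] \<nu> unfolding f_def by blast
    show "(\<Sum>a\<in>T1.dn x. q a b) \<le> hardy2 f x b / l"
      unfolding q_def hardy_eq12 using xb by (intro T1.sum_below_le[where \<rho> = \<rho>] l \<rho>)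
  qed
  also have "\<dots> = 2 / l * pairing f (\<lambda>x y. hardy1 f x y * hardy2 f x y)"
    unfolding pairing_def sum_distrib_left by (subst sum.swap) (simp add: mult_ac)
  also have "pairing f (\<lambda>x y. hardy1 f x y * hardy2 f x y)
      = pairing \<nu> (hardy (\<lambda>x y. hardy1 f x y * hardy2 f x y))"
    unfolding f_def pairing_commute[of "hardy_adj \<nu>"] pairing_hardy[symmetric] by (rule pairing_commute)
  also have "2 / l * \<dots> \<le> 2 / l * pairing \<nu> (\<lambda>_ _. k\<^sup>2)"
  proof (rule mult_left_mono[OF pairing_mono])
    fix a b assume ab: "a \<in> A" "b \<in> B"
    show "\<nu> a b * hardy (\<lambda>x y. hardy1 f x y * hardy2 f x y) a b \<le> \<nu> a b * k\<^sup>2"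
    proof (cases "\<nu> a b > 0")
      case True
      have "hardy (\<lambda>x y. hardy1 f x y * hardy2 f x y) a b \<le> (hardy f a b)\<^sup>2"
        by (rule hardy_cross_le_square[OF f ab])
      also have "\<dots> \<le> k\<^sup>2"
        using bound[OF ab True] nonnegD[OF ff ab] by (intro power_mono) (auto simp: f_def)
      finally show ?thesis using True by simp
    next
      case False
      then have "\<nu> a b = 0" using nonnegD[OF \<nu> ab] by simp
      then show ?thesis by simp
    qed
  qed (use l in auto)
  also have "\<dots> = 2 * k\<^sup>2 / l * pairing \<nu> (\<lambda>_ _. 1)"
    by (simp add: pairing_def sum_distrib_left sum_distrib_right sum_divide_distrib mult_ac)
  finally show ?thesis .
qed

lemma hardy_scale: "hardy (\<lambda>x y. c * f x y) a b = c * hardy f a b"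
  by (simp add: hardy_def sum_distrib_left)

lemma hardy_mono:
  assumes "\<And>x y. x \<in> T1.up a \<Longrightarrow> y \<in> T2.up b \<Longrightarrow> f x y \<le> g x y"
  shows "hardy f a b \<le> hardy g a b"
  unfolding hardy_def by (intro sum_mono assms)

lemma hardy_adj_mono:
  assumes "\<And>x y. x \<in> A \<Longrightarrow> y \<in> B \<Longrightarrow> f x y \<le> g x y"
  shows "hardy_adj f a b \<le> hardy_adj g a b"
  unfolding hardy_adj_def by (intro sum_mono assms) (auto dest: dnA dnB)

text \<open>This replaces the maximum principle. At a node with a descendant charged by \<open>\<nu>\<close> the potential is at most \<open>k\<close>,
because potentials decrease towards the ancestors; so the first term of \<open>hardy_square_le\<close> is at most \<open>k\<close> times the
potential and cannot account for a potential larger than \<open>4 * k\<close>. Hence there the cross term carries a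
quarter of the square, and dividing by \<open>l + hardy f\<close>, which is largest at the node itself,
brings it back to the size of the potential.\<close>

lemma potential_le_majorant:
  assumes \<nu>: "nonneg \<nu>" and k: "k > 0" and l: "l \<ge> 4 * k" and ab: "a \<in> A" "b \<in> B"
    and bound: "\<And>a b. a \<in> A \<Longrightarrow> b \<in> B \<Longrightarrow> \<nu> a b > 0 \<Longrightarrow> hardy (hardy_adj \<nu>) a b \<le> k"
  defines "f \<equiv> hardy_adj \<nu>"
  defines "h \<equiv> \<lambda>a b. hardy1 f a b * hardy2 f a b / (l + hardy f a b)"
  assumes big: "hardy f a b \<ge> l"
  shows "hardy f a b \<le> 8 * hardy h a b"
proof -
  have f: "nonneg f" unfolding f_def by (rule hardy_adj_nonneg[OF \<nu>])
  have f1: "nonneg (hardy1 f)" and f2: "nonneg (hardy2 f)" and ff: "nonneg (hardy f)"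
    using f by (auto intro: hardy1_nonneg hardy2_nonneg hardy_nonneg)
  define V where "V = hardy f a b"
  define W where "W = hardy (\<lambda>x y. hardy1 f x y * hardy2 f x y) a b"
  have l0: "l > 0" and V: "V \<ge> l" using l k big by (auto simp: V_def)
  have le_k: "f x y * hardy f x y \<le> k * f x y" if xy: "x \<in> A" "y \<in> B" for x y
  proof (cases "f x y = 0")
    case False
    then obtain x' where x': "x' \<in> T1.dn x" "(\<Sum>b'\<in>T2.dn y. \<nu> x' b') \<noteq> 0"
      unfolding f_def hardy_adj_def by (meson sum.not_neutral_contains_not_neutral)
    then obtain y' where y': "y' \<in> T2.dn y" "\<nu> x' y' \<noteq> 0"
      by (meson sum.not_neutral_contains_not_neutral)
    have x'A: "x' \<in> A" "y' \<in> B" using x' y' by (auto dest: dnA dnB)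
    have "\<nu> x' y' > 0" using nonnegD[OF \<nu> x'A] y'(2) by simp
    then have "hardy f x' y' \<le> k" using bound x'A by (simp add: f_def)
    moreover have "hardy f x y \<le> hardy f x' y'"
      using x' y' x'A xy by (intro hardy_mono_point f) (auto simp: T1.up_def T1.dn_def T2.up_def T2.dn_def)
    ultimately have "hardy f x y \<le> k" by simp
    from mult_left_mono[OF this nonnegD[OF f xy]] show ?thesis by (simp add: mult.commute)
  qed simp
  have "V\<^sup>2 \<le> 2 * hardy (\<lambda>x y. f x y * hardy f x y) a b + 2 * W"
    unfolding V_def W_def by (rule hardy_square_le[OF f ab])
  also have "hardy (\<lambda>x y. f x y * hardy f x y) a b \<le> hardy (\<lambda>x y. k * f x y) a b"
    by (intro hardy_mono le_k) (auto dest: upA upB)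
  also have "\<dots> = k * V" by (simp add: hardy_scale V_def)
  finally have "V\<^sup>2 \<le> 2 * (k * V) + 2 * W" by simp
  moreover have "4 * (k * V) \<le> V\<^sup>2"
    using V l l0 mult_right_mono[of "4 * k" V V] by (simp add: power2_eq_square)
  ultimately have W: "V\<^sup>2 \<le> 4 * W" by linarith
  have "W / (l + V) \<le> hardy h a b"
  proof -
    have "W / (l + V) = hardy (\<lambda>x y. (1 / (l + V)) * (hardy1 f x y * hardy2 f x y)) a b"
      by (simp only: hardy_scale W_def) simp
    also have "\<dots> \<le> hardy h a b"
    proof (intro hardy_mono)
      fix x y assume xy: "x \<in> T1.up a" "y \<in> T2.up b"
      then have xyA: "x \<in> A" "y \<in> B" by (auto dest: upA upB)
      have le: "hardy f x y \<le> V" unfolding V_def by (rule hardy_mono_point[OF f ab xy])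
      have "hardy1 f x y * hardy2 f x y / (l + V) \<le> h x y"
        unfolding h_def using le l0 nonnegD[OF f1 xyA] nonnegD[OF f2 xyA] nonnegD[OF ff xyA] 
        by (intro divide_left_mono mult_nonneg_nonneg mult_pos_pos) auto
      then show "1 / (l + V) * (hardy1 f x y * hardy2 f x y) \<le> h x y" by simp
    qed
    finally show ?thesis .
  qed
  moreover have "V \<le> 8 * (W / (l + V))"
  proof -
    have "V * (l + V) \<le> V * (2 * V)" using V l0 by (intro mult_left_mono) auto
    also have "\<dots> \<le> 8 * W" using W by (simp add: power2_eq_square)
    finally show ?thesis using V l0 by (simp add: field_simps)
  qed
  ultimately show ?thesis by (simp add: V_def)
qed

definition restr :: "('a \<times> 'b) set \<Rightarrow> ('a \<Rightarrow> 'b \<Rightarrow> real) \<Rightarrow> 'a \<Rightarrow> 'b \<Rightarrow> real" where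
  "restr F m a b = (if (a, b) \<in> F then m a b else 0)"

definition mass :: "('a \<Rightarrow> 'b \<Rightarrow> real) \<Rightarrow> real" where
  "mass m = pairing m (\<lambda>_ _. 1)"

text \<open>The energy of the restriction of \<open>m\<close> to a set is controlled by its mass, for every set of nodes. This is
the form in which the capacity condition enters.\<close>

definition restricted_energy_bound :: "('a \<Rightarrow> 'b \<Rightarrow> real) \<Rightarrow> real \<Rightarrow> bool" where
  "restricted_energy_bound m K \<longleftrightarrow>
     (\<forall>F \<subseteq> A \<times> B. pairing (hardy_adj (restr F m)) (hardy_adj (restr F m)) \<le> K * mass (restr F m))"

lemma restr_nonneg: "nonneg m \<Longrightarrow> nonneg (restr F m)"
  by (simp add: nonneg_def restr_def)

lemma mass_nonneg: "nonneg m \<Longrightarrow> 0 \<le> mass m"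
  unfolding mass_def by (intro pairing_nonneg) (auto simp: nonneg_def)

lemma restr_pairing_hardy_square_le:
  assumes "restricted_energy_bound m K" "F \<subseteq> A \<times> B"
  shows "(pairing (hardy h) (restr F m))\<^sup>2 \<le> pairing h h * (K * mass (restr F m))"
proof -
  have "(pairing (hardy h) (restr F m))\<^sup>2 \<le> pairing h h * pairing (hardy_adj (restr F m)) (hardy_adj (restr F m))"
    unfolding pairing_hardy by (rule pairing_Cauchy_Schwarz)
  also have "\<dots> \<le> pairing h h * (K * mass (restr F m))"
    using assms pairing_self_nonneg by (intro mult_left_mono) (auto simp: restricted_energy_bound_def)
  finally show ?thesis .
qed

text \<open>By the restricted energy bound the potential of \<open>m\<close> on \<open>F\<close> has mean at most \<open>K\<close>. Keeping only the
nodes where it is at most \<open>2 * K\<close> loses at most half of the mass and turns the bound in the mean into a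
pointwise one, the role played by equilibrium measures in the classical argument.\<close>

definition small_part :: "real \<Rightarrow> ('a \<Rightarrow> 'b \<Rightarrow> real) \<Rightarrow> ('a \<times> 'b) set \<Rightarrow> ('a \<times> 'b) set" where
  "small_part K m F = {(a, b) \<in> F. hardy (hardy_adj (restr F m)) a b \<le> 2 * K}"

lemma mass_le_small_part:
  assumes m: "nonneg m" and K: "K > 0" and R: "restricted_energy_bound m K" and F: "F \<subseteq> A \<times> B"
  shows "mass (restr F m) \<le> 2 * mass (restr (small_part K m F) m)"
proof -
  define V where "V = hardy (hardy_adj (restr F m))"
  have V0: "nonneg V" unfolding V_def by (intro hardy_nonneg hardy_adj_nonneg restr_nonneg m)
  have "2 * K * (mass (restr F m) - mass (restr (small_part K m F) m))
      = pairing (\<lambda>a b. restr F m a b - restr (small_part K m F) m a b) (\<lambda>_ _. 2 * K)"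
    by (simp add: mass_def pairing_def sum_distrib_left sum_subtractf algebra_simps)
  also have "\<dots> \<le> pairing V (restr F m)"
  proof (rule pairing_mono)
    fix a b assume "a \<in> A" "b \<in> B"
    then have "0 \<le> V a b" "0 \<le> m a b" using V0 m by (auto simp: nonneg_def)
    then show "(restr F m a b - restr (small_part K m F) m a b) * (2 * K) \<le> V a b * restr F m a b"
      using mult_right_mono[of "2 * K" "V a b" "m a b"]
      by (auto simp: restr_def small_part_def V_def mult_ac)
  qed
  also have "\<dots> = pairing (hardy_adj (restr F m)) (hardy_adj (restr F m))"
    unfolding V_def by (rule pairing_hardy)
  also have "\<dots> \<le> K * mass (restr F m)"
    using R F by (simp add: restricted_energy_bound_def)
  finally have "K * mass (restr F m) \<le> K * (2 * mass (restr (small_part K m F) m))"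
    by (simp add: algebra_simps)
  then show ?thesis using K by simp
qed

lemma potential_small_part_le:
  assumes m: "nonneg m" and F: "F \<subseteq> A \<times> B" and ab: "a \<in> A" "b \<in> B"
    and pos: "restr (small_part K m F) m a b > 0"
  shows "hardy (hardy_adj (restr (small_part K m F) m)) a b \<le> 2 * K"
proof -
  have "hardy (hardy_adj (restr (small_part K m F) m)) a b \<le> hardy (hardy_adj (restr F m)) a b"
    using m by (intro hardy_mono hardy_adj_mono) (auto simp: restr_def small_part_def nonneg_def)
  also have "\<dots> \<le> 2 * K"
    using pos by (auto simp: restr_def small_part_def split: if_splits)
  finally show ?thesis .
qed

text \<open>The mutual energy of two level sets with heights \<open>w\<close> and \<open>16 ^ d * w\<close>. The Cauchy--Schwarz inequality alone
yields no decay in \<open>d\<close>. Below the threshold \<open>l\<close> the potential of \<open>\<nu>\<close> is estimated trivially, and above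
it by the majorant of small energy.\<close>

lemma pairing_energy_decay:
  assumes m: "nonneg m" and K: "K > 0" and R: "restricted_energy_bound m K"
    and F: "F \<subseteq> A \<times> B" and F': "F' \<subseteq> A \<times> B" and w: "w \<ge> 0"
  defines "\<nu> \<equiv> restr (small_part K m F) m" and "\<mu> \<equiv> restr (small_part K m F') m"
  shows "w * (16 ^ d * w) * pairing (hardy_adj \<nu>) (hardy_adj \<mu>)
     \<le> 8 * K * (1/2) ^ d * (w\<^sup>2 * mass \<nu> + 2 * ((16 ^ d * w)\<^sup>2 * mass \<mu>))"
proof -
  define k where "k = 2 * K"
  \<comment> \<open>The trivial part has relative size \<open>4 ^ d / 16 ^ d\<close> and the part above the threshold \<open>4 ^ (- d / 2)\<close>:
both decay geometrically.\<close>
  define l where "l = 4 * k * 4 ^ d"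
  have k: "k > 0" and l: "l > 0" "l \<ge> 4 * k" using K by (auto simp: k_def l_def)
  have \<nu>: "nonneg \<nu>" and \<mu>: "nonneg \<mu>" unfolding \<nu>_def \<mu>_def by (auto intro: restr_nonneg m)
  have bound: "hardy (hardy_adj \<nu>) a b \<le> k" if "a \<in> A" "b \<in> B" "\<nu> a b > 0" for a b
    using potential_small_part_le[OF m F] that by (simp add: \<nu>_def k_def)
  define f where "f = hardy_adj \<nu>"
  define h where "h = (\<lambda>a b. hardy1 f a b * hardy2 f a b / (l + hardy f a b))"
  define P where "P = pairing (hardy h) \<mu>"
  define N where "N = mass \<nu>"
  define M where "M = mass \<mu>"
  have f: "nonneg f" unfolding f_def by (rule hardy_adj_nonneg[OF \<nu>])
  have f1: "nonneg (hardy1 f)" and f2: "nonneg (hardy2 f)" and ff: "nonneg (hardy f)"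
    using f by (auto intro: hardy1_nonneg hardy2_nonneg hardy_nonneg)
  have h: "nonneg h"
    using f1 f2 ff l(1) unfolding nonneg_def h_def
    by (auto intro!: divide_nonneg_nonneg mult_nonneg_nonneg add_nonneg_nonneg)
  have N0: "0 \<le> N" and M0: "0 \<le> M" using \<nu> \<mu> by (auto simp: N_def M_def intro: mass_nonneg)
  have P0: "0 \<le> P" unfolding P_def by (intro pairing_nonneg hardy_nonneg h \<mu>)
  have "pairing (hardy f) \<mu> \<le> pairing (\<lambda>a b. l + 8 * hardy h a b) \<mu>"
  proof (rule pairing_mono, rule mult_right_mono)
    fix a b assume ab: "a \<in> A" "b \<in> B"
    have "0 \<le> hardy h a b" using hardy_nonneg[OF h] ab by (simp add: nonneg_def)
    moreover have "hardy f a b \<le> 8 * hardy h a b" if "hardy f a b \<ge> l"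
      using potential_le_majorant[OF \<nu> k l(2) ab bound] that by (simp add: f_def h_def)
    ultimately show "hardy f a b \<le> l + 8 * hardy h a b"
      using l(1) by (cases "hardy f a b \<ge> l") auto
    show "0 \<le> \<mu> a b" using \<mu> ab by (simp add: nonneg_def)
  qed
  also have "\<dots> = l * M + 8 * P"
    by (simp add: pairing_def M_def P_def mass_def sum_distrib_left sum.distrib algebra_simps)
  finally have first: "pairing f (hardy_adj \<mu>) \<le> l * M + 8 * P" by (simp add: pairing_hardy)
  have "P\<^sup>2 \<le> pairing h h * (K * M)"
    unfolding P_def M_def \<mu>_def using F'
    by (intro restr_pairing_hardy_square_le R) (auto simp: small_part_def)
  also have "\<dots> \<le> (2 * k\<^sup>2 / l * N) * (K * M)"
    unfolding N_def mass_def h_def f_def using l(1) k K M0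
    by (intro mult_right_mono cross_energy_le \<nu> bound) auto
  also have "\<dots> = (k * (1/2) ^ d / 2)\<^sup>2 * (N * M)"
  proof -
    have "(2::real) ^ d * 2 ^ d = 4 ^ d" by (simp flip: power_mult_distrib)
    then show ?thesis
      using k by (simp add: l_def power2_eq_square field_simps power_divide) (simp add: k_def)
  qed
  finally have P2: "P\<^sup>2 \<le> (k * (1/2) ^ d / 2)\<^sup>2 * (N * M)" .
  define v where "v = 16 ^ d * w"
  have v: "v \<ge> 0" using w by (simp add: v_def)
  have "w * v * P \<le> k * (1/2) ^ d / 4 * (w\<^sup>2 * N + v\<^sup>2 * M)"
  proof (rule power2_le_imp_le)
    have "(w * v * P)\<^sup>2 = (w * v)\<^sup>2 * P\<^sup>2" by (simp add: power_mult_distrib)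
    also have "\<dots> \<le> (w * v)\<^sup>2 * ((k * (1/2) ^ d / 2)\<^sup>2 * (N * M))"
      by (intro mult_left_mono P2) simp
    also have "\<dots> = (k * (1/2) ^ d / 4)\<^sup>2 * (4 * (w\<^sup>2 * N) * (v\<^sup>2 * M))"
      by (simp add: power2_eq_square algebra_simps)
    also have "\<dots> \<le> (k * (1/2) ^ d / 4)\<^sup>2 * (w\<^sup>2 * N + v\<^sup>2 * M)\<^sup>2"
    proof (rule mult_left_mono)
      have "0 \<le> (w\<^sup>2 * N - v\<^sup>2 * M)\<^sup>2" by simp
      then show "4 * (w\<^sup>2 * N) * (v\<^sup>2 * M) \<le> (w\<^sup>2 * N + v\<^sup>2 * M)\<^sup>2"
        by (simp add: power2_eq_square algebra_simps)
    qed simp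
    also have "\<dots> = (k * (1/2) ^ d / 4 * (w\<^sup>2 * N + v\<^sup>2 * M))\<^sup>2"
      by (simp only: power_mult_distrib)
    finally show "(w * v * P)\<^sup>2 \<le> \<dots>" .
    show "0 \<le> k * (1/2) ^ d / 4 * (w\<^sup>2 * N + v\<^sup>2 * M)" using k N0 M0 by simp
  qed
  moreover have "w * v * (l * M) \<le> 4 * k * (1/2) ^ d * (v\<^sup>2 * M)"
  proof -
    have "(4::real) ^ d * (1/16) ^ d = (1/4) ^ d" by (simp flip: power_mult_distrib)
    also have "\<dots> \<le> (1/2) ^ d" by (intro power_mono) auto
    finally have "(4::real) ^ d * (1/16) ^ d \<le> (1/2) ^ d" .
    then have "4 * k * (4 ^ d * (1/16) ^ d) * (v\<^sup>2 * M) \<le> 4 * k * (1/2) ^ d * (v\<^sup>2 * M)"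
      using k M0 by (intro mult_right_mono mult_left_mono) auto
    moreover have "w = (1/16) ^ d * v" by (simp add: v_def power_one_over)
    ultimately show ?thesis by (simp add: l_def power2_eq_square mult_ac)
  qed
  moreover have "w * v * pairing f (hardy_adj \<mu>) \<le> w * v * (l * M + 8 * P)"
    using first w v by (intro mult_left_mono) auto
  moreover have "0 \<le> k * (1/2) ^ d * (w\<^sup>2 * N)" "0 \<le> k * (1/2) ^ d * (v\<^sup>2 * M)"
    using k N0 M0 by auto
  ultimately have "w * v * pairing f (hardy_adj \<mu>) \<le> 4 * k * (1/2) ^ d * (w\<^sup>2 * N + 2 * (v\<^sup>2 * M))"
    by (simp add: algebra_simps)
  then show ?thesis by (simp add: k_def f_def v_def N_def M_def)
qed

end

lemma sum_half_power_le:
  fixes i n :: nat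
  shows "(\<Sum>j\<in>{i..<n}. (1/2::real) ^ (j - i)) \<le> 2" "(\<Sum>i\<le>n. (1/2::real) ^ (n - i)) \<le> 2"
proof -
  have geo: "(\<Sum>j<k. (1/2::real) ^ j) \<le> 2" for k
    by (subst sum_gp_strict) simp
  have "(\<Sum>j\<in>{i..<n}. (1/2::real) ^ (j - i)) = (\<Sum>j<n - i. (1/2) ^ j)"
    by (rule sum.reindex_bij_witness[of _ "\<lambda>j. j + i" "\<lambda>j. j - i"]) auto
  with geo show "(\<Sum>j\<in>{i..<n}. (1/2::real) ^ (j - i)) \<le> 2" by simp
  have "(\<Sum>i\<le>n. (1/2::real) ^ (n - i)) = (\<Sum>j<Suc n. (1/2) ^ j)"
    by (rule sum.reindex_bij_witness[of _ "\<lambda>j. n - j" "\<lambda>j. n - j"]) auto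
  with geo[of "Suc n"] show "(\<Sum>i\<le>n. (1/2::real) ^ (n - i)) \<le> 2" by simp
qed

context bitree
begin

lemma pairing_sum_left:
  "finite J \<Longrightarrow> pairing (\<lambda>a b. \<Sum>j\<in>J. c j * f j a b) g = (\<Sum>j\<in>J. c j * pairing (f j) g)"
proof -
  assume "finite J"
  have "pairing (\<lambda>a b. \<Sum>j\<in>J. c j * f j a b) g = (\<Sum>a\<in>A. \<Sum>b\<in>B. \<Sum>j\<in>J. c j * (f j a b * g a b))"
    unfolding pairing_def sum_distrib_right by (simp only: mult.assoc)
  also have "\<dots> = (\<Sum>a\<in>A. \<Sum>j\<in>J. \<Sum>b\<in>B. c j * (f j a b * g a b))"
    by (intro sum.cong refl sum.swap)
  also have "\<dots> = (\<Sum>j\<in>J. \<Sum>a\<in>A. \<Sum>b\<in>B. c j * (f j a b * g a b))"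
    by (rule sum.swap)
  finally show ?thesis by (simp add: pairing_def sum_distrib_left)
qed

text \<open>The potential \<open>hardy h\<close> is cut into level sets at the heights \<open>s * 16 ^ j\<close>. With \<open>T\<close> the sum of the squared
heights times the masses of the small parts, \<open>T\<close> is at most the pairing of \<open>h\<close> with
\<open>\<Phi>\<close>, and the square of the norm of \<open>\<Phi>\<close> is a sum of mutual energies that by \<open>pairing_energy_decay\<close> is at most a
multiple of \<open>T\<close>. So \<open>T\<^sup>2 \<le> C * K * T * pairing h h\<close>.\<close>

theorem bitree_embedding:
  assumes m: "nonneg m" and K: "K > 0" and R: "restricted_energy_bound m K" and h: "nonneg h"
  shows "pairing m (\<lambda>a b. (hardy h a b)\<^sup>2) \<le> 49152 * K * pairing h h"
proof -
  define u where "u = hardy h"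
  have u0: "0 \<le> u a b" if "a \<in> A" "b \<in> B" for a b
    using hardy_nonneg[OF h] that by (simp add: u_def nonneg_def)
  define U where "U = (\<lambda>(a, b). u a b) ` (A \<times> B)"
  have fU: "finite U" unfolding U_def using T1.finite_nodes T2.finite_nodes by auto
  \<comment> \<open>A lower bound for the positive values, so that the levels can be indexed by natural numbers.\<close>
  define s where "s = Min (insert 1 {t \<in> U. t > 0})"
  have s: "s > 0" using fU unfolding s_def by (subst Min_gr_iff) auto
  have s_le: "s \<le> u a b" if "a \<in> A" "b \<in> B" "u a b > 0" for a b
    unfolding s_def using fU that by (intro Min_le) (auto simp: U_def)
  define w where "w j = s * 16 ^ j" for j :: nat
  have w: "w j > 0" "w (i + d) = 16 ^ d * w i" for i j d using s by (auto simp: w_def power_add)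
  obtain n where n: "Max (insert 0 U) / s < 16 ^ n" using real_arch_pow[of "16::real"] by auto
  have u_less: "u a b < w n" if "a \<in> A" "b \<in> B" for a b
  proof -
    have "u a b \<le> Max (insert 0 U)" using fU that by (intro Max_ge) (auto simp: U_def)
    then show ?thesis using n s by (simp add: w_def field_simps)
  qed
  define F where "F j = {(a, b) \<in> A \<times> B. w j \<le> u a b \<and> u a b < w (Suc j)}" for j
  have F: "F j \<subseteq> A \<times> B" for j by (auto simp: F_def)
  have level: "\<exists>j<n. (a, b) \<in> F j" if ab: "a \<in> A" "b \<in> B" and pos: "u a b > 0" for a b
  proof -
    have ex: "\<exists>k. u a b < w (Suc k)" 
      using u_less[OF ab] w(2)[of n 1] w(1)[of n] by (intro exI[of _ n]) auto
    define j where "j = (LEAST k. u a b < w (Suc k))"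
    have j: "u a b < w (Suc j)" unfolding j_def using ex by (rule LeastI_ex)
    have "w j \<le> u a b"
    proof (cases j)
      case 0
      then show ?thesis using s_le[OF ab pos] by (simp add: w_def)
    next
      case (Suc i)
      then have "\<not> u a b < w (Suc i)" using not_less_Least[of i "\<lambda>k. u a b < w (Suc k)"] by (simp add: j_def)
      then show ?thesis using Suc by simp
    qed
    moreover have "j < n"
    proof (rule ccontr)
      assume "\<not> j < n"
      then have "w n \<le> w j" using s by (simp add: w_def)
      with \<open>w j \<le> u a b\<close> u_less[OF ab] show False by simp
    qed
    ultimately show ?thesis using j ab by (auto simp: F_def)
  qed
  define \<mu> where "\<mu> j = restr (small_part K m (F j)) m" for j
  define f where "f j = hardy_adj (\<mu> j)" for j
  define S where "S j = (w j)\<^sup>2 * mass (\<mu> j)" for j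
  define T where "T = (\<Sum>j<n. S j)"
  have \<mu>: "nonneg (\<mu> j)" for j unfolding \<mu>_def by (rule restr_nonneg[OF m])
  have f: "nonneg (f j)" for j unfolding f_def by (rule hardy_adj_nonneg[OF \<mu>])
  have S0: "0 \<le> S j" for j unfolding S_def using mass_nonneg[OF \<mu>] by simp
  have T0: "0 \<le> T" unfolding T_def by (intro sum_nonneg S0)
  have "pairing m (\<lambda>a b. (u a b)\<^sup>2)
      \<le> pairing (\<lambda>a b. \<Sum>j<n. (256 * (w j)\<^sup>2) * restr (F j) m a b) (\<lambda>_ _. 1)"
  proof (rule pairing_mono)
    fix a b assume ab: "a \<in> A" "b \<in> B"
    have m0: "0 \<le> m a b" using m ab by (simp add: nonneg_def)
    have nn: "0 \<le> 256 * (w j)\<^sup>2 * restr (F j) m a b" for j using m0 by (simp add: restr_def)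
    show "m a b * (u a b)\<^sup>2 \<le> (\<Sum>j<n. 256 * (w j)\<^sup>2 * restr (F j) m a b) * 1"
    proof (cases "u a b > 0")
      case True
      from level[OF ab True] obtain j where j: "j < n" "(a, b) \<in> F j" by blast
      have "(u a b)\<^sup>2 \<le> (16 * w j)\<^sup>2"
        using j u0[OF ab] by (intro power_mono) (auto simp: F_def w_def)
      then have "m a b * (u a b)\<^sup>2 \<le> 256 * (w j)\<^sup>2 * restr (F j) m a b"
        using mult_left_mono[OF _ m0] j by (fastforce simp: restr_def power_mult_distrib mult_ac)
      also have "\<dots> \<le> (\<Sum>j<n. 256 * (w j)\<^sup>2 * restr (F j) m a b)"
        using j nn by (intro member_le_sum) auto
      finally show ?thesis by simp
    next
      case False
      then have "u a b = 0" using u0[OF ab] by simp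
      then show ?thesis using nn by (simp add: sum_nonneg)
    qed
  qed
  also have "\<dots> = (\<Sum>j<n. 256 * (w j)\<^sup>2 * mass (restr (F j) m))"
    by (simp add: pairing_sum_left mass_def)
  also have "\<dots> \<le> (\<Sum>j<n. 256 * (w j)\<^sup>2 * (2 * mass (\<mu> j)))"
    unfolding \<mu>_def by (intro sum_mono mult_left_mono mass_le_small_part m K R F) auto
  also have "\<dots> = 512 * T" by (simp add: T_def S_def sum_distrib_left mult_ac)
  finally have upper: "pairing m (\<lambda>a b. (u a b)\<^sup>2) \<le> 512 * T" .
  define \<Phi> where "\<Phi> a b = (\<Sum>j<n. w j * f j a b)" for a b
  have "T \<le> (\<Sum>j<n. w j * pairing (\<mu> j) u)"
    unfolding T_def
  proof (intro sum_mono)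
    fix j
    have "S j = w j * pairing (\<mu> j) (\<lambda>_ _. w j)"
      by (simp add: S_def mass_def pairing_def sum_distrib_left power2_eq_square mult_ac)
    also have "\<dots> \<le> w j * pairing (\<mu> j) u"
    proof (rule mult_left_mono[OF pairing_mono])
      fix a b assume "a \<in> A" "b \<in> B"
      then show "\<mu> j a b * w j \<le> \<mu> j a b * u a b"
        using \<mu>[of j] m by (auto simp: \<mu>_def restr_def small_part_def F_def nonneg_def intro: mult_left_mono)
    qed (use w(1)[of j] in simp)
    finally show "S j \<le> w j * pairing (\<mu> j) u" .
  qed
  also have "\<dots> = pairing \<Phi> h"
    unfolding \<Phi>_def by (simp add: pairing_sum_left u_def f_def pairing_commute[of "\<mu> _"] pairing_hardy)
      (simp add: pairing_commute)
  finally have "T\<^sup>2 \<le> (pairing \<Phi> h)\<^sup>2" using T0 by (intro power_mono)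
  also have "\<dots> \<le> pairing \<Phi> \<Phi> * pairing h h" by (rule pairing_Cauchy_Schwarz)
  finally have T2: "T\<^sup>2 \<le> pairing \<Phi> \<Phi> * pairing h h" .
  define c where "c i j = w i * w j * pairing (f i) (f j)" for i j
  have c0: "0 \<le> c i j" for i j
    unfolding c_def using w(1)[of i] w(1)[of j] pairing_nonneg[OF f f] by simp
  have csym: "c i j = c j i" for i j by (simp add: c_def pairing_commute mult_ac)
  have cle: "c i j \<le> 8 * K * ((1/2) ^ (j - i) * (S i + 2 * S j))" if "i \<le> j" for i j
    using pairing_energy_decay[OF m K R F[of i] F[of j] order.strict_implies_order[OF w(1)[of i]], where d = "j - i"] that w(2)[of i "j - i"]
    by (simp add: c_def f_def \<mu>_def S_def mult.assoc)
  have "pairing \<Phi> \<Phi> = (\<Sum>i<n. w i * pairing (f i) \<Phi>)"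
    unfolding \<Phi>_def by (subst pairing_sum_left) auto
  also have "\<dots> = (\<Sum>i<n. \<Sum>j<n. c i j)"
    unfolding \<Phi>_def
    by (subst (1) pairing_commute, subst pairing_sum_left)
       (auto simp: c_def sum_distrib_left pairing_commute mult_ac)
  also have "\<dots> \<le> (\<Sum>i<n. \<Sum>j<n. (if i \<le> j then c i j else 0) + (if j \<le> i then c i j else 0))"
    using c0 by (intro sum_mono) auto
  also have "\<dots> = (\<Sum>i<n. \<Sum>j<n. if i \<le> j then c i j else 0) + (\<Sum>j<n. \<Sum>i<n. if j \<le> i then c i j else 0)"
    by (simp add: sum.distrib) (rule sum.swap)
  also have "(\<Sum>j<n. \<Sum>i<n. if j \<le> i then c i j else 0) = (\<Sum>j<n. \<Sum>i<n. if j \<le> i then c j i else 0)"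
    by (intro sum.cong refl if_cong csym)
  also have "(\<Sum>i<n. \<Sum>j<n. if i \<le> j then c i j else 0) + \<dots> = 2 * (\<Sum>i<n. \<Sum>j<n. if i \<le> j then c i j else 0)"
    by simp
  also have "\<dots> \<le> 2 * (\<Sum>i<n. \<Sum>j<n. 8 * K * (if i \<le> j then (1/2) ^ (j - i) * (S i + 2 * S j) else 0))"
    using cle by (intro mult_left_mono sum_mono) auto
  also have "\<dots> = 16 * K * (\<Sum>i<n. \<Sum>j<n. if i \<le> j then (1/2) ^ (j - i) * (S i + 2 * S j) else 0)"
    by (simp add: sum_distrib_left mult_ac)
  also have "(\<Sum>i<n. \<Sum>j<n. if i \<le> j then (1/2) ^ (j - i) * (S i + 2 * S j) else 0)
     = (\<Sum>i<n. S i * (\<Sum>j<n. if i \<le> j then (1/2) ^ (j - i) else 0))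
     + (\<Sum>i<n. \<Sum>j<n. 2 * S j * (if i \<le> j then (1/2) ^ (j - i) else 0))"
    unfolding sum_distrib_left sum.distrib[symmetric] by (intro sum.cong refl) (auto simp: algebra_simps)
  also have "(\<Sum>i<n. \<Sum>j<n. 2 * S j * (if i \<le> j then (1/2) ^ (j - i) else 0))
     = (\<Sum>j<n. 2 * S j * (\<Sum>i<n. if i \<le> j then (1/2) ^ (j - i) else 0))"
    unfolding sum_distrib_left by (rule sum.swap)
  also have "(\<Sum>i<n. S i * (\<Sum>j<n. if i \<le> j then (1/2) ^ (j - i) else 0)) \<le> (\<Sum>i<n. S i * 2)"
  proof (intro sum_mono mult_left_mono S0)
    fix i
    have "(\<Sum>j<n. if i \<le> j then (1/2::real) ^ (j - i) else 0) = (\<Sum>j\<in>{i..<n}. (1/2) ^ (j - i))"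
      by (rule sum.mono_neutral_cong_right) auto
    then show "(\<Sum>j<n. if i \<le> j then (1/2::real) ^ (j - i) else 0) \<le> 2"
      using sum_half_power_le by simp
  qed
  also have "(\<Sum>j<n. 2 * S j * (\<Sum>i<n. if i \<le> j then (1/2) ^ (j - i) else 0)) \<le> (\<Sum>j<n. 2 * S j * 2)"
  proof (intro sum_mono mult_left_mono)
    fix j assume "j \<in> {..<n}"
    then have "(\<Sum>i<n. if i \<le> j then (1/2::real) ^ (j - i) else 0) = (\<Sum>i\<le>j. (1/2) ^ (j - i))"
      by (intro sum.mono_neutral_cong_right) auto
    then show "(\<Sum>i<n. if i \<le> j then (1/2::real) ^ (j - i) else 0) \<le> 2"
      using sum_half_power_le by simp
  qed (use S0 in auto)
  finally have "pairing \<Phi> \<Phi> \<le> 16 * K * ((\<Sum>i<n. S i * 2) + (\<Sum>j<n. 2 * S j * 2))"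
    using K by simp
  also have "\<dots> = 96 * K * T"
  proof -
    have "(\<Sum>i<n. S i * 2) = 2 * T" "(\<Sum>j<n. 2 * S j * 2) = 4 * T"
      unfolding T_def sum_distrib_left by (simp_all add: mult_ac)
    then show ?thesis by simp
  qed
  finally have "pairing \<Phi> \<Phi> * pairing h h \<le> 96 * K * T * pairing h h"
    by (intro mult_right_mono pairing_self_nonneg)
  with T2 have "T * T \<le> T * (96 * K * pairing h h)" by (simp add: power2_eq_square mult_ac)
  then have "T \<le> 96 * K * pairing h h"
    using T0 K pairing_self_nonneg[of h] by (cases "T = 0") auto
  with upper show ?thesis by (simp add: u_def)
qed

text \<open>The embedding for \<open>hardy\<close> and the boundedness of the adjoint are equivalent: the left-hand side is the
pairing of \<open>m * g\<close> with the potential of \<open>hardy_adj (m * g)\<close>.\<close>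

theorem bitree_dual_embedding:
  assumes m: "nonneg m" and K: "K > 0" and R: "restricted_energy_bound m K" and g: "nonneg g"
  shows "pairing (hardy_adj (\<lambda>a b. m a b * g a b)) (hardy_adj (\<lambda>a b. m a b * g a b))
     \<le> 49152 * K * pairing m (\<lambda>a b. (g a b)\<^sup>2)"
proof -
  define f where "f = hardy_adj (\<lambda>a b. m a b * g a b)"
  define X where "X = pairing f f"
  have f: "nonneg f" unfolding f_def using m g by (intro hardy_adj_nonneg) (auto simp: nonneg_def)
  define G where "G = pairing m (\<lambda>a b. (g a b)\<^sup>2)"
  have sq: "m a b = sqrt (m a b) * sqrt (m a b)" if "a \<in> A" "b \<in> B" for a b
    using m that by (simp add: nonneg_def)
  have "X = pairing (hardy f) (\<lambda>a b. m a b * g a b)"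
    by (simp add: X_def f_def pairing_hardy)
  also have "\<dots> = pairing (\<lambda>a b. sqrt (m a b) * hardy f a b) (\<lambda>a b. sqrt (m a b) * g a b)"
    unfolding pairing_def by (intro sum.cong refl) (use sq in \<open>simp add: mult_ac\<close>)
  finally have "X\<^sup>2 = (pairing (\<lambda>a b. sqrt (m a b) * hardy f a b) (\<lambda>a b. sqrt (m a b) * g a b))\<^sup>2" by simp
  also have "\<dots> \<le> pairing (\<lambda>a b. sqrt (m a b) * hardy f a b) (\<lambda>a b. sqrt (m a b) * hardy f a b)
     * pairing (\<lambda>a b. sqrt (m a b) * g a b) (\<lambda>a b. sqrt (m a b) * g a b)"
    by (rule pairing_Cauchy_Schwarz)
  also have "pairing (\<lambda>a b. sqrt (m a b) * hardy f a b) (\<lambda>a b. sqrt (m a b) * hardy f a b)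
     = pairing m (\<lambda>a b. (hardy f a b)\<^sup>2)"
    unfolding pairing_def using sq by (intro sum.cong refl) (simp add: power2_eq_square mult_ac)
  also have "pairing (\<lambda>a b. sqrt (m a b) * g a b) (\<lambda>a b. sqrt (m a b) * g a b) = G"
    unfolding pairing_def G_def using sq by (intro sum.cong refl) (simp add: power2_eq_square mult_ac)
  also have "pairing m (\<lambda>a b. (hardy f a b)\<^sup>2) * G \<le> 49152 * K * X * G"
    unfolding X_def G_def
    by (intro mult_right_mono bitree_embedding m K R f pairing_nonneg) (auto simp: nonneg_def)
  finally have "X * X \<le> X * (49152 * K * G)" by (simp add: power2_eq_square mult_ac)
  moreover have "0 \<le> G" unfolding G_def by (intro pairing_nonneg m) (auto simp: nonneg_def)
  ultimately have "X \<le> 49152 * K * G"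
    using pairing_self_nonneg[of f] K by (cases "X = 0") (auto simp: X_def)
  then show ?thesis by (simp add: X_def f_def G_def)
qed

end

context bitree
begin

text \<open>Layer cake with the dyadic heights \<open>2 ^ k * t\<close>; below \<open>t\<close> the function is bounded by \<open>t\<close>. The parameter
\<open>t\<close> is left free because in the application \<open>W\<close> is a multiple of the left-hand side, which is absorbed
by a large choice of \<open>t\<close>.\<close>

lemma weak_type_imp_pairing_le:
  assumes m: "nonneg m" and W: "W \<ge> 0" and t: "t > 0"
    and weak: "\<And>l. l > 0 \<Longrightarrow> mass (restr {(a, b). l < v a b} m) \<le> W / l\<^sup>2"
  shows "pairing (restr F m) v \<le> t * mass (restr F m) + 4 * W / t"
proof -
  define U where "U = (\<lambda>(a, b). v a b) ` (A \<times> B)"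
  have fU: "finite U" unfolding U_def using T1.finite_nodes T2.finite_nodes by auto
  obtain n where n: "Max (insert 0 U) / t < 2 ^ n" using real_arch_pow[of "2::real"] by auto
  have v_le: "v a b \<le> 2 ^ n * t" if "a \<in> A" "b \<in> B" for a b
  proof -
    have "v a b \<le> Max (insert 0 U)" using fU that by (intro Max_ge) (auto simp: U_def)
    then show ?thesis using n t by (simp add: field_simps)
  qed
  define R where "R k = restr {(a, b). 2 ^ k * t < v a b} m" for k :: nat
  have R0: "nonneg (R k)" for k unfolding R_def by (rule restr_nonneg[OF m])
  have "pairing (restr F m) v \<le> pairing (\<lambda>a b. t * restr F m a b + (\<Sum>k<n. (2 ^ Suc k * t) * R k a b)) (\<lambda>_ _. 1)"
  proof (rule pairing_mono)
    fix a b assume ab: "a \<in> A" "b \<in> B"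
    have m0: "0 \<le> m a b" "0 \<le> restr F m a b" "restr F m a b \<le> m a b"
      using m ab by (auto simp: nonneg_def restr_def)
    have R0': "0 \<le> (2 ^ Suc k * t) * R k a b" for k using R0[of k] ab t by (simp add: nonneg_def)
    show "restr F m a b * v a b \<le> (t * restr F m a b + (\<Sum>k<n. (2 ^ Suc k * t) * R k a b)) * 1"
    proof (cases "v a b \<le> t")
      case True
      then have "restr F m a b * v a b \<le> t * restr F m a b" using m0 by (simp add: mult.commute mult_right_mono)
      moreover have "0 \<le> (\<Sum>k<n. (2 ^ Suc k * t) * R k a b)" by (intro sum_nonneg R0')
      ultimately show ?thesis by simp
    next
      case False
      define k where "k = (LEAST k. v a b \<le> 2 ^ Suc k * t)"
      have ex: "\<exists>k. v a b \<le> 2 ^ Suc k * t"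
        using v_le[OF ab] t by (intro exI[of _ n]) (auto intro: order_trans[OF v_le[OF ab]])
      have k: "v a b \<le> 2 ^ Suc k * t" unfolding k_def using ex by (rule LeastI_ex)
      have k2: "2 ^ k * t < v a b"
      proof (cases k)
        case 0
        then show ?thesis using False by simp
      next
        case (Suc i)
        then have "\<not> v a b \<le> 2 ^ Suc i * t"
          using not_less_Least[of i "\<lambda>k. v a b \<le> 2 ^ Suc k * t"] by (simp add: k_def)
        then show ?thesis using Suc by simp
      qed
      have "k < n"
      proof (rule ccontr)
        assume "\<not> k < n"
        then have "2 ^ n * t \<le> 2 ^ k * t" using t by simp
        then show False using k2 v_le[OF ab] by linarith
      qed
      have "restr F m a b * v a b \<le> m a b * (2 ^ Suc k * t)"
        using k k2 m0 t by (intro mult_mono) (auto intro: order_trans[OF _ less_imp_le[OF k2]])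
      also have "\<dots> = (2 ^ Suc k * t) * R k a b" using k2 by (simp add: R_def restr_def)
      also have "\<dots> \<le> (\<Sum>k<n. (2 ^ Suc k * t) * R k a b)"
        using \<open>k < n\<close> R0' by (intro member_le_sum) auto
      finally have "restr F m a b * v a b \<le> (\<Sum>k<n. (2 ^ Suc k * t) * R k a b)" .
      moreover have "0 \<le> t * restr F m a b" using m0 t by simp
      ultimately show ?thesis unfolding mult_1_right by linarith
    qed
  qed
  also have "\<dots> = t * mass (restr F m) + (\<Sum>k<n. (2 ^ Suc k * t) * mass (R k))"
    unfolding mass_def pairing_sum_left[OF finite_lessThan, symmetric]
    by (simp add: pairing_def sum.distrib sum_distrib_left)
  also have "(\<Sum>k<n. (2 ^ Suc k * t) * mass (R k)) \<le> (\<Sum>k<n. (2 ^ Suc k * t) * (W / (2 ^ k * t)\<^sup>2))"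
    unfolding R_def using t by (intro sum_mono mult_left_mono weak) auto
  also have "\<dots> = (\<Sum>k<n. 2 * W / t * (1/2) ^ k)"
    using t by (intro sum.cong refl) (simp add: power2_eq_square field_simps)
  also have "\<dots> = 2 * W / t * (\<Sum>k<n. (1/2) ^ k)" by (rule sum_distrib_left[symmetric])
  also have "\<dots> \<le> 2 * W / t * 2"
  proof (intro mult_left_mono)
    show "(\<Sum>k<n. (1/2::real) ^ k) \<le> 2" by (subst sum_gp_strict) simp
  qed (use W t in auto)
  finally show ?thesis by simp
qed

end

section \<open>Directions and angles\<close>

lemma Arg_measurable [measurable]: "Arg \<in> borel_measurable borel"
proof -
  have "(\<lambda>z. if z = 0 then 0 else Im (Ln z)) \<in> borel_measurable borel" by measurable
  also have "(\<lambda>z. if z = 0 then 0 else Im (Ln z)) = Arg" by (simp add: fun_eq_iff Arg_def)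
  finally show ?thesis .
qed

lemma cis_measurable [measurable]: "cis \<in> borel_measurable borel"
  by (intro borel_measurable_continuous_onI continuous_intros)

lemma cis_add_of_int_mult_2pi: "cis (t + of_int k * (2 * pi)) = cis t"
  using cis_multiple_2pi[of "of_int k"] by (simp add: cis_mult[symmetric] mult_ac)

lemma cis_eq_iff_int: "cis s = cis t \<longleftrightarrow> (\<exists>k. s = t + of_int k * (2 * pi))"
proof
  assume "cis s = cis t"
  then have "sin s = sin t \<and> cos s = cos t" by (simp add: complex_eq_iff)
  then show "\<exists>k. s = t + of_int k * (2 * pi)" 
    unfolding sin_cos_eq_iff by (auto simp: mult_ac)
qed (auto simp: cis_add_of_int_mult_2pi)

lemma Arg_cis_int: "\<exists>k. Arg (cis x) = x + of_int k * (2 * pi)"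
  using cis_Arg[of "cis x"] cis_eq_iff_int[of "Arg (cis x)" x] by simp

lemma abs_Arg_le_pi: "\<bar>Arg z\<bar> \<le> pi"
  using Arg_bounded[of z] by linarith

lemma abs_Arg_cis_le: "\<bar>Arg (cis x)\<bar> \<le> \<bar>x\<bar>"
proof (cases "x \<in> {-pi<..pi}")
  case False
  then have "pi \<le> \<bar>x\<bar>" by auto
  then show ?thesis using abs_Arg_le_pi[of "cis x"] by linarith
qed (simp add: Arg_cis)

text \<open>A point of the closed disc is handled through its modulus and its direction. At the origin the direction is
\<open>1\<close>, a point of the circle as well, so that no case distinction is needed.\<close>

definition direction :: "complex \<Rightarrow> complex" where
  "direction z = cis (Arg z)"

lemma direction_measurable [measurable]: "direction \<in> borel_measurable borel"
  unfolding direction_def by measurable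

lemma norm_direction [simp]: "norm (direction z) = 1"
  by (simp add: direction_def)

lemma norm_times_direction: "of_real (norm z) * direction z = z"
  using rcis_cmod_Arg[of z] by (simp add: direction_def rcis_def)

lemma direction_eqI: "r > 0 \<Longrightarrow> norm u = 1 \<Longrightarrow> z = of_real r * u \<Longrightarrow> direction z = u"
  using cis_Arg[of u] by (cases "u = 0") (auto simp: direction_def sgn_div_norm)

lemma Arg_direction [simp]: "Arg (direction z) = Arg z"
  using Arg_bounded[of z] by (simp add: direction_def Arg_cis)

lemma unit_eq_cis: "norm u = 1 \<Longrightarrow> u = cis (Arg u)"
  by (metis direction_def mult_1 norm_times_direction of_real_1)

text \<open>The length of the shorter arc between two points of the circle; the kernel of the capacity is
\<open>1 / sqrt (angle u \<zeta>)\<close> in each variable.\<close>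

definition angle :: "complex \<Rightarrow> complex \<Rightarrow> real" where
  "angle u v = \<bar>Arg (u / v)\<bar>"

lemma angle_cis: "angle (cis x) (cis y) \<le> \<bar>x - y\<bar>"
  using abs_Arg_cis_le[of "x - y"] by (simp add: angle_def cis_divide)

lemma angle_nonneg [simp]: "0 \<le> angle u v"
  by (simp add: angle_def)

lemma angle_le_pi: "angle u v \<le> pi"
  by (simp add: angle_def abs_Arg_le_pi)

lemma angle_triangle:
  assumes "norm u = 1" "norm v = 1" "norm w = 1"
  shows "angle u w \<le> angle u v + angle v w"
proof -
  have nz: "norm (u / v) = 1" "norm (v / w) = 1" using assms by (auto simp: norm_divide)
  have "u / w = (u / v) * (v / w)" using assms by auto
  also have "\<dots> = cis (Arg (u / v) + Arg (v / w))"
    using unit_eq_cis[OF nz(1)] unit_eq_cis[OF nz(2)] by (metis cis_mult)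
  finally show ?thesis
    using abs_Arg_cis_le[of "Arg (u / v) + Arg (v / w)"] by (simp add: angle_def)
qed

lemma angle_commute:
  assumes "norm u = 1" "norm v = 1"
  shows "angle u v = angle v u"
proof -
  have le: "angle a b \<le> angle b a" if "norm a = 1" "norm b = 1" for a b
  proof -
    have "norm (b / a) = 1" using that by (simp add: norm_divide)
    have "a / b = inverse (b / a)" by simp
    also have "\<dots> = cis (- Arg (b / a))"
      using unit_eq_cis[OF \<open>norm (b / a) = 1\<close>] by (metis cis_inverse)
    finally show ?thesis using abs_Arg_cis_le[of "- Arg (b / a)"] by (simp add: angle_def)
  qed
  show ?thesis using le[OF assms] le[OF assms(2,1)] by simp
qed

lemma angle_measurable [measurable]:
  assumes [measurable]: "f \<in> borel_measurable M" "g \<in> borel_measurable M"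
  shows "(\<lambda>x. angle (f x) (g x)) \<in> borel_measurable M"
  unfolding angle_def by measurable

section \<open>Integration over the circle and the torus\<close>

lemma nn_integral_shift_interval:
  fixes f :: "complex \<Rightarrow> ennreal"
  assumes [measurable]: "f \<in> borel_measurable borel"
  shows "(\<integral>\<^sup>+ t. f (cis t) * indicator {a..<b} t \<partial>lborel)
       = (\<integral>\<^sup>+ t. f (cis t) * indicator {a + of_int k * (2 * pi)..<b + of_int k * (2 * pi)} t \<partial>lborel)"
proof -
  have "(\<integral>\<^sup>+ t. f (cis t) * indicator {a + of_int k * (2 * pi)..<b + of_int k * (2 * pi)} t \<partial>lborel)
     = (\<integral>\<^sup>+ t. f (cis (of_int k * (2 * pi) + 1 * t)) *
          indicator {a + of_int k * (2 * pi)..<b + of_int k * (2 * pi)} (of_int k * (2 * pi) + 1 * t) \<partial>lborel)"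
    by (subst nn_integral_real_affine[where c = 1 and t = "of_int k * (2 * pi)"]) auto
  also have "\<dots> = (\<integral>\<^sup>+ t. f (cis t) * indicator {a..<b} t \<partial>lborel)"
    using cis_add_of_int_mult_2pi[of _ k]
    by (intro nn_integral_cong) (auto simp: indicator_def add.commute)
  finally show ?thesis ..
qed

lemma nn_integral_split_interval:
  fixes f :: "real \<Rightarrow> ennreal"
  assumes [measurable]: "f \<in> borel_measurable borel" and "a \<le> b" "b \<le> c"
  shows "(\<integral>\<^sup>+ t. f t * indicator {a..<c} t \<partial>lborel)
       = (\<integral>\<^sup>+ t. f t * indicator {a..<b} t \<partial>lborel) + (\<integral>\<^sup>+ t. f t * indicator {b..<c} t \<partial>lborel)"
  by (subst nn_integral_add[symmetric])
     (use assms in \<open>auto intro!: nn_integral_cong simp: indicator_def\<close>)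

text \<open>The period is split at the point congruent to \<open>-pi\<close> and the left part is moved to the right.\<close>

lemma nn_integral_period:
  fixes f :: "complex \<Rightarrow> ennreal"
  assumes f[measurable]: "f \<in> borel_measurable borel"
  shows "(\<integral>\<^sup>+ t. f (cis t) * indicator {c..<c + 2 * pi} t \<partial>lborel)
       = (\<integral>\<^sup>+ t. f (cis t) * indicator {-pi..<pi} t \<partial>lborel)"
proof -
  define k where "k = \<lceil>(c + pi) / (2 * pi)\<rceil>"
  define p where "p = - pi + of_int k * (2 * pi)"
  have "(c + pi) / (2 * pi) \<le> of_int k" "of_int k < (c + pi) / (2 * pi) + 1"
    unfolding k_def by linarith+
  then have "c + pi \<le> of_int k * (2 * pi)" "of_int k * (2 * pi) < c + pi + 2 * pi"
    using pi_gt_zero by (auto simp: field_simps)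
  then have p: "c \<le> p" "p \<le> c + 2 * pi" by (auto simp: p_def)
  have "(\<integral>\<^sup>+ t. f (cis t) * indicator {c..<c + 2 * pi} t \<partial>lborel)
     = (\<integral>\<^sup>+ t. f (cis t) * indicator {c..<p} t \<partial>lborel) + (\<integral>\<^sup>+ t. f (cis t) * indicator {p..<c + 2 * pi} t \<partial>lborel)"
    using p by (intro nn_integral_split_interval) auto
  also have "(\<integral>\<^sup>+ t. f (cis t) * indicator {c..<p} t \<partial>lborel)
     = (\<integral>\<^sup>+ t. f (cis t) * indicator {c + 2 * pi..<p + 2 * pi} t \<partial>lborel)"
    using nn_integral_shift_interval[OF f, of c p 1] by simp
  also have "\<dots> + (\<integral>\<^sup>+ t. f (cis t) * indicator {p..<c + 2 * pi} t \<partial>lborel)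
     = (\<integral>\<^sup>+ t. f (cis t) * indicator {p..<p + 2 * pi} t \<partial>lborel)"
    using p by (subst nn_integral_split_interval[of _ p "c + 2 * pi" "p + 2 * pi"]) (auto simp: add.commute)
  also have "\<dots> = (\<integral>\<^sup>+ t. f (cis t) * indicator {-pi..<pi} t \<partial>lborel)"
    using nn_integral_shift_interval[OF f, of "-pi" pi k] by (simp add: p_def algebra_simps)
  finally show ?thesis .
qed

lemma sets_circle_measure [measurable_cong, simp]: "sets circle_measure = sets borel"
  by (simp add: circle_measure_def)

lemma space_circle_measure [simp]: "space circle_measure = UNIV"
  by (simp add: circle_measure_def)

lemma nn_integral_circle_measure:
  fixes f :: "complex \<Rightarrow> ennreal"
  assumes f[measurable]: "f \<in> borel_measurable borel"
  shows "(\<integral>\<^sup>+ \<zeta>. f \<zeta> \<partial>circle_measure)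
       = (\<integral>\<^sup>+ t. f (cis t) * indicator {c..<c + 2 * pi} t \<partial>lborel) / ennreal (2 * pi)"
proof -
  have "(\<integral>\<^sup>+ \<zeta>. f \<zeta> \<partial>circle_measure)
      = (\<integral>\<^sup>+ t. f (cis t) * indicator {-pi..<pi} t \<partial>lborel) / ennreal (2 * pi)"
    unfolding circle_measure_def
    by (subst nn_integral_distr) (auto simp: nn_integral_uniform_measure)
  then show ?thesis by (simp add: nn_integral_period[OF f])
qed

interpretation circle: prob_space circle_measure
  unfolding circle_measure_def
  by (intro prob_space.prob_space_distr prob_space_uniform_measure) auto

interpretation torus: pair_prob_space circle_measure circle_measure ..

lemma sets_torus_measure [measurable_cong, simp]: "sets torus_measure = sets borel"
proof -
  have "sets torus_measure = sets ((borel :: complex measure) \<Otimes>\<^sub>M (borel :: complex measure))"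
    unfolding torus_measure_def by (rule sets_pair_measure_cong) simp_all
  then show ?thesis by (simp only: borel_prod)
qed

lemma space_torus_measure [simp]: "space torus_measure = UNIV"
  by (simp add: torus_measure_def space_pair_measure)

lemma emeasure_angle_le:
  assumes u: "norm u = 1" and \<tau>: "\<tau> \<ge> 0"
  shows "emeasure circle_measure {\<zeta>. angle u \<zeta> \<le> \<tau>} \<le> ennreal (\<tau> / pi)"
proof -
  define c where "c = Arg u - pi"
  have "emeasure circle_measure {\<zeta>. angle u \<zeta> \<le> \<tau>} = (\<integral>\<^sup>+ \<zeta>. indicator {\<zeta>. angle u \<zeta> \<le> \<tau>} \<zeta> \<partial>circle_measure)"
    by (subst nn_integral_indicator) auto
  also have "\<dots> = (\<integral>\<^sup>+ t. indicator {\<zeta>. angle u \<zeta> \<le> \<tau>} (cis t) * indicator {c..<c + 2 * pi} t \<partial>lborel) / ennreal (2 * pi)"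
    by (rule nn_integral_circle_measure) auto
  also have "\<dots> \<le> (\<integral>\<^sup>+ t. indicator {Arg u - \<tau>..Arg u + \<tau>} t \<partial>lborel) / ennreal (2 * pi)"
  proof (intro divide_right_mono_ennreal nn_integral_mono)
    fix t
    have "\<bar>Arg u - t\<bar> \<le> \<tau>" if "t \<in> {c..<c + 2 * pi}" "angle u (cis t) \<le> \<tau>"
    proof -
      have "u / cis t = cis (Arg u - t)"
        using unit_eq_cis[OF u] by (metis cis_divide)
      moreover have "Arg u - t \<in> {-pi<..pi}" using that(1) by (auto simp: c_def)
      ultimately show ?thesis using that(2) by (simp add: angle_def Arg_cis)
    qed
    then show "indicator {\<zeta>. angle u \<zeta> \<le> \<tau>} (cis t) * indicator {c..<c + 2 * pi} t
      \<le> (indicator {Arg u - \<tau>..Arg u + \<tau>} t :: ennreal)"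
      by (force simp: indicator_def)
  qed
  also have "\<dots> = ennreal (2 * \<tau>) / ennreal (2 * pi)"
    using \<tau> by simp
  also have "\<dots> = ennreal (\<tau> / pi)" using \<tau> by (simp add: divide_ennreal)
  finally show ?thesis .
qed

lemma AE_circle_norm: "AE \<zeta> in circle_measure. norm \<zeta> = 1"
  unfolding circle_measure_def by (subst AE_distr_iff) auto

interpretation torus_prob: prob_space torus_measure
  unfolding torus_measure_def by (rule torus.P.prob_space_axioms)

lemma fst_measurable_torus [measurable]: "fst \<in> borel_measurable torus_measure"
  and snd_measurable_torus [measurable]: "snd \<in> borel_measurable torus_measure"
  by (auto simp: measurable_cong_sets[OF sets_torus_measure refl]
      intro!: borel_measurable_continuous_onI continuous_intros)

interpretation lborel_torus: pair_sigma_finite lborel torus_measure ..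

lemma AE_torus_norm: "AE \<zeta> in torus_measure. norm (fst \<zeta>) = 1 \<and> norm (snd \<zeta>) = 1"
proof -
  have "AE x in circle_measure. AE y in circle_measure. norm (fst (x, y)) = 1 \<and> norm (snd (x, y)) = 1"
    using AE_circle_norm
  proof eventually_elim
    case (elim x)
    show ?case using AE_circle_norm by eventually_elim (use elim in simp)
  qed
  moreover have "{\<zeta> :: complex \<times> complex. norm (fst \<zeta>) = 1 \<and> norm (snd \<zeta>) = 1} \<in> sets torus_measure"
    unfolding sets_torus_measure
    by (intro borel_closed closed_Collect_conj closed_Collect_eq continuous_intros)
  ultimately show ?thesis
    unfolding torus_measure_def by (intro torus.AE_pair_measure) (auto simp: space_pair_measure)
qed

lemma nn_integral_torus_product:
  assumes [measurable]: "u \<in> borel_measurable borel" "v \<in> borel_measurable borel"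
  shows "(\<integral>\<^sup>+ \<zeta>. u (fst \<zeta>) * v (snd \<zeta>) \<partial>torus_measure)
     = (\<integral>\<^sup>+ x. u x \<partial>circle_measure) * (\<integral>\<^sup>+ y. v y \<partial>circle_measure)"
proof -
  have "(\<integral>\<^sup>+ \<zeta>. u (fst \<zeta>) * v (snd \<zeta>) \<partial>torus_measure) = (\<integral>\<^sup>+ x. \<integral>\<^sup>+ y. u x * v y \<partial>circle_measure \<partial>circle_measure)"
    unfolding torus_measure_def
    by (subst circle.nn_integral_fst[symmetric]) auto
  then show ?thesis by (simp add: nn_integral_cmult nn_integral_multc)
qed

section \<open>Arcs and Carleson boxes\<close>

text \<open>By periodicity the parameter interval may start at \<open>a\<close>. There the preimage of the arc is the interval
itself, except that for the full circle the end point repeats the starting point.\<close>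

lemma arc_length_cis_image:
  assumes "a < b" "b \<le> a + 2 * pi"
  shows "arc_length (cis ` {a..b}) = b - a"
proof -
  let ?J = "cis ` {a..b}"
  have J[measurable]: "?J \<in> sets borel"
    by (intro borel_closed compact_imp_closed compact_continuous_image continuous_intros) auto
  have "{t \<in> {-pi..<pi}. cis t \<in> ?J} = {-pi..<pi} \<inter> cis -` ?J" by auto
  also have "\<dots> \<in> sets lborel"
    using measurable_sets[OF cis_measurable J] by (simp add: sets.Int)
  finally have "emeasure lborel {t \<in> {-pi..<pi}. cis t \<in> ?J}
      = (\<integral>\<^sup>+ t. indicator {t \<in> {-pi..<pi}. cis t \<in> ?J} t \<partial>lborel)"
    by (rule nn_integral_indicator[symmetric])
  also have "\<dots> = (\<integral>\<^sup>+ t. indicator ?J (cis t) * indicator {-pi..<pi} t \<partial>lborel)"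
    by (intro nn_integral_cong) (auto simp: indicator_def)
  also have "\<dots> = (\<integral>\<^sup>+ t. indicator ?J (cis t) * indicator {a..<a + 2 * pi} t \<partial>lborel)"
    by (rule nn_integral_period[symmetric]) auto
  also have "\<dots> = (\<integral>\<^sup>+ t. indicator ({a..b} - {a + 2 * pi}) t \<partial>lborel)"
  proof (intro nn_integral_cong)
    fix t
    have "t \<in> {a..b}" if "cis t \<in> ?J" "t \<in> {a..<a + 2 * pi}"
    proof -
      from that(1) obtain s where s: "s \<in> {a..b}" "cis t = cis s" by auto
      then obtain k where k: "t = s + of_int k * (2 * pi)" by (auto simp: cis_eq_iff_int)
      have "s \<le> a + 2 * pi" "a \<le> s" "a \<le> t" "t < a + 2 * pi" using s(1) that(2) assms by auto
      then have "(-1) * (2 * pi) \<le> of_int k * (2 * pi)" "of_int k * (2 * pi) < 1 * (2 * pi)"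
        using k by linarith+
      then have "-1 \<le> (of_int k :: real)" "(of_int k :: real) < 1"
        by (subst (asm) mult_le_cancel_right_pos mult_less_cancel_right_pos, simp, simp)+
      then have "k = 0 \<or> k = -1" by linarith
      then show ?thesis using k s(1) that(2) assms by auto
    qed
    then show "indicator ?J (cis t) * indicator {a..<a + 2 * pi} t = (indicator ({a..b} - {a + 2 * pi}) t :: ennreal)"
      using assms by (auto simp: indicator_def split: if_splits)
  qed
  also have "\<dots> = emeasure lborel ({a..b} - {a + 2 * pi})" by simp
  also have "\<dots> = ennreal (b - a)"
    using assms by (subst emeasure_Diff_null_set) auto
  finally show ?thesis using assms by (simp add: arc_length_def measure_def)
qed

text \<open>Only for the full circle does the box contain the origin, whose argument in the description of the box
is arbitrary; there every direction is allowed.\<close>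

lemma carleson_box_eq:
  assumes ab: "a < b" "b \<le> a + 2 * pi"
  shows "carleson_box (cis ` {a..b}) = {z. norm z \<le> 1 \<and> 1 - norm z \<le> (b - a) / (2 * pi) \<and> direction z \<in> cis ` {a..b}}"
    (is "?L = ?R")
proof
  show "?L \<subseteq> ?R"
  proof
    fix z assume "z \<in> ?L"
    then obtain \<rho> s where z: "z = rcis \<rho> s" "cis s \<in> cis ` {a..b}" "1 - (b - a) / (2 * pi) \<le> \<rho>" "\<rho> \<le> 1"
      by (auto simp: carleson_box_def arc_length_cis_image[OF ab])
    have "(b - a) / (2 * pi) \<le> 1" using ab by (simp add: field_simps)
    then have \<rho>: "\<rho> \<ge> 0" using z by linarith
    have "direction z \<in> cis ` {a..b}"
    proof (cases "\<rho> = 0")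
      case False
      then have "direction z = cis s" using \<rho> z by (intro direction_eqI[of \<rho>]) (auto simp: rcis_def)
      then show ?thesis using z by simp
    next
      case True
      then have "1 \<le> (b - a) / (2 * pi)" using z by simp
      then have "b = a + 2 * pi" using ab by (simp add: field_simps)
      moreover obtain k where k: "k = \<lceil>a / (2 * pi)\<rceil>" by simp
      have "a / (2 * pi) \<le> of_int k" "of_int k < a / (2 * pi) + 1" unfolding k by linarith+
      then have "of_int k * (2 * pi) \<in> {a..a + 2 * pi}" by (auto simp: field_simps)
      moreover have "cis (of_int k * (2 * pi)) = 1" using cis_add_of_int_mult_2pi[of 0 k] by simp
      ultimately have "1 \<in> cis ` {a..b}" by (metis imageI)
      moreover have "direction z = 1" using True z by (simp add: direction_def Arg_zero)
      ultimately show ?thesis by simp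
    qed
    then show "z \<in> ?R" using z \<rho> by auto
  qed
  show "?R \<subseteq> ?L"
  proof
    fix z assume "z \<in> ?R"
    moreover have "z = rcis (norm z) (Arg z)" by (simp add: rcis_cmod_Arg)
    ultimately show "z \<in> ?L"
      unfolding carleson_box_def arc_length_cis_image[OF ab] direction_def by fastforce
  qed
qed

lemma compact_carleson_box:
  assumes ab: "a < b" "b \<le> a + 2 * pi"
  shows "compact (carleson_box (cis ` {a..b}))"
proof -
  have "carleson_box (cis ` {a..b}) = (\<lambda>(\<rho>, s). rcis \<rho> s) ` ({1 - (b - a) / (2 * pi)..1} \<times> {a..b})"
    by (force simp: carleson_box_def arc_length_cis_image[OF ab] rcis_def)
  also have "compact \<dots>"
    by (intro compact_continuous_image compact_Times compact_Icc)
       (auto simp: case_prod_beta rcis_def intro!: continuous_intros)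
  finally show ?thesis .
qed

section \<open>Coefficients of functions on the bidisc\<close>

lemma powser_zero_imp_coeff_zero:
  fixes a :: "nat \<Rightarrow> complex"
  assumes "\<And>z. norm z < 1 \<Longrightarrow> (\<lambda>n. a n * z ^ n) sums 0"
  shows "a n = 0"
proof -
  define f where "f = Abs_fps a"
  have "(\<lambda>n. fps_nth f n * (1/2) ^ n) sums 0" using assms[of "1/2"] by (simp add: f_def)
  then have "norm (1/2 :: complex) \<le> fps_conv_radius f"
    unfolding fps_conv_radius_def by (intro conv_radius_geI) (auto simp: sums_iff)
  then have rad: "fps_conv_radius f > 0"
    by (rule less_le_trans[rotated]) auto
  have "eventually (\<lambda>z. z \<in> ball 0 1) (nhds (0::complex))"
    by (intro eventually_nhds_in_open) auto
  then have "eventually (\<lambda>z. eval_fps f z = eval_fps 0 z) (nhds 0)"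
    by eventually_elim (use assms in \<open>auto simp: eval_fps_def f_def sums_iff\<close>)
  then have "f = 0" using rad by (intro eval_fps_eqD) auto
  then have "fps_nth f n = 0" by simp
  then show ?thesis by (simp add: f_def)
qed

text \<open>Uniqueness of power series, applied first in \<open>z\<close> with \<open>w\<close> fixed and then in \<open>w\<close>.\<close>

lemma bidisc_expansion_zero:
  assumes c: "\<And>z w. norm z < 1 \<Longrightarrow> norm w < 1 \<Longrightarrow> ((\<lambda>(m, n). c m n * z ^ m * w ^ n) has_sum (0::complex)) UNIV"
  shows "c m n = 0"
proof -
  have inner: "(\<lambda>n. c m n * w ^ n) summable_on UNIV" if w: "norm w < 1" for m w
  proof -
    \<comment> \<open>At the point \<open>1/2\<close> the power of the first variable is not zero and can be divided out.\<close>
    have "(\<lambda>(m, n). c m n * (1/2) ^ m * w ^ n) summable_on UNIV \<times> UNIV"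
      using has_sum_imp_summable[OF c[of "1/2" w]] w by simp
    then have "(\<lambda>n. c m n * (1/2) ^ m * w ^ n) summable_on UNIV"
      by (rule summable_on_SigmaD1[where A = UNIV and B = "\<lambda>_. UNIV"]) auto
    then have "(\<lambda>n. 2 ^ m * (c m n * (1/2) ^ m * w ^ n)) summable_on UNIV"
      by (rule summable_on_cmult_right)
    then show ?thesis by (simp add: field_simps power_one_over)
  qed
  have zero: "(\<Sum>\<^sub>\<infinity>n. c m n * w ^ n) = 0" if w: "norm w < 1" for m w
  proof (rule powser_zero_imp_coeff_zero)
    fix z :: complex assume z: "norm z < 1"
    have "((\<lambda>m. (\<Sum>\<^sub>\<infinity>n. c m n * w ^ n) * z ^ m) has_sum 0) UNIV"
    proof (rule has_sum_SigmaD[where B = "\<lambda>_. UNIV" and f = "\<lambda>(m, n). c m n * z ^ m * w ^ n"])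
      show "((\<lambda>(m, n). c m n * z ^ m * w ^ n) has_sum 0) (UNIV \<times> UNIV)" using c[OF z w] by simp
      fix m
      have "((\<lambda>n. z ^ m * (c m n * w ^ n)) has_sum (z ^ m * (\<Sum>\<^sub>\<infinity>n. c m n * w ^ n))) UNIV"
        by (intro has_sum_cmult_right has_sum_infsum inner w)
      then show "((\<lambda>n. case (m, n) of (m, n) \<Rightarrow> c m n * z ^ m * w ^ n) has_sum (\<Sum>\<^sub>\<infinity>n. c m n * w ^ n) * z ^ m) UNIV"
        by (simp add: mult_ac)
    qed
    then show "(\<lambda>m. (\<Sum>\<^sub>\<infinity>n. c m n * w ^ n) * z ^ m) sums 0" by (rule has_sum_imp_sums)
  qed
  show ?thesis
  proof (rule powser_zero_imp_coeff_zero)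
    fix w :: complex assume w: "norm w < 1"
    show "(\<lambda>n. c m n * w ^ n) sums 0"
      using has_sum_imp_sums[OF has_sum_infsum[OF inner[OF w, of m]]] zero[OF w] by simp
  qed
qed

lemma bidisc_coeff_eq:
  assumes f: "has_bidisc_expansion f a"
  shows "bidisc_coeff f = a"
  unfolding bidisc_coeff_def
proof (rule the_equality)
  show "has_bidisc_expansion f a" by (rule f)
next
  fix b assume b: "has_bidisc_expansion f b"
  have "b m n - a m n = 0" for m n
  proof (rule bidisc_expansion_zero[of "\<lambda>m n. b m n - a m n"])
    fix z w :: complex assume zw: "norm z < 1" "norm w < 1"
    have "((\<lambda>p. (case p of (m, n) \<Rightarrow> b m n * z ^ m * w ^ n) + - (case p of (m, n) \<Rightarrow> a m n * z ^ m * w ^ n)) has_sum (f (z, w) + - f (z, w))) UNIV"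
      using f b zw unfolding has_bidisc_expansion_def by (intro has_sum_add has_sum_uminusI) auto
    then show "((\<lambda>(m, n). (b m n - a m n) * z ^ m * w ^ n) has_sum 0) UNIV"
      by (simp add: case_prod_unfold algebra_simps)
  qed
  then show "b = a" by (auto simp: fun_eq_iff)
qed

definition bipoly :: "nat \<Rightarrow> (nat \<Rightarrow> nat \<Rightarrow> complex) \<Rightarrow> complex \<times> complex \<Rightarrow> complex" where
  "bipoly D b = (\<lambda>(z, w). \<Sum>m<D. \<Sum>n<D. b m n * z ^ m * w ^ n)"

lemma bipoly_dirichlet:
  shows "bipoly D b \<in> dirichlet_space"
    and "dirichlet_norm_sq (bipoly D b) = (\<Sum>m<D. \<Sum>n<D. (norm (b m n))\<^sup>2 * (real m + 1) * (real n + 1))"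
proof -
  define a where "a m n = (if m < D \<and> n < D then b m n else 0)" for m n
  have exp: "has_bidisc_expansion (bipoly D b) a"
    unfolding has_bidisc_expansion_def
  proof (intro ballI)
    fix z w :: complex
    have "((\<lambda>(m, n). a m n * z ^ m * w ^ n) has_sum (\<Sum>(m, n)\<in>{..<D} \<times> {..<D}. b m n * z ^ m * w ^ n)) UNIV"
      by (rule has_sum_finite_neutralI[where B = "{..<D} \<times> {..<D}"]) (auto simp: a_def intro!: sum.cong split: if_splits)
    then show "((\<lambda>(m, n). a m n * z ^ m * w ^ n) has_sum bipoly D b (z, w)) UNIV"
      by (simp add: bipoly_def sum.cartesian_product)
  qed
  have sums: "((\<lambda>(m, n). (norm (a m n))\<^sup>2 * (real m + 1) * (real n + 1)) has_sum
     (\<Sum>(m, n)\<in>{..<D} \<times> {..<D}. (norm (b m n))\<^sup>2 * (real m + 1) * (real n + 1))) UNIV"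
    by (rule has_sum_finite_neutralI[where B = "{..<D} \<times> {..<D}"]) (auto simp: a_def intro!: sum.cong split: if_splits)
  show "dirichlet_norm_sq (bipoly D b) = (\<Sum>m<D. \<Sum>n<D. (norm (b m n))\<^sup>2 * (real m + 1) * (real n + 1))"
    unfolding dirichlet_norm_sq_def bidisc_coeff_eq[OF exp] using infsumI[OF sums]
    by (simp add: sum.cartesian_product)
  have "holomorphic_on_bidisc (bipoly D b)"
    unfolding holomorphic_on_bidisc_def bipoly_def
    by (auto simp: case_prod_unfold intro!: continuous_intros holomorphic_intros)
  then show "bipoly D b \<in> dirichlet_space"
    using exp has_sum_imp_summable[OF sums] by (auto simp: dirichlet_space_def)
qed

section \<open>The logarithmic kernel\<close>

text \<open>The coefficients of \<open>10 - Ln (1 - w)\<close>. They are comparable to \<open>1 / (n + 1)\<close>, the reproducing kernel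
coefficients of the Dirichlet space; the large constant term makes the real part dominate.\<close>

definition log_coeff :: "nat \<Rightarrow> real" where
  "log_coeff n = (if n = 0 then 10 else 1 / real n)"

definition log_poly :: "nat \<Rightarrow> complex \<Rightarrow> complex" where
  "log_poly D w = (\<Sum>n<D. of_real (log_coeff n) * w ^ n)"

definition log_kernel :: "complex \<Rightarrow> real" where
  "log_kernel w = 10 - ln (norm (1 - w))"

definition bidisc_kernel :: "real \<Rightarrow> complex \<times> complex \<Rightarrow> complex \<times> complex \<Rightarrow> real" where
  "bidisc_kernel \<rho> z z' = log_kernel (of_real \<rho> * (fst z * cnj (fst z')))
     * log_kernel (of_real \<rho> * (snd z * cnj (snd z')))"

lemma cnj_measurable [measurable]: "cnj \<in> borel_measurable borel"
  by (intro borel_measurable_continuous_onI continuous_intros)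

lemma log_kernel_measurable [measurable]: "log_kernel \<in> borel_measurable borel"
  unfolding log_kernel_def by measurable

lemma bidisc_kernel_measurable [measurable]:
  assumes [measurable]: "(\<lambda>x. fst (f x)) \<in> borel_measurable M" "(\<lambda>x. snd (f x)) \<in> borel_measurable M"
       "(\<lambda>x. fst (g x)) \<in> borel_measurable M" "(\<lambda>x. snd (g x)) \<in> borel_measurable M"
  shows "(\<lambda>x. bidisc_kernel \<rho> (f x) (g x)) \<in> borel_measurable M"
  unfolding bidisc_kernel_def by measurable

lemma log_coeff_pos: "log_coeff n > 0"
  by (simp add: log_coeff_def)

lemma log_coeff_bounds: "1 \<le> log_coeff n * (real n + 1)" "log_coeff n * (real n + 1) \<le> 10"
  by (auto simp: log_coeff_def field_simps)

lemma log_kernel_ge: "norm w < 1 \<Longrightarrow> log_kernel w \<ge> 9"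
proof -
  assume w: "norm w < 1"
  have "norm (1 - w) \<le> 2" using norm_triangle_ineq4[of 1 w] w by simp
  moreover have "norm (1 - w) > 0" using w by auto
  ultimately have "ln (norm (1 - w)) \<le> norm (1 - w) - 1" by (intro ln_le_minus_one)
  with \<open>norm (1 - w) \<le> 2\<close> show ?thesis by (simp add: log_kernel_def)
qed

lemma log_poly_approx:
  assumes "0 \<le> \<rho>" "\<rho> < 1"
  shows "\<forall>\<^sub>F D in sequentially. \<forall>w. norm w \<le> \<rho> \<longrightarrow> norm (log_poly D w - (10 - Ln (1 - w))) \<le> 1"
proof -
  let ?f = "\<lambda>n w. of_real (log_coeff n) * w ^ n :: complex"
  have bound: "norm (?f n w) \<le> 10 * \<rho> ^ n" if "w \<in> cball 0 \<rho>" for n w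
  proof -
    have "log_coeff n \<le> 10" by (auto simp: log_coeff_def field_simps)
    moreover have "norm w ^ n \<le> \<rho> ^ n" using that by (intro power_mono) auto
    ultimately show ?thesis using log_coeff_pos[of n]
      by (auto simp: norm_mult norm_power intro!: mult_mono)
  qed
  have "summable (\<lambda>n. 10 * \<rho> ^ n)" using assms by (intro summable_mult summable_geometric) auto
  then have lim: "uniform_limit (cball 0 \<rho>) (\<lambda>D w. \<Sum>n<D. ?f n w) (\<lambda>w. suminf (\<lambda>n. ?f n w)) sequentially"
    by (intro Weierstrass_m_test[where M = "\<lambda>n. 10 * \<rho> ^ n"] bound)
  have "suminf (\<lambda>n. ?f n w) = 10 - Ln (1 - w)" if w: "norm w \<le> \<rho>" for w
  proof -
    have "(\<lambda>n. (-1) ^ Suc n / of_nat n * (-w) ^ n) sums Ln (1 + - w)"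
      using w assms by (intro Ln_series) auto
    then have "(\<lambda>n. - ((-1) ^ Suc n / of_nat n * (-w) ^ n)) sums (- Ln (1 + - w))"
      by (rule sums_minus)
    also have "(\<lambda>n. - ((-1) ^ Suc n / of_nat n * (-w) ^ n)) = (\<lambda>n. w ^ n / of_nat n)"
      by (auto simp: fun_eq_iff power_mult_distrib[symmetric] simp flip: mult.assoc)
    finally have "(\<lambda>n. (if n = 0 then 10 else 0) + w ^ n / of_nat n) sums (10 + - Ln (1 + - w))"
      by (intro sums_add sums_single)
    also have "(\<lambda>n. (if n = 0 then 10 else 0) + w ^ n / of_nat n) = (\<lambda>n. ?f n w)"
      by (auto simp: fun_eq_iff log_coeff_def)
    finally show ?thesis by (simp add: sums_iff)
  qed
  then have "uniform_limit (cball 0 \<rho>) (\<lambda>D w. log_poly D w) (\<lambda>w. 10 - Ln (1 - w)) sequentially"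
    using lim unfolding log_poly_def by (subst uniform_limit_cong'[where g = "\<lambda>D w. \<Sum>n<D. ?f n w" and i = "\<lambda>w. suminf (\<lambda>n. ?f n w)"]) auto
  then have "\<forall>\<^sub>F D in sequentially. \<forall>w\<in>cball 0 \<rho>. dist (log_poly D w) (10 - Ln (1 - w)) < 1"
    by (rule uniform_limitD) simp
  then show ?thesis by eventually_elim (simp add: dist_norm less_imp_le)
qed

text \<open>The imaginary part of the logarithm is at most \<open>pi\<close> in modulus, the error of the partial sum is at
most \<open>1\<close>, and \<open>log_kernel\<close> is at least \<open>9\<close>.\<close>

lemma log_poly_bounds:
  assumes w: "norm w < 1" and D: "norm (log_poly D w - (10 - Ln (1 - w))) \<le> 1"
  shows "norm (log_poly D w) \<le> 2 * log_kernel w"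
    and "Re (log_poly D w) \<ge> log_kernel w - 1" and "\<bar>Im (log_poly D w)\<bar> \<le> 5"
proof -
  have nz: "1 - w \<noteq> 0" using w by auto
  have Re: "Re (10 - Ln (1 - w)) = log_kernel w" using nz by (simp add: log_kernel_def)
  have Im: "\<bar>Im (10 - Ln (1 - w))\<bar> \<le> 4"
    using Im_Ln_le_pi[OF nz] mpi_less_Im_Ln[OF nz] pi_less_4 by simp
  have "\<bar>Re (log_poly D w - (10 - Ln (1 - w)))\<bar> \<le> 1" "\<bar>Im (log_poly D w - (10 - Ln (1 - w)))\<bar> \<le> 1"
    using abs_Re_le_cmod[of "log_poly D w - (10 - Ln (1 - w))"] abs_Im_le_cmod[of "log_poly D w - (10 - Ln (1 - w))"] D
    by linarith+
  then show "Re (log_poly D w) \<ge> log_kernel w - 1" "\<bar>Im (log_poly D w)\<bar> \<le> 5" using Re Im by simp_all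
  have "norm (10 - Ln (1 - w)) \<le> log_kernel w + 4"
    using cmod_le[of "10 - Ln (1 - w)"] Re Im log_kernel_ge[OF w] by simp
  moreover have "norm (log_poly D w) \<le> norm (log_poly D w - (10 - Ln (1 - w))) + norm (10 - Ln (1 - w))"
    by (metis diff_add_cancel norm_triangle_ineq)
  ultimately show "norm (log_poly D w) \<le> 2 * log_kernel w" using D log_kernel_ge[OF w] by linarith
qed

text \<open>The product of the real parts is at least \<open>(p - 1) * (q - 1)\<close> with \<open>p, q \<ge> 9\<close>, which outweighs
the product of the imaginary parts.\<close>

lemma Re_log_poly_mult_ge:
  assumes w: "norm w < 1" "norm (log_poly D w - (10 - Ln (1 - w))) \<le> 1"
    and v: "norm v < 1" "norm (log_poly D v - (10 - Ln (1 - v))) \<le> 1"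
  shows "Re (log_poly D w * log_poly D v) \<ge> log_kernel w * log_kernel v / 4"
proof -
  note W = log_poly_bounds(2,3)[OF w] and V = log_poly_bounds(2,3)[OF v]
  define p q where "p = log_kernel w" and "q = log_kernel v"
  have pq: "p \<ge> 9" "q \<ge> 9" using log_kernel_ge w(1) v(1) by (auto simp: p_def q_def)
  have "(p - 1) * (q - 1) \<le> Re (log_poly D w) * Re (log_poly D v)"
    using W V pq by (intro mult_mono) (auto simp: p_def q_def)
  moreover have "Im (log_poly D w) * Im (log_poly D v) \<le> 5 * 5"
  proof -
    have "\<bar>Im (log_poly D w)\<bar> * \<bar>Im (log_poly D v)\<bar> \<le> 5 * 5" using W V by (intro mult_mono) auto
    then show ?thesis by (simp flip: abs_mult)
  qed
  moreover have "p * q / 4 \<le> (p - 1) * (q - 1) - 5 * 5"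
  proof -
    have "0 \<le> (p - 9) * (q - 9)" using pq by simp
    then show ?thesis using pq by (simp add: algebra_simps)
  qed
  ultimately show ?thesis by (simp add: p_def q_def)
qed

section \<open>Moments and energy of a density\<close>

locale bidisc_measure = finite_measure \<mu> for \<mu> :: "(complex \<times> complex) measure" +
  assumes borel_on_bidisc: "borel_measure_on_closed_bidisc \<mu>"
begin

lemma sets_\<mu>: "sets \<mu> = sets (restrict_space borel closed_bidisc)"
  using borel_on_bidisc by (simp add: borel_measure_on_closed_bidisc_def)

lemma space_\<mu>: "space \<mu> = closed_bidisc"
  using sets_eq_imp_space_eq[OF sets_\<mu>] by (simp add: space_restrict_space)

lemma measurable_\<mu>: "f \<in> borel_measurable borel \<Longrightarrow> f \<in> borel_measurable \<mu>"
  by (subst measurable_cong_sets[OF sets_\<mu> refl]) (rule measurable_restrict_space1)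

lemma fst_measurable [measurable]: "fst \<in> borel_measurable \<mu>"
  and snd_measurable [measurable]: "snd \<in> borel_measurable \<mu>"
  by (auto intro!: measurable_\<mu> borel_measurable_continuous_onI continuous_intros)

lemma borel_sets_\<mu>: "S \<in> sets borel \<Longrightarrow> S \<subseteq> closed_bidisc \<Longrightarrow> S \<in> sets \<mu>"
  unfolding sets_\<mu> sets_restrict_space by (auto intro: image_eqI[of _ _ S])

lemma in_bidisc: "z \<in> space \<mu> \<Longrightarrow> norm (fst z) \<le> 1 \<and> norm (snd z) \<le> 1"
  by (auto simp: space_\<mu>)

lemma integrable_bounded:
  fixes f :: "complex \<times> complex \<Rightarrow> 'b :: {banach, second_countable_topology}"
  assumes "f \<in> borel_measurable \<mu>" "\<And>z. z \<in> space \<mu> \<Longrightarrow> norm (f z) \<le> B"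
  shows "integrable \<mu> f"
  by (rule integrable_const_bound[of _ B]) (use assms in auto)

end

lemma integral_double_sum:
  fixes f :: "nat \<Rightarrow> nat \<Rightarrow> 'a \<Rightarrow> complex"
  assumes "\<And>m n. integrable M (f m n)"
  shows "(\<integral>z. (\<Sum>m<D. \<Sum>n<D. f m n z) \<partial>M) = (\<Sum>m<D. \<Sum>n<D. \<integral>z. f m n z \<partial>M)"
  using assms by (simp add: Bochner_Integration.integral_sum Bochner_Integration.integrable_sum)

text \<open>The density \<open>\<phi>\<close> is an indicator function in one direction of the theorem and the conjugate of a
polynomial in the other.\<close>

locale bidisc_density = bidisc_measure +
  fixes \<phi> :: "complex \<times> complex \<Rightarrow> complex" and B :: real
  assumes phi_measurable [measurable]: "\<phi> \<in> borel_measurable \<mu>"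
    and phi_bounded: "z \<in> space \<mu> \<Longrightarrow> norm (\<phi> z) \<le> B"
begin

definition moment :: "nat \<Rightarrow> nat \<Rightarrow> complex" where
  "moment m n = (\<integral>z. fst z ^ m * snd z ^ n * \<phi> z \<partial>\<mu>)"

definition energy :: "nat \<Rightarrow> real \<Rightarrow> real" where
  "energy D \<rho> = (\<Sum>m<D. \<Sum>n<D. log_coeff m * log_coeff n * \<rho> ^ m * \<rho> ^ n * (norm (moment m n))\<^sup>2)"

definition energy_kernel :: "nat \<Rightarrow> real \<Rightarrow> complex \<times> complex \<Rightarrow> complex \<times> complex \<Rightarrow> complex" where
  "energy_kernel D \<rho> z z' = log_poly D (of_real \<rho> * (fst z * cnj (fst z')))
     * log_poly D (of_real \<rho> * (snd z * cnj (snd z')))"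

lemma integrable_monomial: "integrable \<mu> (\<lambda>z. fst z ^ m * snd z ^ n * \<phi> z)"
proof (rule integrable_bounded[where B = B])
  fix z assume z: "z \<in> space \<mu>"
  have "norm (fst z) ^ m * norm (snd z) ^ n \<le> 1 * 1"
    using in_bidisc[OF z] by (intro mult_mono power_le_one) auto
  then have "norm (fst z) ^ m * norm (snd z) ^ n * norm (\<phi> z) \<le> 1 * B"
    using phi_bounded[OF z] by (intro mult_mono) auto
  then show "norm (fst z ^ m * snd z ^ n * \<phi> z) \<le> B"
    by (simp add: norm_mult norm_power)
qed measurable

lemma energy_kernel_expand:
  "energy_kernel D \<rho> z z' * \<phi> z * cnj (\<phi> z') =
    (\<Sum>m<D. \<Sum>n<D. of_real (log_coeff m * log_coeff n * \<rho> ^ m * \<rho> ^ n) * (fst z ^ m * snd z ^ n * \<phi> z)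
        * cnj (fst z' ^ m * snd z' ^ n * \<phi> z'))"
  unfolding energy_kernel_def log_poly_def sum_product
  unfolding sum_distrib_right
  by (intro sum.cong refl) (simp add: power_mult_distrib mult_ac)

lemma integrable_energy_kernel: "integrable \<mu> (\<lambda>z'. energy_kernel D \<rho> z z' * \<phi> z * cnj (\<phi> z'))"
  unfolding energy_kernel_expand
  by (intro Bochner_Integration.integrable_sum integrable_mult_right integrable_cnj integrable_monomial)

lemma integral_energy_kernel:
  "(\<integral>z'. energy_kernel D \<rho> z z' * \<phi> z * cnj (\<phi> z') \<partial>\<mu>) =
    (\<Sum>m<D. \<Sum>n<D. of_real (log_coeff m * log_coeff n * \<rho> ^ m * \<rho> ^ n) * (fst z ^ m * snd z ^ n * \<phi> z)
        * cnj (moment m n))"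
  unfolding energy_kernel_expand moment_def
  by (subst integral_double_sum)
     (simp_all only: integral_mult_right_zero Bochner_Integration.integral_cnj integrable_mult_right integrable_cnj integrable_monomial)

lemma integrable_integral_energy_kernel:
  "integrable \<mu> (\<lambda>z. \<integral>z'. energy_kernel D \<rho> z z' * \<phi> z * cnj (\<phi> z') \<partial>\<mu>)"
  unfolding integral_energy_kernel
  by (intro Bochner_Integration.integrable_sum integrable_mult_right integrable_mult_left integrable_monomial)

text \<open>The sum of the weighted squares of the moments is the quadratic form of the truncated reproducing kernel at
\<open>\<phi>\<close>.\<close>

lemma energy_eq:
  "(\<integral>z. \<integral>z'. energy_kernel D \<rho> z z' * \<phi> z * cnj (\<phi> z') \<partial>\<mu> \<partial>\<mu>) = of_real (energy D \<rho>)"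
proof -
  have "(\<integral>z. \<integral>z'. energy_kernel D \<rho> z z' * \<phi> z * cnj (\<phi> z') \<partial>\<mu> \<partial>\<mu>) =
    (\<Sum>m<D. \<Sum>n<D. of_real (log_coeff m * log_coeff n * \<rho> ^ m * \<rho> ^ n) * moment m n * cnj (moment m n))"
    unfolding integral_energy_kernel
    by (subst integral_double_sum)
       (simp_all only: integral_mult_right_zero integral_mult_left_zero moment_def integrable_mult_right
          integrable_mult_left integrable_monomial)
  also have "\<dots> = of_real (energy D \<rho>)"
    unfolding energy_def of_real_sum
    by (intro sum.cong refl) (simp add: complex_norm_square[symmetric] mult.assoc)
  finally show ?thesis .
qed

lemma energy_nonneg: "\<rho> \<ge> 0 \<Longrightarrow> 0 \<le> energy D \<rho>"
  unfolding energy_def using log_coeff_pos less_imp_le by (intro sum_nonneg mult_nonneg_nonneg) auto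

lemma energy_mono: "\<rho> \<ge> 0 \<Longrightarrow> D \<le> D' \<Longrightarrow> energy D \<rho> \<le> energy D' \<rho>"
proof -
  assume a: "\<rho> \<ge> 0" "D \<le> D'"
  have nn: "0 \<le> log_coeff m * log_coeff n * \<rho> ^ m * \<rho> ^ n * (norm (moment m n))\<^sup>2" for m n
    using log_coeff_pos[of m] log_coeff_pos[of n] a by simp
  have "energy D \<rho> \<le> (\<Sum>m<D. \<Sum>n<D'. log_coeff m * log_coeff n * \<rho> ^ m * \<rho> ^ n * (norm (moment m n))\<^sup>2)"
    unfolding energy_def using a nn by (intro sum_mono sum_mono2) auto
  also have "\<dots> \<le> energy D' \<rho>"
    unfolding energy_def using a nn by (intro sum_mono2) (auto intro: sum_nonneg)
  finally show ?thesis .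
qed

lemma norm_dilated_product:
  assumes "0 \<le> \<rho>" "norm a \<le> 1" "norm b \<le> 1"
  shows "norm (of_real \<rho> * (a * cnj b)) \<le> \<rho>"
proof -
  have "norm a * norm b \<le> 1 * 1" using assms by (intro mult_mono) auto
  then show ?thesis using assms mult_left_mono[of "norm a * norm b" 1 \<rho>] by (simp add: norm_mult)
qed

text \<open>Since the energy increases with the degree \<open>D\<close>, the degree may be raised until the partial sum of the kernel is within
\<open>1\<close> of its limit.\<close>

lemma energy_le:
  assumes \<rho>: "0 \<le> \<rho>" "\<rho> < 1"
  shows "ennreal (energy D \<rho>) \<le> (\<integral>\<^sup>+ z. \<integral>\<^sup>+ z'. ennreal (4 * (bidisc_kernel \<rho> z z')) * ennreal (norm (\<phi> z)) * ennreal (norm (\<phi> z')) \<partial>\<mu> \<partial>\<mu>)"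
proof -
  obtain D0 where D0: "\<And>E w. E \<ge> D0 \<Longrightarrow> norm w \<le> \<rho> \<Longrightarrow> norm (log_poly E w - (10 - Ln (1 - w))) \<le> 1"
    using log_poly_approx[OF \<rho>] unfolding eventually_sequentially by blast
  define E where "E = max D D0"
  have E: "norm (log_poly E w) \<le> 2 * log_kernel w" if "norm w \<le> \<rho>" for w
    using that \<rho> by (intro log_poly_bounds D0) (auto simp: E_def)
  have "ennreal (energy D \<rho>) \<le> ennreal (energy E \<rho>)"
    using \<rho> by (intro ennreal_leI energy_mono) (auto simp: E_def)
  also have "energy E \<rho> = norm (\<integral>z. \<integral>z'. energy_kernel E \<rho> z z' * \<phi> z * cnj (\<phi> z') \<partial>\<mu> \<partial>\<mu>)"
    using energy_nonneg[OF \<rho>(1), of E] by (simp add: energy_eq)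
  also have "ennreal \<dots> \<le> (\<integral>\<^sup>+ z. norm (\<integral>z'. energy_kernel E \<rho> z z' * \<phi> z * cnj (\<phi> z') \<partial>\<mu>) \<partial>\<mu>)"
    by (intro integral_norm_bound_ennreal integrable_integral_energy_kernel)
  also have "\<dots> \<le> (\<integral>\<^sup>+ z. \<integral>\<^sup>+ z'. norm (energy_kernel E \<rho> z z' * \<phi> z * cnj (\<phi> z')) \<partial>\<mu> \<partial>\<mu>)"
    by (intro nn_integral_mono integral_norm_bound_ennreal integrable_energy_kernel)
  also have "\<dots> \<le> (\<integral>\<^sup>+ z. \<integral>\<^sup>+ z'. ennreal (4 * (bidisc_kernel \<rho> z z')) * ennreal (norm (\<phi> z)) * ennreal (norm (\<phi> z')) \<partial>\<mu> \<partial>\<mu>)"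
  proof (intro nn_integral_mono)
    fix z z' assume zz: "z \<in> space \<mu>" "z' \<in> space \<mu>"
    let ?w = "of_real \<rho> * (fst z * cnj (fst z'))" and ?v = "of_real \<rho> * (snd z * cnj (snd z'))"
    have wv: "norm ?w \<le> \<rho>" "norm ?v \<le> \<rho>" using norm_dilated_product[OF \<rho>(1)] zz in_bidisc by auto
    have pos: "log_kernel ?w \<ge> 9" "log_kernel ?v \<ge> 9" using wv \<rho> by (auto intro!: log_kernel_ge)
    have "norm (energy_kernel E \<rho> z z') \<le> (2 * log_kernel ?w) * (2 * log_kernel ?v)"
      unfolding energy_kernel_def norm_mult using E wv pos by (intro mult_mono) auto
    then have "norm (energy_kernel E \<rho> z z' * \<phi> z * cnj (\<phi> z')) \<le> 4 * (log_kernel ?w * log_kernel ?v) * norm (\<phi> z) * norm (\<phi> z')"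
      unfolding norm_mult complex_mod_cnj by (intro mult_right_mono) auto
    then show "ennreal (norm (energy_kernel E \<rho> z z' * \<phi> z * cnj (\<phi> z')))
      \<le> ennreal (4 * (bidisc_kernel \<rho> z z')) * ennreal (norm (\<phi> z)) * ennreal (norm (\<phi> z'))"
      using pos by (simp add: bidisc_kernel_def ennreal_mult[symmetric] ennreal_leI)
  qed
  finally show ?thesis .
qed

text \<open>For a nonnegative density only the real part of the kernel contributes, and it is bounded below by the
positive kernel.\<close>

lemma energy_ge:
  assumes \<rho>: "0 \<le> \<rho>" "\<rho> < 1" and \<phi>: "\<And>z. z \<in> space \<mu> \<Longrightarrow> \<phi> z = of_real (p z) \<and> 0 \<le> p z"
  shows "\<forall>\<^sub>F D in sequentially. (\<integral>\<^sup>+ z. \<integral>\<^sup>+ z'. ennreal (bidisc_kernel \<rho> z z') * ennreal (p z) * ennreal (p z') \<partial>\<mu> \<partial>\<mu>) \<le> ennreal (4 * energy D \<rho>)"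
  using log_poly_approx[OF \<rho>]
proof eventually_elim
  case (elim D)
  define F where "F z z' = energy_kernel D \<rho> z z' * \<phi> z * cnj (\<phi> z')" for z z'
  have F: "bidisc_kernel \<rho> z z' * p z * p z'
       \<le> 4 * Re (F z z') \<and> 0 \<le> Re (F z z')"
    if zz: "z \<in> space \<mu>" "z' \<in> space \<mu>" for z z'
  proof -
    let ?w = "of_real \<rho> * (fst z * cnj (fst z'))" and ?v = "of_real \<rho> * (snd z * cnj (snd z'))"
    have wv: "norm ?w \<le> \<rho>" "norm ?v \<le> \<rho>" using norm_dilated_product[OF \<rho>(1)] zz in_bidisc by auto
    then have "norm ?w < 1" "norm ?v < 1" using \<rho> by linarith+
    then have pos: "log_kernel ?w \<ge> 9" "log_kernel ?v \<ge> 9" by (auto intro!: log_kernel_ge)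
    have ge: "log_kernel ?w * log_kernel ?v / 4 \<le> Re (energy_kernel D \<rho> z z')"
      unfolding energy_kernel_def using wv \<open>norm ?w < 1\<close> \<open>norm ?v < 1\<close> elim
      by (intro Re_log_poly_mult_ge) auto
    have "Re (F z z') = Re (energy_kernel D \<rho> z z') * (p z * p z')"
      using \<phi>[OF zz(1)] \<phi>[OF zz(2)] by (simp add: F_def mult_ac)
    moreover have "log_kernel ?w * log_kernel ?v / 4 * (p z * p z') \<le> Re (energy_kernel D \<rho> z z') * (p z * p z')"
      using ge \<phi>[OF zz(1)] \<phi>[OF zz(2)] by (intro mult_right_mono) auto
    moreover have "0 \<le> log_kernel ?w * log_kernel ?v / 4 * (p z * p z')"
      using pos \<phi>[OF zz(1)] \<phi>[OF zz(2)] by (intro mult_nonneg_nonneg) auto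
    ultimately show ?thesis by (simp add: bidisc_kernel_def mult_ac)
  qed
  have "(\<integral>\<^sup>+ z. \<integral>\<^sup>+ z'. ennreal (bidisc_kernel \<rho> z z') * ennreal (p z) * ennreal (p z') \<partial>\<mu> \<partial>\<mu>)
     \<le> (\<integral>\<^sup>+ z. \<integral>\<^sup>+ z'. ennreal (4 * Re (F z z')) \<partial>\<mu> \<partial>\<mu>)"
  proof (intro nn_integral_mono)
    fix z z' assume zz: "z \<in> space \<mu>" "z' \<in> space \<mu>"
    have "ennreal (bidisc_kernel \<rho> z z') * ennreal (p z) * ennreal (p z')
      = ennreal (bidisc_kernel \<rho> z z' * p z * p z')"
      using \<phi>[OF zz(1)] \<phi>[OF zz(2)] by (simp add: ennreal_mult''[symmetric])
    also have "\<dots> \<le> ennreal (4 * Re (F z z'))" using F[OF zz] by (intro ennreal_leI) auto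
    finally show "ennreal (bidisc_kernel \<rho> z z') * ennreal (p z) * ennreal (p z') \<le> ennreal (4 * Re (F z z'))" .
  qed
  also have "\<dots> = (\<integral>\<^sup>+ z. ennreal (4 * Re (\<integral>z'. F z z' \<partial>\<mu>)) \<partial>\<mu>)"
  proof (intro nn_integral_cong)
    fix z assume z: "z \<in> space \<mu>"
    have int: "integrable \<mu> (F z)" unfolding F_def by (rule integrable_energy_kernel)
    have "(\<integral>\<^sup>+ z'. ennreal (4 * Re (F z z')) \<partial>\<mu>) = ennreal (\<integral>z'. 4 * Re (F z z') \<partial>\<mu>)"
      using F[OF z] int by (intro nn_integral_eq_integral) auto
    also have "(\<integral>z'. 4 * Re (F z z') \<partial>\<mu>) = 4 * Re (\<integral>z'. F z z' \<partial>\<mu>)"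
      using int by simp
    finally show "(\<integral>\<^sup>+ z'. ennreal (4 * Re (F z z')) \<partial>\<mu>) = ennreal (4 * Re (\<integral>z'. F z z' \<partial>\<mu>))" .
  qed
  also have "\<dots> = ennreal (\<integral>z. 4 * Re (\<integral>z'. F z z' \<partial>\<mu>) \<partial>\<mu>)"
  proof (intro nn_integral_eq_integral)
    show "integrable \<mu> (\<lambda>z. 4 * Re (\<integral>z'. F z z' \<partial>\<mu>))"
      unfolding F_def by (intro integrable_mult_right integrable_Re integrable_integral_energy_kernel)
    show "AE z in \<mu>. 0 \<le> 4 * Re (\<integral>z'. F z z' \<partial>\<mu>)"
    proof (intro AE_I2)
      fix z assume z: "z \<in> space \<mu>"
      have int: "integrable \<mu> (F z)" unfolding F_def by (rule integrable_energy_kernel)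
      have "Re (\<integral>z'. F z z' \<partial>\<mu>) = (\<integral>z'. Re (F z z') \<partial>\<mu>)" using int by simp
      also have "\<dots> \<ge> 0" using F[OF z] by (intro integral_nonneg_AE AE_I2) auto
      finally show "0 \<le> 4 * Re (\<integral>z'. F z z' \<partial>\<mu>)" by simp
    qed
  qed
  also have "(\<integral>z. 4 * Re (\<integral>z'. F z z' \<partial>\<mu>) \<partial>\<mu>) = 4 * Re (\<integral>z. \<integral>z'. F z z' \<partial>\<mu> \<partial>\<mu>)"
    unfolding F_def using integrable_integral_energy_kernel by simp
  also have "\<dots> = 4 * energy D \<rho>"
    unfolding F_def energy_eq by simp
  finally show ?case .
qed

end

section \<open>Truncated kernels\<close>

text \<open>The kernel \<open>1 / sqrt (angle (direction z) \<zeta>)\<close> as a dyadic sum over caps, cut off at the distance of \<open>z\<close> from the circle and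
at the scale \<open>N\<close>; \<open>sqrt 2 ^ n\<close> is the size of the kernel at distance \<open>(1/2) ^ n\<close>.\<close>

definition truncated_kernel :: "nat \<Rightarrow> complex \<Rightarrow> complex \<Rightarrow> real" where
  "truncated_kernel N z \<zeta> = (\<Sum>n\<le>N.
     if 1 - norm z \<le> (1/2) ^ n \<and> angle (direction z) \<zeta> \<le> 2 * pi * (1/2) ^ n then sqrt 2 ^ n else 0)"

lemma truncated_kernel_nonneg [simp]: "0 \<le> truncated_kernel N z \<zeta>"
  unfolding truncated_kernel_def by (intro sum_nonneg) auto

lemma truncated_kernel_measurable [measurable]:
  assumes [measurable]: "f \<in> borel_measurable M" "g \<in> borel_measurable M"
  shows "(\<lambda>x. truncated_kernel N (f x) (g x)) \<in> borel_measurable M"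
  unfolding truncated_kernel_def by measurable

lemma truncated_kernel_ge:
  assumes "n \<le> N" "1 - norm z \<le> (1/2) ^ n" "angle (direction z) \<zeta> \<le> 2 * pi * (1/2) ^ n"
  shows "sqrt 2 ^ n \<le> truncated_kernel N z \<zeta>"
proof -
  have "sqrt 2 ^ n = (if 1 - norm z \<le> (1/2) ^ n \<and> angle (direction z) \<zeta> \<le> 2 * pi * (1/2) ^ n then sqrt 2 ^ n else 0)"
    using assms by simp
  also have "\<dots> \<le> truncated_kernel N z \<zeta>"
    unfolding truncated_kernel_def using assms(1)
    by (intro member_le_sum[where f = "\<lambda>n. if 1 - norm z \<le> (1/2) ^ n \<and> angle (direction z) \<zeta> \<le> 2 * pi * (1/2) ^ n then sqrt 2 ^ n else 0"]) auto
  finally show ?thesis .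
qed

lemma sum_inv_sqrt2_power_le: "(\<Sum>m\<in>{k..N}. (1 / sqrt 2) ^ (m - k)) \<le> 4"
proof -
  have q: "1 / sqrt 2 \<le> 3/4"
    by (rule power2_le_imp_le) (auto simp: power_divide)
  have "(\<Sum>m\<in>{k..N}. (1 / sqrt 2) ^ (m - k)) = (\<Sum>j<Suc N - k. (1 / sqrt 2) ^ j)"
    by (rule sum.reindex_bij_witness[of _ "\<lambda>j. j + k" "\<lambda>m. m - k"]) auto
  also have "\<dots> \<le> (\<Sum>j<Suc N - k. (3/4) ^ j)"
    using q by (intro sum_mono power_mono) auto
  also have "\<dots> \<le> 4" by (subst sum_gp_strict) simp
  finally show ?thesis .
qed

text \<open>The intersection is contained in the smaller cap, and it is empty unless the centres are within
the sum of the radii.\<close>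

lemma cap_intersection_le:
  assumes e: "norm e = 1" "norm e' = 1"
  shows "emeasure circle_measure {\<zeta>. norm \<zeta> = 1 \<and> angle e \<zeta> \<le> 2 * pi * (1/2) ^ n \<and> angle e' \<zeta> \<le> 2 * pi * (1/2) ^ m}
     \<le> ennreal (2 * (1/2) ^ (max n m) * of_bool (angle e e' \<le> 4 * pi * (1/2) ^ (min n m)))" (is "emeasure _ ?X \<le> _")
proof (cases "angle e e' \<le> 4 * pi * (1/2) ^ (min n m)")
  case True
  have "emeasure circle_measure {\<zeta>. angle u \<zeta> \<le> 2 * pi * (1/2) ^ k} \<le> ennreal (2 * (1/2) ^ k)" if "norm u = 1" for u k
    using emeasure_angle_le[OF that, of "2 * pi * (1/2) ^ k"] by simp
  moreover have "emeasure circle_measure ?X \<le> emeasure circle_measure {\<zeta>. angle e \<zeta> \<le> 2 * pi * (1/2) ^ n}"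
    "emeasure circle_measure ?X \<le> emeasure circle_measure {\<zeta>. angle e' \<zeta> \<le> 2 * pi * (1/2) ^ m}"
    by (intro emeasure_mono; force)+
  ultimately have "emeasure circle_measure ?X \<le> ennreal (2 * (1/2) ^ n)" "emeasure circle_measure ?X \<le> ennreal (2 * (1/2) ^ m)"
    using e order_trans by blast+
  then show ?thesis using True by (auto simp: max_def)
next
  case False
  have "?X = {}"
  proof (rule ccontr)
    assume "?X \<noteq> {}"
    then obtain \<zeta> where \<zeta>: "norm \<zeta> = 1" "angle e \<zeta> \<le> 2 * pi * (1/2) ^ n" "angle e' \<zeta> \<le> 2 * pi * (1/2) ^ m" by blast
    have "angle e e' \<le> angle e \<zeta> + angle \<zeta> e'" using e \<zeta> by (intro angle_triangle)
    also have "\<dots> \<le> 2 * pi * (1/2) ^ n + 2 * pi * (1/2) ^ m"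
      using \<zeta> e angle_commute[of \<zeta> e'] by simp
    also have "\<dots> \<le> 2 * pi * (1/2) ^ (min n m) + 2 * pi * (1/2) ^ (min n m)"
      by (intro add_mono mult_left_mono power_decreasing) auto
    finally show False using False by simp
  qed
  show ?thesis unfolding \<open>?X = {}\<close> by simp
qed

text \<open>The product is moved to \<open>1\<close> first along the radius and then along the circle.\<close>

lemma norm_one_minus_product_le:
  assumes z: "norm z \<le> 1" "norm z' \<le> 1" and \<rho>: "0 \<le> \<rho>" "\<rho> \<le> 1"
  shows "norm (1 - of_real \<rho> * (z * cnj z'))
     \<le> (1 - \<rho>) + (1 - norm z) + (1 - norm z') + angle (direction z) (direction z')"
proof -
  define e e' where "e = direction z" and "e' = direction z'"
  have e: "norm e = 1" "norm e' = 1" by (auto simp: e_def e'_def)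
  have "e * cnj e' = e / e'" using e by (subst complex_div_cnj) simp
  also have "\<dots> = cis (Arg (e / e'))" using e by (intro unit_eq_cis) (auto simp: norm_divide)
  finally have ee: "e * cnj e' = cis (Arg (e / e'))" .
  define q where "q = \<rho> * norm z * norm z'"
  have q01: "0 \<le> q" "q \<le> 1"
    using z \<rho> unfolding q_def by (auto intro!: mult_le_one)
  have zz: "z = of_real (norm z) * e" "z' = of_real (norm z') * e'"
    by (simp_all add: e_def e'_def norm_times_direction)
  have "of_real \<rho> * (z * cnj z') = of_real \<rho> * ((of_real (norm z) * e) * cnj (of_real (norm z') * e'))"
    by (simp only: zz[symmetric])
  also have "\<dots> = of_real q * (e * cnj e')" by (simp add: q_def mult_ac)
  finally have "of_real \<rho> * (z * cnj z') = of_real q * (e * cnj e')" .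
  then have "norm (1 - of_real \<rho> * (z * cnj z')) = norm (of_real (1 - q) + of_real q * (1 - cis (Arg (e / e'))))"
    by (simp add: ee algebra_simps)
  also have "\<dots> \<le> (1 - q) + q * norm (1 - cis (Arg (e / e')))"
    using q01 by (intro order_trans[OF norm_triangle_ineq]) (simp add: norm_mult del: of_real_diff)
  also have "\<dots> \<le> (1 - q) + 1 * \<bar>Arg (e / e')\<bar>"
  proof (intro add_left_mono mult_mono)
    have "norm (cis (Arg (e / e')) - 1) \<le> \<bar>Arg (e / e')\<bar>"
      using dist_exp_i_1[of "Arg (e / e')"] abs_sin_x_le_abs_x[of "Arg (e / e') / 2"] by (simp add: cis_conv_exp dist_norm)
    then show "norm (1 - cis (Arg (e / e'))) \<le> \<bar>Arg (e / e')\<bar>" by (simp add: norm_minus_commute)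
  qed (use q01 in auto)
  also have "1 - q \<le> (1 - \<rho>) + (1 - norm z) + (1 - norm z')"
  proof -
    have "norm z * norm z' \<le> 1 * 1" using z by (intro mult_mono) auto
    then have "(1 - \<rho>) * (norm z * norm z') \<le> (1 - \<rho>) * 1"
      using \<rho> by (intro mult_left_mono) auto
    moreover have "0 \<le> (1 - norm z) * (1 - norm z')" using z by simp
    ultimately show ?thesis by (simp add: q_def algebra_simps)
  qed
  finally show ?thesis by (simp add: angle_def e_def e'_def)
qed

lemma log_kernel_ge_level:
  assumes "norm (1 - w) \<le> 32 * (1/2) ^ k" "w \<noteq> 1"
  shows "real (k + 1) \<le> 2 * log_kernel w"
proof -
  have "ln (norm (1 - w)) \<le> ln (2 ^ 5 * (1/2) ^ k)" using assms by (subst ln_le_cancel_iff) auto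
  also have "\<dots> = ln ((2::real) ^ 5) + ln ((1/2) ^ k)" by (simp add: ln_mult_pos)
  also have "ln ((2::real) ^ 5) = 5 * ln 2" by (subst ln_realpow) auto
  also have "ln ((1/2::real) ^ k) = - real k * ln 2" by (subst ln_realpow) (auto simp: ln_div)
  finally have "ln (norm (1 - w)) \<le> 5 * ln 2 - real k * ln 2" by simp
  also have "\<dots> \<le> 5 * 1 - real k * (1/2)"
    using ln_2_less_1 ln2_ge_two_thirds by (intro diff_mono mult_left_mono) auto
  finally show ?thesis by (simp add: log_kernel_def)
qed

text \<open>A pair of caps of levels \<open>n\<close> and \<open>m\<close> contributes \<open>sqrt 2 ^ (n + m) * (1/2) ^ max n m\<close>, which decays
geometrically in the difference of the levels. So the integral is at most a multiple of the number of levels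
\<open>k\<close> at which both caps are present and close to each other. At the largest such level
\<open>1 - \<rho> * z * cnj z'\<close> is at most \<open>32 * (1/2) ^ k\<close>, so \<open>k\<close> is bounded by the logarithmic kernel.\<close>

lemma truncated_kernel_convolution_le:
  assumes z: "norm z \<le> 1" "norm z' \<le> 1" and \<rho>: "0 \<le> \<rho>" "\<rho> < 1" "1 - \<rho> \<le> (1/2) ^ N"
  shows "(\<integral>\<^sup>+ \<zeta>. ennreal (truncated_kernel N z \<zeta> * truncated_kernel N z' \<zeta>) \<partial>circle_measure)
    \<le> ennreal (32 * log_kernel (of_real \<rho> * (z * cnj z')))"
proof -
  define e e' where "e = direction z" and "e' = direction z'"
  have e: "norm e = 1" "norm e' = 1" by (auto simp: e_def e'_def)
  define c :: "nat \<Rightarrow> real" where "c k = of_bool (1 - norm z \<le> (1/2) ^ k \<and> 1 - norm z' \<le> (1/2) ^ k \<and> angle e e' \<le> 4 * pi * (1/2) ^ k)" for k :: nat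
  have c0: "0 \<le> c k" for k by (simp add: c_def)
  define X where "X n m = {\<zeta>. norm \<zeta> = 1 \<and> angle e \<zeta> \<le> 2 * pi * (1/2) ^ n \<and> angle e' \<zeta> \<le> 2 * pi * (1/2) ^ m}" for n m :: nat
  have X[measurable]: "X n m \<in> sets borel" for n m unfolding X_def by measurable
  define d where "d n m = (if 1 - norm z \<le> (1/2) ^ n \<and> 1 - norm z' \<le> (1/2) ^ m then sqrt 2 ^ n * sqrt 2 ^ m else 0)" for n m :: nat
  have d0: "0 \<le> d n m" for n m by (simp add: d_def)
  have "(\<integral>\<^sup>+ \<zeta>. ennreal (truncated_kernel N z \<zeta> * truncated_kernel N z' \<zeta>) \<partial>circle_measure)
     = (\<integral>\<^sup>+ \<zeta>. (\<Sum>n\<le>N. \<Sum>m\<le>N. ennreal (d n m) * indicator (X n m) \<zeta>) \<partial>circle_measure)"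
  proof (rule nn_integral_cong_AE, use AE_circle_norm in eventually_elim)
    case (elim \<zeta>)
    have "truncated_kernel N z \<zeta> * truncated_kernel N z' \<zeta> = (\<Sum>n\<le>N. \<Sum>m\<le>N. d n m * indicator (X n m) \<zeta>)"
      unfolding truncated_kernel_def sum_product using elim
      by (intro sum.cong refl) (simp add: d_def X_def e_def e'_def indicator_def)
    moreover have "(\<Sum>n\<le>N. \<Sum>m\<le>N. ennreal (d n m) * indicator (X n m) \<zeta>)
        = (\<Sum>n\<le>N. \<Sum>m\<le>N. ennreal (d n m * indicator (X n m) \<zeta>))"
      by (intro sum.cong refl) (simp add: indicator_def)
    moreover have "\<dots> = (\<Sum>n\<le>N. ennreal (\<Sum>m\<le>N. d n m * indicator (X n m) \<zeta>))"
      by (intro sum.cong refl sum_ennreal) (simp add: d0)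
    moreover have "\<dots> = ennreal (\<Sum>n\<le>N. \<Sum>m\<le>N. d n m * indicator (X n m) \<zeta>)"
      by (intro sum_ennreal sum_nonneg) (simp add: d0)
    ultimately show ?case by simp
  qed
  also have "\<dots> = (\<Sum>n\<le>N. \<Sum>m\<le>N. ennreal (d n m) * emeasure circle_measure (X n m))"
  proof -
    have "(\<integral>\<^sup>+ \<zeta>. (\<Sum>n\<le>N. \<Sum>m\<le>N. ennreal (d n m) * indicator (X n m) \<zeta>) \<partial>circle_measure)
       = (\<Sum>n\<le>N. \<integral>\<^sup>+ \<zeta>. (\<Sum>m\<le>N. ennreal (d n m) * indicator (X n m) \<zeta>) \<partial>circle_measure)"
      by (rule nn_integral_sum) measurable
    also have "\<dots> = (\<Sum>n\<le>N. \<Sum>m\<le>N. \<integral>\<^sup>+ \<zeta>. ennreal (d n m) * indicator (X n m) \<zeta> \<partial>circle_measure)"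
      by (intro sum.cong refl nn_integral_sum) measurable
    finally show ?thesis by (simp only: nn_integral_cmult_indicator sets_circle_measure X)
  qed
  also have "\<dots> \<le> (\<Sum>n\<le>N. \<Sum>m\<le>N. ennreal (2 * (c (min n m) * (1 / sqrt 2) ^ (max n m - min n m))))"
  proof (intro sum_mono)
    fix n m :: nat
    have "ennreal (d n m) * emeasure circle_measure (X n m)
      \<le> ennreal (d n m) * ennreal (2 * (1/2) ^ (max n m) * of_bool (angle e e' \<le> 4 * pi * (1/2) ^ (min n m)))"
      unfolding X_def by (intro mult_left_mono cap_intersection_le e) auto
    also have "\<dots> = ennreal (d n m * (2 * (1/2) ^ (max n m) * of_bool (angle e e' \<le> 4 * pi * (1/2) ^ (min n m))))"
      using d0 by (intro ennreal_mult[symmetric]) auto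
    also have "\<dots> \<le> ennreal (2 * (c (min n m) * (1 / sqrt 2) ^ (max n m - min n m)))"
    proof (rule ennreal_leI)
      have mono: "(1/2::real) ^ n \<le> (1/2) ^ (min n m)" "(1/2::real) ^ m \<le> (1/2) ^ (min n m)"
        by (auto intro!: power_decreasing)
      have gen: "sqrt 2 ^ i * sqrt 2 ^ j * (1/2) ^ j = (1 / sqrt 2) ^ (j - i)" if "i \<le> j" for i j :: nat
      proof -
        obtain l where j: "j = i + l" using \<open>i \<le> j\<close> le_Suc_ex by blast
        have "sqrt 2 ^ i * sqrt 2 ^ j * (1/2) ^ j = (sqrt 2 * sqrt 2 * (1/2)) ^ i * (sqrt 2 * (1/2)) ^ l"
          by (simp only: j power_add power_mult_distrib mult_ac)
        also have "sqrt 2 * (1/2) = 1 / sqrt 2" by (simp add: field_simps)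
        finally show ?thesis by (simp add: j)
      qed
      have eq: "sqrt 2 ^ n * sqrt 2 ^ m * (1/2) ^ (max n m) = (1 / sqrt 2) ^ (max n m - min n m)"
        using gen[of n m] gen[of m n] by (auto simp: max_def min_def mult_ac)
      show "d n m * (2 * (1/2) ^ (max n m) * of_bool (angle e e' \<le> 4 * pi * (1/2) ^ (min n m)))
        \<le> 2 * (c (min n m) * (1 / sqrt 2) ^ (max n m - min n m))"
      proof (cases "1 - norm z \<le> (1/2) ^ n \<and> 1 - norm z' \<le> (1/2) ^ m \<and> angle e e' \<le> 4 * pi * (1/2) ^ (min n m)")
        case True
        have "1 - norm z \<le> (1/2) ^ (min n m)" using True mono(1) by (blast intro: order_trans)
        moreover have "1 - norm z' \<le> (1/2) ^ (min n m)" using True mono(2) by (blast intro: order_trans)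
        ultimately have "c (min n m) = 1" using True by (simp add: c_def)
        then show ?thesis using True eq[symmetric] by (simp add: d_def)
      next
        case False
        then show ?thesis using c0[of "min n m"] by (auto simp: d_def)
      qed
    qed
    finally show "ennreal (d n m) * emeasure circle_measure (X n m)
      \<le> ennreal (2 * (c (min n m) * (1 / sqrt 2) ^ (max n m - min n m)))" .
  qed
  also have "\<dots> = ennreal (\<Sum>n\<le>N. \<Sum>m\<le>N. 2 * (c (min n m) * (1 / sqrt 2) ^ (max n m - min n m)))"
    using c0 by (simp add: sum_nonneg sum_ennreal)
  also have "\<dots> \<le> ennreal (32 * log_kernel (of_real \<rho> * (z * cnj z')))"
  proof (rule ennreal_leI)
    let ?g = "\<lambda>n m. c n * (1 / sqrt 2) ^ (m - n)"
    have "(\<Sum>n\<le>N. \<Sum>m\<le>N. 2 * (c (min n m) * (1 / sqrt 2) ^ (max n m - min n m)))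
       \<le> (\<Sum>n\<le>N. \<Sum>m\<le>N. 2 * (if n \<le> m then ?g n m else 0) + 2 * (if m \<le> n then ?g m n else 0))"
      using c0 by (intro sum_mono) (auto simp: max_def min_def)
    also have "\<dots> = 2 * (\<Sum>n\<le>N. \<Sum>m\<le>N. if n \<le> m then ?g n m else 0) + 2 * (\<Sum>n\<le>N. \<Sum>m\<le>N. if m \<le> n then ?g m n else 0)"
      by (simp add: sum.distrib sum_distrib_left)
    also have "(\<Sum>n\<le>N. \<Sum>m\<le>N. if m \<le> n then ?g m n else 0) = (\<Sum>n\<le>N. \<Sum>m\<le>N. if n \<le> m then ?g n m else 0)"
      by (rule sum.swap)
    also have "(\<Sum>n\<le>N. \<Sum>m\<le>N. if n \<le> m then ?g n m else 0) = (\<Sum>n\<le>N. c n * (\<Sum>m\<in>{n..N}. (1 / sqrt 2) ^ (m - n)))"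
      unfolding sum_distrib_left by (intro sum.cong refl sum.mono_neutral_cong_right) auto
    also have "2 * \<dots> + 2 * \<dots> \<le> 2 * (\<Sum>n\<le>N. c n * 4) + 2 * (\<Sum>n\<le>N. c n * 4)"
      using c0 by (intro add_mono mult_left_mono sum_mono sum_inv_sqrt2_power_le) auto
    also have "\<dots> = 16 * (\<Sum>n\<le>N. c n)" by (simp add: sum_distrib_left sum_distrib_right)
    also have "(\<Sum>n\<le>N. c n) \<le> 2 * log_kernel (of_real \<rho> * (z * cnj z'))"
    proof (cases "\<exists>k\<le>N. c k \<noteq> 0")
      case False
      then have "(\<Sum>n\<le>N. c n) = 0" by (intro sum.neutral) auto
      moreover have "norm (of_real \<rho> * (z * cnj z')) < 1"
      proof -
        have "norm z * norm z' \<le> 1 * 1" using z by (intro mult_mono) auto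
        then have "\<rho> * (norm z * norm z') \<le> \<rho> * 1" using \<rho> by (intro mult_left_mono) auto
        then show ?thesis using \<rho> by (simp add: norm_mult)
      qed
      ultimately show ?thesis using log_kernel_ge[of "of_real \<rho> * (z * cnj z')"] by simp
    next
      case True
      define k where "k = Max {k. k \<le> N \<and> c k \<noteq> 0}"
      have fin: "finite {k. k \<le> N \<and> c k \<noteq> 0}" by simp
      have k: "k \<le> N" "c k \<noteq> 0" using Max_in[OF fin] True unfolding k_def by auto
      have le_k: "n \<le> k" if "n \<le> N" "c n \<noteq> 0" for n
        unfolding k_def using that by (intro Max_ge fin) auto
      have "(\<Sum>n\<le>N. c n) = (\<Sum>n\<le>k. c n)"
        using le_k k by (intro sum.mono_neutral_right) auto
      also have "\<dots> \<le> (\<Sum>n\<le>k. 1)" by (intro sum_mono) (simp add: c_def)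
      also have "\<dots> = real (k + 1)" by simp
      also have "\<dots> \<le> 2 * log_kernel (of_real \<rho> * (z * cnj z'))"
      proof (rule log_kernel_ge_level)
        have kk: "1 - norm z \<le> (1/2) ^ k" "1 - norm z' \<le> (1/2) ^ k" "angle e e' \<le> 4 * pi * (1/2) ^ k"
          using k(2) by (auto simp: c_def)
        have "(1/2::real) ^ N \<le> (1/2) ^ k" using k by (intro power_decreasing) auto
        then have "1 - \<rho> \<le> (1/2) ^ k" using \<rho> by linarith
        moreover have "4 * pi * (1/2) ^ k \<le> 16 * (1/2) ^ k" using pi_less_4 by simp
        ultimately show "norm (1 - of_real \<rho> * (z * cnj z')) \<le> 32 * (1/2) ^ k"
          using norm_one_minus_product_le[OF z, of \<rho>] \<rho> kk zero_le_power[of "1/2::real" k] unfolding e_def e'_def by linarith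
        show "of_real \<rho> * (z * cnj z') \<noteq> 1"
        proof
          assume "of_real \<rho> * (z * cnj z') = 1"
          then have "\<rho> * (norm z * norm z') = 1" using \<rho> by (metis abs_of_nonneg complex_mod_cnj norm_mult norm_of_real norm_one)
          moreover have "\<rho> * (norm z * norm z') \<le> \<rho> * (1 * 1)" using z \<rho> by (intro mult_left_mono mult_mono) auto
          ultimately show False using \<rho> by simp
        qed
      qed
      finally show ?thesis .
    qed
    finally show "(\<Sum>n\<le>N. \<Sum>m\<le>N. 2 * (c (min n m) * (1 / sqrt 2) ^ (max n m - min n m)))
      \<le> 32 * log_kernel (of_real \<rho> * (z * cnj z'))" by simp
  qed
  finally show ?thesis .
qed

section \<open>Averages of the potential kernel\<close>

definition riesz_kernel :: "complex \<Rightarrow> complex \<Rightarrow> ennreal" where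
  "riesz_kernel u \<zeta> = inverse (ennreal (sqrt (angle u \<zeta>)))"

lemma potential_kernel_eq: "potential_kernel z \<zeta> = riesz_kernel (fst z) (fst \<zeta>) * riesz_kernel (snd z) (snd \<zeta>)"
  by (simp add: potential_kernel_def riesz_kernel_def angle_def)

lemma riesz_kernel_measurable [measurable]:
  assumes [measurable]: "f \<in> borel_measurable M" "g \<in> borel_measurable M"
  shows "(\<lambda>x. riesz_kernel (f x) (g x)) \<in> borel_measurable M"
  unfolding riesz_kernel_def by measurable

lemma riesz_kernel_le: "0 < \<delta> \<Longrightarrow> \<delta> \<le> angle u \<zeta> \<Longrightarrow> riesz_kernel u \<zeta> \<le> ennreal (1 / sqrt \<delta>)"
  by (auto simp: riesz_kernel_def inverse_ennreal divide_inverse intro!: ennreal_leI le_imp_inverse_le)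

lemma riesz_kernel_ge: "angle u \<zeta> \<le> \<delta> \<Longrightarrow> 0 < \<delta> \<Longrightarrow> ennreal (1 / sqrt \<delta>) \<le> riesz_kernel u \<zeta>"
  unfolding riesz_kernel_def
  by (cases "angle u \<zeta> = 0")
     (auto simp: inverse_ennreal divide_inverse order_less_le intro!: ennreal_leI le_imp_inverse_le)

lemma nn_integral_inverse_sqrt:
  assumes L: "L \<ge> 0"
  shows "(\<integral>\<^sup>+ x. inverse (ennreal (sqrt \<bar>x\<bar>)) * indicator {-L..L} x \<partial>lborel) = ennreal (4 * sqrt L)"
proof -
  have "((\<lambda>x. x powr (-1/2)) has_integral (L powr (-1/2 + 1) / (-1/2 + 1))) {0..L}"
    using L by (intro has_integral_powr_from_0) auto
  also have "L powr (-1/2 + 1) / (-1/2 + 1) = 2 * sqrt L"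
    using L by (simp add: powr_half_sqrt)
  finally have hi: "((\<lambda>x. x powr (-1/2)) has_integral (2 * sqrt L)) {0..L}" .
  have "(\<integral>\<^sup>+ x. indicator {0..L} x * ennreal (x powr (-1/2)) \<partial>lborel) = ennreal (2 * sqrt L)"
  proof -
    have "((\<lambda>x. if x \<in> {0..L} then x powr (-1/2) else 0) has_integral (2 * sqrt L)) UNIV"
      using hi by (simp only: has_integral_restrict_UNIV)
    then have "(\<integral>\<^sup>+ x. ennreal (if x \<in> {0..L} then x powr (-1/2) else 0) \<partial>lborel) = ennreal (2 * sqrt L)"
      by (intro nn_integral_has_integral_lborel) auto
    also have "(\<integral>\<^sup>+ x. ennreal (if x \<in> {0..L} then x powr (-1/2) else 0) \<partial>lborel)
       = (\<integral>\<^sup>+ x. indicator {0..L} x * ennreal (x powr (-1/2)) \<partial>lborel)"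
      by (intro nn_integral_cong) (simp add: indicator_def)
    finally show ?thesis .
  qed
  moreover have "(\<integral>\<^sup>+ x. inverse (ennreal (sqrt \<bar>x\<bar>)) * indicator {0..L} x \<partial>lborel)
     = (\<integral>\<^sup>+ x. indicator {0..L} x * ennreal (x powr (-1/2)) \<partial>lborel)"
  proof (rule nn_integral_cong_AE, use AE_lborel_singleton[of 0] in eventually_elim)
    case (elim x)
    then show ?case
      by (auto simp: indicator_def inverse_ennreal powr_minus powr_half_sqrt[symmetric] simp del: powr_half_sqrt)
  qed
  ultimately have pos: "(\<integral>\<^sup>+ x. inverse (ennreal (sqrt \<bar>x\<bar>)) * indicator {0..L} x \<partial>lborel) = ennreal (2 * sqrt L)"
    by simp
  have neg: "(\<integral>\<^sup>+ x. inverse (ennreal (sqrt \<bar>x\<bar>)) * indicator {-L..0} x \<partial>lborel) = ennreal (2 * sqrt L)"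
    unfolding pos[symmetric]
    by (subst nn_integral_real_affine[where c = "-1" and t = 0])
       (auto intro!: nn_integral_cong simp: indicator_def)
  have "(\<integral>\<^sup>+ x. inverse (ennreal (sqrt \<bar>x\<bar>)) * indicator {-L..L} x \<partial>lborel)
     = (\<integral>\<^sup>+ x. inverse (ennreal (sqrt \<bar>x\<bar>)) * indicator {-L..0} x + inverse (ennreal (sqrt \<bar>x\<bar>)) * indicator {0..L} x \<partial>lborel)"
    by (rule nn_integral_cong_AE, use AE_lborel_singleton[of 0] in eventually_elim) (use L in \<open>auto simp: indicator_def\<close>)
  also have "\<dots> = ennreal (2 * sqrt L) + ennreal (2 * sqrt L)"
    by (subst nn_integral_add) (auto simp: pos neg)
  finally show ?thesis using L by (simp flip: ennreal_plus)
qed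

text \<open>Where the angle is at least the length \<open>L\<close> of the arc the kernel is at most \<open>1 / sqrt L\<close>; the rest is
contained in an interval of radius \<open>L\<close> around \<open>\<zeta>\<close>.\<close>

lemma riesz_kernel_arc_integral_le:
  assumes \<zeta>: "norm \<zeta> = 1" and ab: "a < b" "b \<le> a + 2 * pi"
  shows "(\<integral>\<^sup>+ s. riesz_kernel (cis s) \<zeta> * indicator {a..<b} s \<partial>lborel) \<le> ennreal (5 * sqrt (b - a))"
proof -
  define L where "L = b - a"
  have L: "L > 0" using ab by (simp add: L_def)
  define N where "N = {u. angle u \<zeta> < L}"
  have N[measurable]: "N \<in> sets borel" unfolding N_def by measurable
  define c where "c = Arg \<zeta> - pi"
  have "(\<integral>\<^sup>+ s. riesz_kernel (cis s) \<zeta> * indicator {a..<b} s \<partial>lborel)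
    \<le> (\<integral>\<^sup>+ s. ennreal (1 / sqrt L) * indicator {a..<b} s
         + (riesz_kernel (cis s) \<zeta> * indicator N (cis s)) * indicator {a..<a + 2 * pi} s \<partial>lborel)"
  proof (intro nn_integral_mono)
    fix s
    show "riesz_kernel (cis s) \<zeta> * indicator {a..<b} s \<le> ennreal (1 / sqrt L) * indicator {a..<b} s
         + (riesz_kernel (cis s) \<zeta> * indicator N (cis s)) * indicator {a..<a + 2 * pi} s"
      using riesz_kernel_le[OF L, of "cis s" \<zeta>] ab by (auto simp: indicator_def N_def not_less)
  qed
  also have "\<dots> = (\<integral>\<^sup>+ s. ennreal (1 / sqrt L) * indicator {a..<b} s \<partial>lborel)
      + (\<integral>\<^sup>+ s. (riesz_kernel (cis s) \<zeta> * indicator N (cis s)) * indicator {a..<a + 2 * pi} s \<partial>lborel)"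
    by (rule nn_integral_add) measurable
  also have "(\<integral>\<^sup>+ s. ennreal (1 / sqrt L) * indicator {a..<b} s \<partial>lborel) = ennreal (sqrt L)"
    using L ab by (simp add: nn_integral_cmult_indicator L_def[symmetric] ennreal_mult'[symmetric] real_div_sqrt)
  also have "(\<integral>\<^sup>+ s. (riesz_kernel (cis s) \<zeta> * indicator N (cis s)) * indicator {a..<a + 2 * pi} s \<partial>lborel)
     = (\<integral>\<^sup>+ s. (riesz_kernel (cis s) \<zeta> * indicator N (cis s)) * indicator {c..<c + 2 * pi} s \<partial>lborel)"
    using nn_integral_period[of "\<lambda>u. riesz_kernel u \<zeta> * indicator N u" a]
      nn_integral_period[of "\<lambda>u. riesz_kernel u \<zeta> * indicator N u" c] by simp
  also have "\<dots> \<le> (\<integral>\<^sup>+ s. inverse (ennreal (sqrt \<bar>s - Arg \<zeta>\<bar>)) * indicator {-L..L} (s - Arg \<zeta>) \<partial>lborel)"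
  proof (intro nn_integral_mono)
    fix s
    show "(riesz_kernel (cis s) \<zeta> * indicator N (cis s)) * indicator {c..<c + 2 * pi} s
      \<le> inverse (ennreal (sqrt \<bar>s - Arg \<zeta>\<bar>)) * indicator {-L..L} (s - Arg \<zeta>)"
    proof (cases "s \<in> {c..<c + 2 * pi}")
      case True
      have "angle (cis s) \<zeta> = angle \<zeta> (cis s)" using \<zeta> by (intro angle_commute) auto
      also have "\<zeta> / cis s = cis (Arg \<zeta> - s)" using unit_eq_cis[OF \<zeta>] by (metis cis_divide)
      then have "angle \<zeta> (cis s) = \<bar>Arg \<zeta> - s\<bar>"
        using True by (simp add: angle_def c_def Arg_cis)
      finally have "angle (cis s) \<zeta> = \<bar>s - Arg \<zeta>\<bar>" by simp
      then show ?thesis by (auto simp: riesz_kernel_def N_def indicator_def)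
    qed simp
  qed
  also have "\<dots> = (\<integral>\<^sup>+ x. inverse (ennreal (sqrt \<bar>x\<bar>)) * indicator {-L..L} x \<partial>lborel)"
    by (subst nn_integral_real_affine[where c = 1 and t = "Arg \<zeta>"]) auto
  also have "\<dots> = ennreal (4 * sqrt L)" using L by (intro nn_integral_inverse_sqrt) simp
  finally show ?thesis using L by (simp add: L_def[symmetric] flip: ennreal_plus)
qed

lemma dyadic_scale:
  assumes "0 < t" "t \<le> 1"
  obtains n where "t \<le> (1/2) ^ n" "(1/2) ^ n < 2 * t" "1 / sqrt (2 * t) \<le> sqrt 2 ^ n"
proof -
  have "\<exists>k. (1/2::real) ^ k < t" using assms by (intro real_arch_pow_inv) auto
  then obtain k where k: "(1/2::real) ^ k < t" "\<And>j. j < k \<Longrightarrow> \<not> (1/2::real) ^ j < t"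
    using exists_least_iff[of "\<lambda>k. (1/2::real) ^ k < t"] by blast
  have "k \<noteq> 0" using k assms by (intro notI) simp
  then obtain n where n: "k = Suc n" by (cases k) auto
  have lo: "t \<le> (1/2) ^ n" using k(2)[of n] n by simp
  have hi: "(1/2) ^ n < 2 * t" using k(1) n by simp
  have "1 / (2 * t) \<le> 1 / (1/2) ^ n"
    using hi assms by (intro divide_left_mono) auto
  also have "\<dots> = 2 ^ n" by (simp add: power_one_over)
  finally have "sqrt (1 / (2 * t)) \<le> sqrt (2 ^ n)" by (rule real_sqrt_le_mono)
  then have "1 / sqrt (2 * t) \<le> sqrt 2 ^ n" by (simp add: real_sqrt_divide real_sqrt_power)
  with lo hi that show thesis by blast
qed

text \<open>If \<open>\<zeta>\<close> is close to the arc, the mean of the kernel over the arc is of size \<open>1 / sqrt L\<close>; otherwise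
the kernel is essentially constant on the arc. In both cases a single term of the truncated kernel
suffices: the box condition \<open>1 - norm z \<le> L / (2 * pi)\<close> and the assumption on \<open>N\<close> ensure that the term of
the required level is present.\<close>

lemma riesz_kernel_average_le:
  assumes ab: "a < b" "b \<le> a + 2 * pi" and \<zeta>: "norm \<zeta> = 1"
    and z: "z \<in> carleson_box (cis ` {a..b})" and N: "(1/2) ^ N \<le> (b - a) / (2 * pi)"
  shows "(\<integral>\<^sup>+ s. riesz_kernel (cis s) \<zeta> * indicator {a..<b} s \<partial>lborel)
     \<le> ennreal (5 * (b - a) * truncated_kernel N z \<zeta>)"
proof -
  define L where "L = b - a"
  define e where "e = direction z"
  have L: "L > 0" "L \<le> 2 * pi" using ab by (auto simp: L_def)
  obtain s0 where s0: "s0 \<in> {a..b}" "e = cis s0"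
    using z carleson_box_eq[OF ab] by (auto simp: e_def)
  have zn: "1 - norm z \<le> L / (2 * pi)"
    using z carleson_box_eq[OF ab] by (auto simp: L_def)
  have le_N: "n \<le> N" if t: "L / (2 * pi) < 2 * t" "t \<le> (1/2) ^ n" for n and t :: real
  proof (rule ccontr)
    assume "\<not> n \<le> N"
    then have "(1/2::real) ^ n \<le> (1/2) ^ Suc N" by (intro power_decreasing) auto
    also have "\<dots> = (1/2) ^ N / 2" by simp
    finally show False using t N unfolding L_def by linarith
  qed
  show ?thesis
  proof (cases "angle e \<zeta> \<le> 2 * L")
    case True
    define t where "t = min 1 (L / pi)"
    have t: "0 < t" "t \<le> 1" using L by (auto simp: t_def)
    obtain n where n: "t \<le> (1/2) ^ n" "1 / sqrt (2 * t) \<le> sqrt 2 ^ n"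
      using dyadic_scale[OF t] by blast
    have L1: "L / (2 * pi) \<le> t" using L by (auto simp: t_def field_simps)
    have "n \<le> N" using n L1 t by (intro le_N[of t]) auto
    moreover have "1 - norm z \<le> (1/2) ^ n" using zn L1 n by linarith
    moreover have "angle e \<zeta> \<le> 2 * pi * (1/2) ^ n"
    proof -
      have "angle e \<zeta> \<le> 2 * pi * t"
      proof (cases "L \<le> pi")
        case True
        then have "2 * pi * t = 2 * L" by (simp add: t_def)
        then show ?thesis using \<open>angle e \<zeta> \<le> 2 * L\<close> by simp
      next
        case False
        then have "t = 1" by (simp add: t_def field_simps)
        show ?thesis unfolding \<open>t = 1\<close> using angle_le_pi[of e \<zeta>] pi_gt_zero by linarith
      qed
      also have "\<dots> \<le> 2 * pi * (1/2) ^ n" using n by (intro mult_left_mono) auto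
      finally show ?thesis .
    qed
    ultimately have "sqrt 2 ^ n \<le> truncated_kernel N z \<zeta>"
      unfolding e_def by (intro truncated_kernel_ge)
    moreover have "1 / sqrt L \<le> 1 / sqrt (2 * t)"
    proof -
      have "2 * t \<le> L"
      proof -
        have "t \<le> L / pi" by (simp add: t_def)
        also have "\<dots> \<le> L / 2" using L pi_ge_two by (intro divide_left_mono) auto
        finally show ?thesis by simp
      qed
      then show ?thesis using t L by (intro divide_left_mono) auto
    qed
    ultimately have "1 / sqrt L \<le> truncated_kernel N z \<zeta>" using n by linarith
    then have "5 * L * (1 / sqrt L) \<le> 5 * L * truncated_kernel N z \<zeta>" using L by (intro mult_left_mono) auto
    moreover have "5 * L * (1 / sqrt L) = 5 * sqrt L" using L real_div_sqrt[of L] by simp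
    ultimately have "5 * sqrt L \<le> 5 * L * truncated_kernel N z \<zeta>" by simp
    then show ?thesis
      using order_trans[OF riesz_kernel_arc_integral_le[OF \<zeta> ab] ennreal_leI] by (simp add: L_def)
  next
    case False
    define \<alpha> where "\<alpha> = angle e \<zeta>"
    have \<alpha>: "\<alpha> > 2 * L" "\<alpha> \<le> pi" using False angle_le_pi by (auto simp: \<alpha>_def)
    define t where "t = \<alpha> / (2 * pi)"
    have t: "0 < t" "t \<le> 1" using \<alpha> L by (auto simp: t_def field_simps)
    obtain n where n: "t \<le> (1/2) ^ n" "1 / sqrt (2 * t) \<le> sqrt 2 ^ n"
      using dyadic_scale[OF t] by blast
    have L1: "L / (2 * pi) \<le> t" using \<alpha> L by (simp add: t_def field_simps)
    have "n \<le> N" using n L1 t by (intro le_N[of t]) auto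
    moreover have "1 - norm z \<le> (1/2) ^ n" using zn L1 n by linarith
    moreover have "angle e \<zeta> \<le> 2 * pi * (1/2) ^ n"
    proof -
      have "2 * pi * t \<le> 2 * pi * (1/2) ^ n" using n by (intro mult_left_mono) auto
      then show ?thesis by (simp add: t_def \<alpha>_def)
    qed
    ultimately have "sqrt 2 ^ n \<le> truncated_kernel N z \<zeta>"
      unfolding e_def by (intro truncated_kernel_ge)
    moreover have "1 / sqrt (\<alpha> / 2) \<le> 1 / sqrt (2 * t)"
    proof -
      have "2 * t = \<alpha> / pi" by (simp add: t_def)
      also have "\<dots> \<le> \<alpha> / 2" using \<alpha> L pi_ge_two by (intro divide_left_mono) auto
      finally show ?thesis using t \<alpha> L by (intro divide_left_mono) auto
    qed
    ultimately have ker: "1 / sqrt (\<alpha> / 2) \<le> truncated_kernel N z \<zeta>" using n by linarith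
    have "(\<integral>\<^sup>+ s. riesz_kernel (cis s) \<zeta> * indicator {a..<b} s \<partial>lborel)
       \<le> (\<integral>\<^sup>+ s. ennreal (1 / sqrt (\<alpha> / 2)) * indicator {a..<b} s \<partial>lborel)"
    proof (intro nn_integral_mono)
      fix s
      show "riesz_kernel (cis s) \<zeta> * indicator {a..<b} s \<le> ennreal (1 / sqrt (\<alpha> / 2)) * indicator {a..<b} s"
      proof (cases "s \<in> {a..<b}")
        case True
        have "\<alpha> \<le> angle e (cis s) + angle (cis s) \<zeta>"
          unfolding \<alpha>_def using \<zeta> s0 by (intro angle_triangle) auto
        moreover have "angle e (cis s) \<le> \<bar>s0 - s\<bar>" unfolding s0(2) by (rule angle_cis)
        moreover have "\<bar>s0 - s\<bar> \<le> L" using True s0 by (auto simp: L_def)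
        ultimately have "\<alpha> / 2 \<le> angle (cis s) \<zeta>" using \<alpha> by linarith
        then show ?thesis using riesz_kernel_le[of "\<alpha> / 2" "cis s" \<zeta>] \<alpha> L by (auto simp: indicator_def)
      qed simp
    qed
    also have "\<dots> = ennreal (1 / sqrt (\<alpha> / 2)) * ennreal L"
      using ab by (simp add: nn_integral_cmult_indicator L_def)
    also have "\<dots> = ennreal (1 / sqrt (\<alpha> / 2) * L)"
      using L \<alpha> by (intro ennreal_mult[symmetric]) auto
    also have "\<dots> \<le> ennreal (5 * L * truncated_kernel N z \<zeta>)"
    proof (rule ennreal_leI)
      have "1 / sqrt (\<alpha> / 2) * L \<le> truncated_kernel N z \<zeta> * L" using ker L by (intro mult_right_mono) auto
      also have "\<dots> \<le> 5 * L * truncated_kernel N z \<zeta>"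
        using L mult_nonneg_nonneg[of L "truncated_kernel N z \<zeta>"] by (simp add: mult_ac)
      finally show "1 / sqrt (\<alpha> / 2) * L \<le> 5 * L * truncated_kernel N z \<zeta>" .
    qed
    finally show ?thesis by (simp add: L_def)
  qed
qed

definition truncated_product_kernel :: "nat \<Rightarrow> complex \<times> complex \<Rightarrow> complex \<times> complex \<Rightarrow> ennreal" where
  "truncated_product_kernel N z \<zeta> =
     ennreal (truncated_kernel N (fst z) (fst \<zeta>)) * ennreal (truncated_kernel N (snd z) (snd \<zeta>))"

lemma truncated_product_kernel_measurable [measurable]:
  assumes [measurable]: "(\<lambda>x. fst (f x)) \<in> borel_measurable M" "(\<lambda>x. snd (f x)) \<in> borel_measurable M"
       "(\<lambda>x. fst (g x)) \<in> borel_measurable M" "(\<lambda>x. snd (g x)) \<in> borel_measurable M"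
  shows "(\<lambda>x. truncated_product_kernel N (f x) (g x)) \<in> borel_measurable M"
  unfolding truncated_product_kernel_def by measurable

text \<open>A lower bound for the potential on the rectangle of arcs below a pair of boxes is carried into the boxes by
taking the mean over the rectangle and exchanging the integrals.\<close>

lemma one_le_potential_average:
  assumes arc1: "a1 < b1" "b1 \<le> a1 + 2 * pi" and arc2: "a2 < b2" "b2 \<le> a2 + 2 * pi"
    and z1: "z1 \<in> carleson_box (cis ` {a1..b1})" and z2: "z2 \<in> carleson_box (cis ` {a2..b2})"
    and N: "(1/2) ^ N \<le> (b1 - a1) / (2 * pi)" "(1/2) ^ N \<le> (b2 - a2) / (2 * pi)"
    and h[measurable]: "h \<in> borel_measurable borel"
    and pot: "\<And>u v. u \<in> cis ` {a1..b1} \<Longrightarrow> v \<in> cis ` {a2..b2} \<Longrightarrow> 1 \<le> potential h (u, v)"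
  shows "1 \<le> ennreal 25 * (\<integral>\<^sup>+ \<zeta>. ennreal (truncated_kernel N z1 (fst \<zeta>)) * ennreal (truncated_kernel N z2 (snd \<zeta>)) * h \<zeta> \<partial>torus_measure)"
    (is "_ \<le> _ * ?Q")
proof -
  define l where "l = (b1 - a1) * (b2 - a2)"
  have l: "l > 0" using arc1 arc2 by (simp add: l_def)
  let ?F = "\<lambda>s t \<zeta>. indicator {a1..<b1} s * indicator {a2..<b2} t * (riesz_kernel (cis s) (fst \<zeta>) * riesz_kernel (cis t) (snd \<zeta>) * h \<zeta>)"
  let ?R1 = "\<lambda>s \<zeta>. riesz_kernel (cis s) (fst \<zeta>) * indicator {a1..<b1} s"
    and ?R2 = "\<lambda>t \<zeta>. riesz_kernel (cis t) (snd \<zeta>) * indicator {a2..<b2} t"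
  let ?K1 = "\<lambda>\<zeta>. ennreal (5 * (b1 - a1) * truncated_kernel N z1 (fst \<zeta>))"
    and ?K2 = "\<lambda>\<zeta>. ennreal (5 * (b2 - a2) * truncated_kernel N z2 (snd \<zeta>))"
    and ?P = "\<lambda>\<zeta>. ennreal (truncated_kernel N z1 (fst \<zeta>)) * ennreal (truncated_kernel N z2 (snd \<zeta>))"
  let ?I1 = "indicator {a1..<b1} :: real \<Rightarrow> ennreal" and ?I2 = "indicator {a2..<b2} :: real \<Rightarrow> ennreal"
  have "ennreal l = (\<integral>\<^sup>+ s. \<integral>\<^sup>+ t. ?I1 s * ?I2 t \<partial>lborel \<partial>lborel)"
    using arc1 arc2 by (simp add: nn_integral_cmult nn_integral_multc l_def ennreal_mult)
  also have "\<dots> \<le> (\<integral>\<^sup>+ s. \<integral>\<^sup>+ t. ?I1 s * ?I2 t * potential h (cis s, cis t) \<partial>lborel \<partial>lborel)"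
  proof (intro nn_integral_mono)
    fix s t
    show "?I1 s * ?I2 t \<le> ?I1 s * ?I2 t * potential h (cis s, cis t)"
      using pot[of "cis s" "cis t"] by (auto simp: indicator_def)
  qed
  also have "\<dots> = (\<integral>\<^sup>+ s. \<integral>\<^sup>+ t. \<integral>\<^sup>+ \<zeta>. ?F s t \<zeta> \<partial>torus_measure \<partial>lborel \<partial>lborel)"
    unfolding potential_def potential_kernel_eq fst_conv snd_conv
    by (intro nn_integral_cong nn_integral_cmult[symmetric]) measurable
  also have "\<dots> = (\<integral>\<^sup>+ s. \<integral>\<^sup>+ \<zeta>. \<integral>\<^sup>+ t. ?F s t \<zeta> \<partial>lborel \<partial>torus_measure \<partial>lborel)"
    by (intro nn_integral_cong lborel_torus.Fubini'[symmetric]) measurable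
  also have "\<dots> = (\<integral>\<^sup>+ \<zeta>. \<integral>\<^sup>+ s. \<integral>\<^sup>+ t. ?F s t \<zeta> \<partial>lborel \<partial>lborel \<partial>torus_measure)"
    by (intro lborel_torus.Fubini'[symmetric]) measurable
  also have "\<dots> = (\<integral>\<^sup>+ \<zeta>. (\<integral>\<^sup>+ s. ?R1 s \<zeta> \<partial>lborel) * (\<integral>\<^sup>+ t. ?R2 t \<zeta> \<partial>lborel) * h \<zeta> \<partial>torus_measure)"
  proof (intro nn_integral_cong)
    fix \<zeta>
    have "(\<integral>\<^sup>+ s. \<integral>\<^sup>+ t. ?F s t \<zeta> \<partial>lborel \<partial>lborel)
      = (\<integral>\<^sup>+ s. \<integral>\<^sup>+ t. ?R1 s \<zeta> * (?R2 t \<zeta> * h \<zeta>) \<partial>lborel \<partial>lborel)"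
      by (intro nn_integral_cong) (simp only: mult_ac)
    also have "\<dots> = (\<integral>\<^sup>+ s. ?R1 s \<zeta> * (\<integral>\<^sup>+ t. ?R2 t \<zeta> * h \<zeta> \<partial>lborel) \<partial>lborel)"
      by (intro nn_integral_cong nn_integral_cmult) measurable
    also have "(\<integral>\<^sup>+ t. ?R2 t \<zeta> * h \<zeta> \<partial>lborel) = (\<integral>\<^sup>+ t. ?R2 t \<zeta> \<partial>lborel) * h \<zeta>"
      by (rule nn_integral_multc) measurable
    also have "(\<integral>\<^sup>+ s. ?R1 s \<zeta> * ((\<integral>\<^sup>+ t. ?R2 t \<zeta> \<partial>lborel) * h \<zeta>) \<partial>lborel) = (\<integral>\<^sup>+ s. ?R1 s \<zeta> \<partial>lborel) * ((\<integral>\<^sup>+ t. ?R2 t \<zeta> \<partial>lborel) * h \<zeta>)"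
      by (rule nn_integral_multc) measurable
    finally show "(\<integral>\<^sup>+ s. \<integral>\<^sup>+ t. ?F s t \<zeta> \<partial>lborel \<partial>lborel)
      = (\<integral>\<^sup>+ s. ?R1 s \<zeta> \<partial>lborel) * (\<integral>\<^sup>+ t. ?R2 t \<zeta> \<partial>lborel) * h \<zeta>"
      by (simp only: mult.assoc)
  qed
  also have "\<dots> \<le> (\<integral>\<^sup>+ \<zeta>. ?K1 \<zeta> * ?K2 \<zeta> * h \<zeta> \<partial>torus_measure)"
    by (rule nn_integral_mono_AE, use AE_torus_norm in eventually_elim)
       (intro mult_right_mono mult_mono riesz_kernel_average_le arc1 arc2 z1 z2 N; simp)
  also have "\<dots> = (\<integral>\<^sup>+ \<zeta>. ennreal (25 * l) * (?P \<zeta> * h \<zeta>) \<partial>torus_measure)"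
  proof (intro nn_integral_cong)
    fix \<zeta>
    have "?K1 \<zeta> * ?K2 \<zeta>
      = ennreal (25 * l) * (?P \<zeta>)"
    proof -
      have "5 * (b1 - a1) * x * (5 * (b2 - a2) * y) = 25 * l * (x * y)" for x y by (simp only: l_def) algebra
      then show ?thesis using arc1 arc2 l by (simp add: ennreal_mult[symmetric] del: mult.assoc)
    qed
    then show "?K1 \<zeta> * ?K2 \<zeta> * h \<zeta>
      = ennreal (25 * l) * (?P \<zeta> * h \<zeta>)"
      by (simp add: mult.assoc)
  qed
  also have "\<dots> = ennreal (25 * l) * ?Q"
    by (rule nn_integral_cmult) measurable
  finally have "ennreal l * 1 \<le> ennreal l * (ennreal 25 * ?Q)"
    using l by (simp add: ennreal_mult mult_ac)
  then show ?thesis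
    using l by (subst (asm) ennreal_mult_le_mult_iff) auto
qed

section \<open>From the embedding to the capacity condition\<close>

text \<open>This stands in for the Cauchy--Schwarz inequality: it holds pointwise, without integrability, and the weight is chosen so
that the second term can be absorbed.\<close>

lemma ennreal_mult_le_squares:
  fixes x y :: ennreal
  assumes "t > 0"
  shows "x * y \<le> ennreal t * x\<^sup>2 + ennreal (1 / t) * y\<^sup>2"
proof (cases "x = \<infinity> \<or> y = \<infinity>")
  case True
  then have "ennreal t * x\<^sup>2 + ennreal (1 / t) * y\<^sup>2 = \<infinity>"
    using assms by (auto simp: power2_eq_square ennreal_mult_top ennreal_top_mult)
  then show ?thesis by (metis infinity_ennreal_def top_greatest)
next
  case False
  then obtain a b where ab: "x = ennreal a" "y = ennreal b" "0 \<le> a" "0 \<le> b"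
    by (cases x; cases y) auto
  have "0 \<le> (t * a - b)\<^sup>2 + t * a * b" using assms ab by simp
  then have "t * (a * b) \<le> t * (t * a\<^sup>2) + b\<^sup>2"
    by (simp add: power2_eq_square algebra_simps)
  then have "t * (a * b) \<le> t * (t * a\<^sup>2 + 1 / t * b\<^sup>2)"
    using assms by (simp add: algebra_simps)
  then have "a * b \<le> t * a\<^sup>2 + 1 / t * b\<^sup>2"
    using assms by (subst (asm) mult_le_cancel_left_pos) auto
  then show ?thesis
    using ab assms by (simp add: ennreal_mult[symmetric] ennreal_power flip: ennreal_plus)
qed

lemma le_ennreal_mult_INF:
  fixes x :: ennreal
  assumes c: "c > 0" and le: "\<And>h. h \<in> H \<Longrightarrow> x \<le> ennreal c * g h"
  shows "x \<le> ennreal c * (INF h\<in>H. g h)"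
proof -
  have inv: "ennreal c * ennreal (1 / c) = 1" "ennreal (1 / c) * ennreal c = 1"
    using c by (simp_all flip: ennreal_mult)
  have "ennreal (1 / c) * x \<le> (INF h\<in>H. g h)"
  proof (rule INF_greatest)
    fix h assume "h \<in> H"
    have "ennreal (1 / c) * x \<le> ennreal (1 / c) * (ennreal c * g h)"
      by (intro mult_left_mono le \<open>h \<in> H\<close>) auto
    also have "\<dots> = g h" by (simp flip: mult.assoc add: inv)
    finally show "ennreal (1 / c) * x \<le> g h" .
  qed
  then have "ennreal c * (ennreal (1 / c) * x) \<le> ennreal c * (INF h\<in>H. g h)"
    by (rule mult_left_mono) auto
  then show ?thesis by (simp flip: mult.assoc add: inv)
qed

context bidisc_measure
begin

text \<open>Testing the embedding on the polynomial with coefficients \<open>b\<close>: the square of its Dirichlet norm is at most \<open>100\<close> times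
the energy, and its integral over \<open>S\<close> is the energy. The factor \<open>100\<close> comes from \<open>log_coeff_bounds\<close>
in both variables.\<close>

lemma embedding_energy_le:
  assumes C: "C > 0" and emb: "embedding_bound \<mu> C" and S[measurable]: "S \<in> sets \<mu>" and \<rho>: "0 \<le> \<rho>" "\<rho> < 1"
  shows "bidisc_density.energy \<mu> (\<lambda>z. indicator S z) D \<rho> \<le> 400 * C * measure \<mu> S"
proof -
  \<comment> \<open>The density is the indicator of \<open>S\<close>; \<open>b\<close> are the coefficients of the test polynomial, whose pairing
with the density is exactly the energy.\<close>
  interpret bidisc_density \<mu> "\<lambda>z. indicator S z :: complex" 1
    by standard (auto simp: indicator_def)
  define r where "r = sqrt \<rho>"
  have r: "0 \<le> r" "r < 1" "r * r = \<rho>" using \<rho> by (auto simp: r_def)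
  have rr: "r ^ m * r ^ m = \<rho> ^ m" for m using r by (simp flip: power_mult_distrib)
  define b where "b m n = of_real (log_coeff m * log_coeff n * r ^ m * r ^ n) * cnj (moment m n)" for m n
  define f where "f = bipoly D b"
  define E where "E = energy D \<rho>"
  have E0: "0 \<le> E" unfolding E_def by (rule energy_nonneg[OF \<rho>(1)])
  define g where "g z = f (of_real r * fst z, of_real r * snd z)" for z
  have g: "g z = (\<Sum>m<D. \<Sum>n<D. of_real (log_coeff m * log_coeff n * \<rho> ^ m * \<rho> ^ n) * cnj (moment m n) * (fst z ^ m * snd z ^ n))" for z
    unfolding g_def f_def bipoly_def b_def rr[symmetric]
    by (auto intro!: sum.cong simp: power_mult_distrib mult_ac)
  have [measurable]: "g \<in> borel_measurable \<mu>" unfolding g by measurable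
  have "dirichlet_norm_sq f \<le> 100 * E"
    unfolding f_def bipoly_dirichlet E_def energy_def sum_distrib_left
  proof (intro sum_mono)
    fix m n
    have "(norm (b m n))\<^sup>2 = (log_coeff m * log_coeff n * r ^ m * r ^ n)\<^sup>2 * (norm (moment m n))\<^sup>2"
      using r by (simp add: b_def norm_mult norm_power power_mult_distrib)
    also have "(log_coeff m * log_coeff n * r ^ m * r ^ n)\<^sup>2 = (log_coeff m * log_coeff n) * (log_coeff m * log_coeff n * \<rho> ^ m * \<rho> ^ n)"
      unfolding rr[symmetric] by (simp add: power2_eq_square mult_ac)
    finally have "(norm (b m n))\<^sup>2 * (real m + 1) * (real n + 1)
      = (log_coeff m * (real m + 1)) * (log_coeff n * (real n + 1)) * (log_coeff m * log_coeff n * \<rho> ^ m * \<rho> ^ n * (norm (moment m n))\<^sup>2)"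
      by (simp add: mult_ac)
    also have "\<dots> \<le> (10 * 10) * (log_coeff m * log_coeff n * \<rho> ^ m * \<rho> ^ n * (norm (moment m n))\<^sup>2)"
      using log_coeff_bounds[of m] log_coeff_bounds[of n] log_coeff_pos[of m] log_coeff_pos[of n] \<rho>
      by (intro mult_right_mono mult_mono) auto
    finally show "(norm (b m n))\<^sup>2 * (real m + 1) * (real n + 1)
      \<le> 100 * (log_coeff m * log_coeff n * \<rho> ^ m * \<rho> ^ n * (norm (moment m n))\<^sup>2)" by simp
  qed
  then have "ennreal (C * dirichlet_norm_sq f) \<le> ennreal (C * (100 * E))"
    using C by (intro ennreal_leI mult_left_mono) auto
  moreover have "(\<integral>\<^sup>+ z. ennreal ((norm (g z))\<^sup>2) \<partial>\<mu>) \<le> ennreal (C * dirichlet_norm_sq f)"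
  proof -
    have "(\<integral>\<^sup>+ z. ennreal ((norm (g z))\<^sup>2) \<partial>\<mu>) \<le> (SUP r\<in>{0..<1::real}.
           \<integral>\<^sup>+ (z1, z2). ennreal ((norm (f (of_real r * z1, of_real r * z2)))\<^sup>2) \<partial>\<mu>)"
      using r by (intro SUP_upper2[of r]) (auto simp: g_def case_prod_unfold)
    also have "\<dots> \<le> ennreal (C * dirichlet_norm_sq f)"
      using emb bipoly_dirichlet(1)[of D b] unfolding embedding_bound_def f_def by blast
    finally show ?thesis .
  qed
  ultimately have int_g: "(\<integral>\<^sup>+ z. ennreal ((norm (g z))\<^sup>2) \<partial>\<mu>) \<le> ennreal (C * (100 * E))" by (rule order_trans[rotated])
  have gi_expand: "g z * indicator S z = (\<Sum>m<D. \<Sum>n<D. (of_real (log_coeff m * log_coeff n * \<rho> ^ m * \<rho> ^ n) * cnj (moment m n)) * (fst z ^ m * snd z ^ n * indicator S z))" for z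
    unfolding g by (simp only: sum_distrib_right mult.assoc)
  have int: "integrable \<mu> (\<lambda>z. g z * indicator S z)"
    unfolding gi_expand by (intro Bochner_Integration.integrable_sum integrable_mult_right integrable_monomial)
  have "(\<integral>z. g z * indicator S z \<partial>\<mu>) = (\<Sum>m<D. \<Sum>n<D. (of_real (log_coeff m * log_coeff n * \<rho> ^ m * \<rho> ^ n) * cnj (moment m n)) * moment m n)"
    unfolding gi_expand
    by (subst integral_double_sum)
       (simp_all only: integral_mult_right_zero moment_def integrable_mult_right integrable_monomial)
  also have "\<dots> = of_real E"
    unfolding E_def energy_def of_real_sum
    by (intro sum.cong refl) (simp only: of_real_mult complex_norm_square mult_ac)
  finally have "ennreal E = ennreal (norm (\<integral>z. g z * indicator S z \<partial>\<mu>))" using E0 by simp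
  also have "\<dots> \<le> (\<integral>\<^sup>+ z. norm (g z * indicator S z) \<partial>\<mu>)"
    by (rule integral_norm_bound_ennreal[OF int])
  \<comment> \<open>With the weight \<open>200 * C\<close> the second term is at most half of the energy.\<close>
  also have "\<dots> \<le> (\<integral>\<^sup>+ z. ennreal (200 * C) * indicator S z + ennreal (1 / (200 * C)) * ennreal ((norm (g z))\<^sup>2) \<partial>\<mu>)"
  proof (intro nn_integral_mono)
    fix z
    have "ennreal (norm (g z * indicator S z)) = indicator S z * ennreal (norm (g z))"
      by (simp add: indicator_def)
    also have "\<dots> \<le> ennreal (200 * C) * (indicator S z)\<^sup>2 + ennreal (1 / (200 * C)) * (ennreal (norm (g z)))\<^sup>2"
      using C by (intro ennreal_mult_le_squares) simp
    finally show "ennreal (norm (g z * indicator S z)) \<le> ennreal (200 * C) * indicator S z + ennreal (1 / (200 * C)) * ennreal ((norm (g z))\<^sup>2)"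
      by (cases "z \<in> S") (simp_all add: ennreal_power)
  qed
  also have "\<dots> = ennreal (200 * C) * emeasure \<mu> S + ennreal (1 / (200 * C)) * (\<integral>\<^sup>+ z. ennreal ((norm (g z))\<^sup>2) \<partial>\<mu>)"
    by (simp add: nn_integral_add nn_integral_cmult)
  also have "\<dots> \<le> ennreal (200 * C) * emeasure \<mu> S + ennreal (1 / (200 * C)) * ennreal (C * (100 * E))"
    by (intro add_left_mono mult_left_mono int_g) auto
  also have "\<dots> = ennreal (200 * C * measure \<mu> S + E / 2)"
    using C E0 by (simp add: emeasure_eq_measure ennreal_mult[symmetric] flip: ennreal_plus)
  finally have "E \<le> 200 * C * measure \<mu> S + E / 2"
    using C E0 by (subst (asm) ennreal_le_iff) (auto intro!: add_nonneg_nonneg)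
  then show ?thesis by (simp add: E_def)
qed

text \<open>With \<open>G\<close> the potential of \<open>\<mu>\<close> on \<open>S\<close> for the truncated kernel, \<open>\<mu>(S) \<le> 25 * \<integral> h * G\<close>, and the square integral of \<open>G\<close>
is at most a multiple of the energy, hence of \<open>C * \<mu>(S)\<close>. Since there are finitely many arcs, one truncation
level \<open>N\<close> serves all of them.\<close>

theorem embedding_imp_capacity:
  assumes C: "C > 0" and emb: "embedding_bound \<mu> C"
  shows "capacity_bound \<mu> (4096000000 * C)"
  unfolding capacity_bound_def
proof (intro allI impI)
  fix n :: nat and J1 J2 :: "nat \<Rightarrow> complex set"
  assume n: "1 \<le> n" and J: "\<forall>k\<in>{1..n}. J1 k \<in> circle_arcs \<and> J2 k \<in> circle_arcs"
  define P where "P J x \<longleftrightarrow> J = cis ` {fst x..snd x} \<and> fst x < snd x \<and> snd x \<le> fst x + 2 * pi" for J :: "complex set" and x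
  have ex: "\<exists>x. P J x" if "J \<in> circle_arcs" for J
    using that by (auto simp: circle_arcs_def P_def)
  have some: "P J (SOME x. P J x)" if "J \<in> circle_arcs" for J
    by (rule someI_ex[OF ex[OF that]])
  define p q where "p k = (SOME x. P (J1 k) x)" and "q k = (SOME x. P (J2 k) x)" for k
  have p: "J1 k = cis ` {fst (p k)..snd (p k)} \<and> fst (p k) < snd (p k) \<and> snd (p k) \<le> fst (p k) + 2 * pi" if "k \<in> {1..n}" for k
    using some[of "J1 k"] J that by (simp add: P_def p_def)
  have q: "J2 k = cis ` {fst (q k)..snd (q k)} \<and> fst (q k) < snd (q k) \<and> snd (q k) \<le> fst (q k) + 2 * pi" if "k \<in> {1..n}" for k
    using some[of "J2 k"] J that by (simp add: P_def q_def)
  define S where "S = (\<Union>k\<in>{1..n}. carleson_box (J1 k) \<times> carleson_box (J2 k))"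
  define E where "E = (\<Union>k\<in>{1..n}. J1 k \<times> J2 k)"
  have "closed S" unfolding S_def
    using p q by (intro closed_UN) (auto intro!: compact_imp_closed compact_Times compact_carleson_box)
  moreover have "S \<subseteq> closed_bidisc"
    using p q by (auto simp: S_def carleson_box_eq)
  ultimately have S[measurable]: "S \<in> sets \<mu>" by (intro borel_sets_\<mu> borel_closed)
  define T where "T = (\<lambda>k. (snd (p k) - fst (p k)) / (2 * pi)) ` {1..n} \<union> (\<lambda>k. (snd (q k) - fst (q k)) / (2 * pi)) ` {1..n}"
  have T: "finite T" "T \<noteq> {}" "\<And>t. t \<in> T \<Longrightarrow> t > 0" using n p q by (auto simp: T_def)
  have "Min T > 0" using T by simp
  then obtain N where N: "(1/2::real) ^ N < Min T" using real_arch_pow_inv[of "Min T" "1/2"] by auto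
  have N1: "(1/2) ^ N \<le> (snd (p k) - fst (p k)) / (2 * pi)" if "k \<in> {1..n}" for k
  proof -
    have "(snd (p k) - fst (p k)) / (2 * pi) \<in> T" using that unfolding T_def by blast
    then show ?thesis using N Min_le[OF T(1)] by (meson less_imp_le order_trans)
  qed
  have N2: "(1/2) ^ N \<le> (snd (q k) - fst (q k)) / (2 * pi)" if "k \<in> {1..n}" for k
  proof -
    have "(snd (q k) - fst (q k)) / (2 * pi) \<in> T" using that unfolding T_def by blast
    then show ?thesis using N Min_le[OF T(1)] by (meson less_imp_le order_trans)
  qed
  \<comment> \<open>The dilation by \<open>\<rho>\<close> acts on the scale at which the kernel is truncated, so all energies are finite.\<close>
  define \<rho> :: real where "\<rho> = 1 - (1/2) ^ Suc N"
  have \<rho>: "0 \<le> \<rho>" "\<rho> < 1" "1 - \<rho> \<le> (1/2) ^ N"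
    using power_le_one[of "1/2::real" "Suc N"] by (auto simp: \<rho>_def)
  define tk where tk_eq: "tk = truncated_product_kernel N"
  have tk_def: "tk z \<zeta> = ennreal (truncated_kernel N (fst z) (fst \<zeta>)) * ennreal (truncated_kernel N (snd z) (snd \<zeta>))" for z \<zeta>
    by (simp add: tk_eq truncated_product_kernel_def)
  note [measurable] = truncated_product_kernel_measurable[of _ _ _ N, folded tk_eq]
  define G where "G \<zeta> = (\<integral>\<^sup>+ z. tk z \<zeta> * indicator S z \<partial>\<mu>)" for \<zeta>
  interpret \<mu>T: pair_sigma_finite \<mu> torus_measure ..
  have G_meas[measurable]: "G \<in> borel_measurable torus_measure"
    unfolding G_def by measurable
  interpret bidisc_density \<mu> "\<lambda>z. indicator S z :: complex" 1
    by standard (auto simp: indicator_def)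
  let ?W = "\<lambda>z z'. ennreal (bidisc_kernel \<rho> z z') * ennreal (indicator S z) * ennreal (indicator S z')"
  have "\<forall>\<^sub>F D in sequentially. (\<integral>\<^sup>+ z. \<integral>\<^sup>+ z'. ?W z z' \<partial>\<mu> \<partial>\<mu>) \<le> ennreal (4 * energy D \<rho>)"
    by (rule energy_ge[OF \<rho>(1,2), of "indicator S"]) (simp add: indicator_def)
  from eventually_happens[OF this]
  obtain D where D: "(\<integral>\<^sup>+ z. \<integral>\<^sup>+ z'. ?W z z' \<partial>\<mu> \<partial>\<mu>) \<le> ennreal (4 * energy D \<rho>)"
    by auto
  have G2: "(\<integral>\<^sup>+ \<zeta>. (G \<zeta>)\<^sup>2 \<partial>torus_measure) \<le> ennreal (1638400 * C * measure \<mu> S)"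
  proof -
    let ?T = "\<lambda>z z' \<zeta>. (tk z \<zeta> * indicator S z) * (tk z' \<zeta> * indicator S z')"
    have "(\<integral>\<^sup>+ \<zeta>. (G \<zeta>)\<^sup>2 \<partial>torus_measure)
       = (\<integral>\<^sup>+ \<zeta>. \<integral>\<^sup>+ z. \<integral>\<^sup>+ z'. ?T z z' \<zeta> \<partial>\<mu> \<partial>\<mu> \<partial>torus_measure)"
      unfolding G_def power2_eq_square
      by (intro nn_integral_cong) (simp add: nn_integral_cmult nn_integral_multc)
    also have "\<dots> = (\<integral>\<^sup>+ z. \<integral>\<^sup>+ \<zeta>. \<integral>\<^sup>+ z'. ?T z z' \<zeta> \<partial>\<mu> \<partial>torus_measure \<partial>\<mu>)"
      by (intro \<mu>T.Fubini') measurable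
    also have "\<dots> = (\<integral>\<^sup>+ z. \<integral>\<^sup>+ z'. \<integral>\<^sup>+ \<zeta>. ?T z z' \<zeta> \<partial>torus_measure \<partial>\<mu> \<partial>\<mu>)"
      by (intro nn_integral_cong \<mu>T.Fubini') measurable
    also have "\<dots> \<le> (\<integral>\<^sup>+ z. \<integral>\<^sup>+ z'. ennreal 1024 * (?W z z') \<partial>\<mu> \<partial>\<mu>)"
    proof (intro nn_integral_mono)
      fix z z' assume zz: "z \<in> space \<mu>" "z' \<in> space \<mu>"
      let ?w = "of_real \<rho> * (fst z * cnj (fst z'))" and ?v = "of_real \<rho> * (snd z * cnj (snd z'))"
      have "norm ?w < 1" "norm ?v < 1"
        using norm_dilated_product[OF \<rho>(1)] zz in_bidisc \<rho>(2) by (meson le_less_trans)+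
      then have pos: "log_kernel ?w \<ge> 9" "log_kernel ?v \<ge> 9" by (auto intro!: log_kernel_ge)
      have "(\<integral>\<^sup>+ \<zeta>. ?T z z' \<zeta> \<partial>torus_measure)
        = (\<integral>\<^sup>+ \<zeta>. (indicator S z * indicator S z') * (ennreal (truncated_kernel N (fst z) (fst \<zeta>) * truncated_kernel N (fst z') (fst \<zeta>))
            * ennreal (truncated_kernel N (snd z) (snd \<zeta>) * truncated_kernel N (snd z') (snd \<zeta>))) \<partial>torus_measure)"
        by (intro nn_integral_cong) (simp add: tk_def ennreal_mult mult_ac)
      also have "\<dots> = (indicator S z * indicator S z') *
          ((\<integral>\<^sup>+ \<zeta>. ennreal (truncated_kernel N (fst z) \<zeta> * truncated_kernel N (fst z') \<zeta>) \<partial>circle_measure)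
          * (\<integral>\<^sup>+ \<zeta>. ennreal (truncated_kernel N (snd z) \<zeta> * truncated_kernel N (snd z') \<zeta>) \<partial>circle_measure))"
        by (subst nn_integral_cmult, measurable) (subst nn_integral_torus_product, auto)
      also have "\<dots> \<le> (indicator S z * indicator S z') * (ennreal (32 * log_kernel ?w) * ennreal (32 * log_kernel ?v))"
        using zz[THEN in_bidisc] by (intro mult_left_mono mult_mono truncated_kernel_convolution_le \<rho>) auto
      also have "\<dots> = ennreal 1024 * (?W z z')"
        using pos by (auto simp: bidisc_kernel_def indicator_def ennreal_mult[symmetric] simp del: ennreal_numeral)
      finally show "(\<integral>\<^sup>+ \<zeta>. ?T z z' \<zeta> \<partial>torus_measure)
        \<le> ennreal 1024 * (?W z z')" .
    qed
    also have "\<dots> = ennreal 1024 * (\<integral>\<^sup>+ z. \<integral>\<^sup>+ z'. ?W z z' \<partial>\<mu> \<partial>\<mu>)"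
    proof -
      have "(\<integral>\<^sup>+ z. \<integral>\<^sup>+ z'. ennreal 1024 * (?W z z') \<partial>\<mu> \<partial>\<mu>)
        = (\<integral>\<^sup>+ z. ennreal 1024 * (\<integral>\<^sup>+ z'. ?W z z' \<partial>\<mu>) \<partial>\<mu>)"
        by (intro nn_integral_cong nn_integral_cmult) measurable
      also have "\<dots> = ennreal 1024 * (\<integral>\<^sup>+ z. \<integral>\<^sup>+ z'. ?W z z' \<partial>\<mu> \<partial>\<mu>)"
        by (rule nn_integral_cmult) measurable
      finally show ?thesis .
    qed
    also have "\<dots> \<le> ennreal 1024 * ennreal (4 * energy D \<rho>)" by (intro mult_left_mono D) auto
    also have "\<dots> \<le> ennreal 1024 * ennreal (4 * (400 * C * measure \<mu> S))"
      by (intro mult_left_mono ennreal_leI embedding_energy_le C emb S \<rho>) auto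
    also have "\<dots> = ennreal (1638400 * C * measure \<mu> S)"
      using C by (simp add: ennreal_mult[symmetric] del: ennreal_numeral)
    finally show ?thesis .
  qed
  show "emeasure \<mu> (\<Union>k\<in>{1..n}. carleson_box (J1 k) \<times> carleson_box (J2 k))
        \<le> ennreal (4096000000 * C) * capacity (\<Union>k\<in>{1..n}. J1 k \<times> J2 k)"
    unfolding capacity_def S_def[symmetric] E_def[symmetric]
  proof (rule le_ennreal_mult_INF)
    fix h assume "h \<in> {h \<in> borel_measurable torus_measure. \<forall>z\<in>E. 1 \<le> potential h z}"
    then have h[measurable]: "h \<in> borel_measurable borel" and pot: "\<And>z. z \<in> E \<Longrightarrow> 1 \<le> potential h z"
      by (auto simp: measurable_cong_sets[OF sets_torus_measure refl])
    define H where "H = (\<integral>\<^sup>+ \<zeta>. (h \<zeta>)\<^sup>2 \<partial>torus_measure)"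
    have "emeasure \<mu> S = (\<integral>\<^sup>+ z. indicator S z \<partial>\<mu>)" by simp
    also have "\<dots> \<le> (\<integral>\<^sup>+ z. (ennreal 25 * (\<integral>\<^sup>+ \<zeta>. tk z \<zeta> * h \<zeta> \<partial>torus_measure)) * indicator S z \<partial>\<mu>)"
    proof (intro nn_integral_mono)
      fix z assume "z \<in> space \<mu>"
      show "indicator S z \<le> (ennreal 25 * (\<integral>\<^sup>+ \<zeta>. tk z \<zeta> * h \<zeta> \<partial>torus_measure)) * indicator S z"
      proof (cases "z \<in> S")
        case True
        then obtain k where k: "k \<in> {1..n}" "fst z \<in> carleson_box (J1 k)" "snd z \<in> carleson_box (J2 k)"
          by (auto simp: S_def)
        have "1 \<le> ennreal 25 * (\<integral>\<^sup>+ \<zeta>. ennreal (truncated_kernel N (fst z) (fst \<zeta>)) * ennreal (truncated_kernel N (snd z) (snd \<zeta>)) * h \<zeta> \<partial>torus_measure)"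
        proof (rule one_le_potential_average[OF _ _ _ _ _ _ N1[OF k(1)] N2[OF k(1)] h])
          show "1 \<le> potential h (u, v)" if "u \<in> cis ` {fst (p k)..snd (p k)}" "v \<in> cis ` {fst (q k)..snd (q k)}" for u v
          proof (rule pot)
            have "(u, v) \<in> J1 k \<times> J2 k" using that p[OF k(1)] q[OF k(1)] by simp
            then show "(u, v) \<in> E" using k(1) unfolding E_def by blast
          qed
        qed (use p[OF k(1)] q[OF k(1)] k in auto)
        then show ?thesis using True by (simp add: tk_def)
      qed simp
    qed
    also have "\<dots> = (\<integral>\<^sup>+ z. \<integral>\<^sup>+ \<zeta>. ennreal 25 * (tk z \<zeta> * h \<zeta> * indicator S z) \<partial>torus_measure \<partial>\<mu>)"
    proof (intro nn_integral_cong)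
      fix z assume [simp]: "z \<in> space \<mu>"
      have "(\<integral>\<^sup>+ \<zeta>. ennreal 25 * (tk z \<zeta> * h \<zeta> * indicator S z) \<partial>torus_measure)
         = ennreal 25 * (\<integral>\<^sup>+ \<zeta>. tk z \<zeta> * h \<zeta> * indicator S z \<partial>torus_measure)"
        by (rule nn_integral_cmult) measurable
      also have "(\<integral>\<^sup>+ \<zeta>. tk z \<zeta> * h \<zeta> * indicator S z \<partial>torus_measure)
         = (\<integral>\<^sup>+ \<zeta>. tk z \<zeta> * h \<zeta> \<partial>torus_measure) * indicator S z"
        by (rule nn_integral_multc) measurable
      finally show "ennreal 25 * (\<integral>\<^sup>+ \<zeta>. tk z \<zeta> * h \<zeta> \<partial>torus_measure) * indicator S z
        = (\<integral>\<^sup>+ \<zeta>. ennreal 25 * (tk z \<zeta> * h \<zeta> * indicator S z) \<partial>torus_measure)"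
        by (simp only: mult.assoc)
    qed
    also have "\<dots> = (\<integral>\<^sup>+ \<zeta>. \<integral>\<^sup>+ z. ennreal 25 * (tk z \<zeta> * h \<zeta> * indicator S z) \<partial>\<mu> \<partial>torus_measure)"
      by (intro \<mu>T.Fubini'[symmetric]) measurable
    also have "\<dots> = (\<integral>\<^sup>+ \<zeta>. ennreal 25 * (h \<zeta> * G \<zeta>) \<partial>torus_measure)"
    proof (intro nn_integral_cong)
      fix \<zeta>
      have "(\<integral>\<^sup>+ z. ennreal 25 * (tk z \<zeta> * h \<zeta> * indicator S z) \<partial>\<mu>) = (\<integral>\<^sup>+ z. (ennreal 25 * h \<zeta>) * (tk z \<zeta> * indicator S z) \<partial>\<mu>)"
        by (simp add: mult_ac)
      also have "\<dots> = ennreal 25 * h \<zeta> * G \<zeta>" unfolding G_def by (rule nn_integral_cmult) measurable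
      finally show "(\<integral>\<^sup>+ z. ennreal 25 * (tk z \<zeta> * h \<zeta> * indicator S z) \<partial>\<mu>) = ennreal 25 * (h \<zeta> * G \<zeta>)"
        by (simp add: mult.assoc)
    qed
    \<comment> \<open>The weight is \<open>50\<close> times the constant in the bound for \<open>G\<close>, so the second term is half of \<open>\<mu>(S)\<close>.\<close>
    also have "\<dots> \<le> (\<integral>\<^sup>+ \<zeta>. ennreal 25 * (ennreal (81920000 * C) * (h \<zeta>)\<^sup>2 + ennreal (1 / (81920000 * C)) * (G \<zeta>)\<^sup>2) \<partial>torus_measure)"
      using C by (intro nn_integral_mono mult_left_mono ennreal_mult_le_squares) auto
    also have "\<dots> = ennreal 25 * (ennreal (81920000 * C) * H + ennreal (1 / (81920000 * C)) * (\<integral>\<^sup>+ \<zeta>. (G \<zeta>)\<^sup>2 \<partial>torus_measure))"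
      unfolding H_def by (simp add: nn_integral_cmult nn_integral_add)
    also have "\<dots> \<le> ennreal 25 * (ennreal (81920000 * C) * H + ennreal (1 / (81920000 * C)) * ennreal (1638400 * C * measure \<mu> S))"
      by (intro mult_left_mono add_left_mono G2) auto
    finally have main: "emeasure \<mu> S \<le> ennreal 25 * (ennreal (81920000 * C) * H + ennreal (1 / (81920000 * C)) * ennreal (1638400 * C * measure \<mu> S))" .
    show "emeasure \<mu> S \<le> ennreal (4096000000 * C) * (\<integral>\<^sup>+ \<zeta>. (h \<zeta>)\<^sup>2 \<partial>torus_measure)"
    proof (cases "H = \<infinity>")
      case True
      then show ?thesis using C by (simp add: H_def ennreal_mult_top)
    next
      case False
      then obtain H' where H': "H = ennreal H'" "0 \<le> H'" by (cases H) auto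
      have "ennreal (measure \<mu> S) \<le> ennreal (25 * (81920000 * C * H' + 1 / (81920000 * C) * (1638400 * C * measure \<mu> S)))"
        using main C H' by (simp add: emeasure_eq_measure ennreal_mult[symmetric] del: ennreal_numeral flip: ennreal_plus)
      then have "measure \<mu> S \<le> 25 * (81920000 * C * H' + 1 / (81920000 * C) * (1638400 * C * measure \<mu> S))"
        using C H' by (subst (asm) ennreal_le_iff) auto
      then have "measure \<mu> S \<le> 4096000000 * C * H'" using C by (simp add: field_simps)
      then show ?thesis using C H' by (simp add: emeasure_eq_measure H_def[symmetric] ennreal_mult[symmetric] ennreal_leI)
    qed
  qed (use C in simp)
qed

end

section \<open>Dyadic grids on the circle\<close>

text \<open>The node \<open>(n, k)\<close> stands for the \<open>k\<close>-th dyadic interval of length \<open>(1/2) ^ n\<close> in \<open>[0, 1)\<close>. The depth is bounded by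
\<open>N\<close> so that all sums are finite.\<close>

definition dyadic_nodes :: "nat \<Rightarrow> (nat \<times> int) set" where
  "dyadic_nodes N = {(n, k). n \<le> N \<and> 0 \<le> k \<and> k < 2 ^ n}"

definition dyadic_le :: "nat \<times> int \<Rightarrow> nat \<times> int \<Rightarrow> bool" where
  "dyadic_le x y \<longleftrightarrow> fst y \<le> fst x \<and> snd y = snd x div 2 ^ (fst x - fst y)"

lemma finite_dyadic_nodes: "finite (dyadic_nodes N)"
proof -
  have "dyadic_nodes N \<subseteq> {..N} \<times> {0..<2 ^ N}"
  proof
    fix x assume "x \<in> dyadic_nodes N"
    then have x: "fst x \<le> N" "0 \<le> snd x" "snd x < 2 ^ fst x" by (auto simp: dyadic_nodes_def)
    have "(2::int) ^ fst x \<le> 2 ^ N" using x by (intro power_increasing) auto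
    then have "snd x < 2 ^ N" using x by (rule_tac less_le_trans)
    then show "x \<in> {..N} \<times> {0..<2 ^ N}" using x by (cases x) auto
  qed
  then show ?thesis by (rule finite_subset) auto
qed

lemma div_power_div: "(k::int) div 2 ^ a div 2 ^ b = k div 2 ^ (a + b)"
  by (simp add: zdiv_zmult2_eq power_add)

interpretation dyadic: finite_forest "dyadic_nodes N" dyadic_le for N
proof
  show "finite (dyadic_nodes N)" by (rule finite_dyadic_nodes)
  show "dyadic_le a a" for a by (simp add: dyadic_le_def)
  show "dyadic_le a c" if "dyadic_le a b" "dyadic_le b c" for a b c
    using that by (auto simp: dyadic_le_def div_power_div)
  show "a = b" if "dyadic_le a b" "dyadic_le b a" for a b
    using that by (auto simp: dyadic_le_def prod_eq_iff)
  have *: "dyadic_le a b" if "dyadic_le x a" "dyadic_le x b" "fst b \<le> fst a" for x a b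
    using that by (auto simp: dyadic_le_def div_power_div)
  show "dyadic_le a b \<or> dyadic_le b a" if "dyadic_le x a" "dyadic_le x b" for x a b
    using *[OF that] *[OF that(2,1)] by (cases "fst b \<le> fst a") auto
qed

interpretation bidyadic: bitree "dyadic_nodes N" dyadic_le "dyadic_nodes N" dyadic_le for N ..

text \<open>The circle is cut open at a point that depends on the shift \<open>\<sigma>\<close>, and the grid consists of the dyadic intervals
of the resulting parameter.\<close>

definition phase :: "real \<Rightarrow> complex \<Rightarrow> real" where
  "phase \<sigma> z = frac (Arg z / (2 * pi) + \<sigma>)"

definition grid_index :: "real \<Rightarrow> nat \<Rightarrow> complex \<Rightarrow> int" where
  "grid_index \<sigma> n z = \<lfloor>2 ^ n * phase \<sigma> z\<rfloor>"

definition depth :: "nat \<Rightarrow> complex \<Rightarrow> nat" where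
  "depth N z = Max {n. n \<le> N \<and> 1 - norm z \<le> (1/2) ^ n}"

text \<open>The deepest node whose Carleson box contains \<open>z\<close>, within the depth \<open>N\<close>. Its ancestors are all the nodes whose
boxes contain \<open>z\<close>, see \<open>leaf_le_iff\<close>.\<close>

definition leaf :: "real \<Rightarrow> nat \<Rightarrow> complex \<Rightarrow> nat \<times> int" where
  "leaf \<sigma> N z = (depth N z, grid_index \<sigma> (depth N z) z)"

lemma phase_bounds: "0 \<le> phase \<sigma> z" "phase \<sigma> z < 1"
  by (auto simp: phase_def frac_ge_0 frac_lt_1)

lemma phase_measurable [measurable]: "phase \<sigma> \<in> borel_measurable borel"
  unfolding phase_def frac_def by measurable

lemma grid_index_eq_iff: "grid_index \<sigma> n z = k \<longleftrightarrow> of_int k \<le> 2 ^ n * phase \<sigma> z \<and> 2 ^ n * phase \<sigma> z < of_int k + 1"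
  unfolding grid_index_def by (rule floor_eq_iff)

lemma grid_index_bounds: "0 \<le> grid_index \<sigma> n z" "grid_index \<sigma> n z < 2 ^ n"
proof -
  show "0 \<le> grid_index \<sigma> n z" using phase_bounds by (simp add: grid_index_def)
  have "2 ^ n * phase \<sigma> z < 2 ^ n * 1" using phase_bounds by (intro mult_strict_left_mono) auto
  then show "grid_index \<sigma> n z < 2 ^ n" by (simp add: grid_index_def floor_less_iff)
qed

lemma grid_index_div: "n \<le> m \<Longrightarrow> grid_index \<sigma> m z div 2 ^ (m - n) = grid_index \<sigma> n z"
proof -
  assume nm: "n \<le> m"
  have "2 ^ n * phase \<sigma> z = (2 ^ m * phase \<sigma> z) / of_int (2 ^ (m - n))"
    using nm by (simp add: field_simps flip: power_add)
  then show ?thesis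
    unfolding grid_index_def by (simp only: floor_divide_real_eq_div[OF zero_le_power[OF zero_le_numeral]])
qed

lemma le_depth_iff:
  assumes "norm z \<le> 1"
  shows "n \<le> depth N z \<longleftrightarrow> n \<le> N \<and> 1 - norm z \<le> (1/2) ^ n"
proof -
  let ?X = "{n. n \<le> N \<and> 1 - norm z \<le> (1/2) ^ n}"
  have fin: "finite ?X" and ne: "?X \<noteq> {}" by (auto intro: exI[of _ 0])
  have mem: "depth N z \<in> ?X" unfolding depth_def by (rule Max_in[OF fin ne])
  show ?thesis
  proof
    assume n: "n \<le> depth N z"
    have "(1/2::real) ^ depth N z \<le> (1/2) ^ n" using n by (intro power_decreasing) auto
    moreover have "1 - norm z \<le> (1/2) ^ depth N z" "depth N z \<le> N" using mem by auto
    ultimately show "n \<le> N \<and> 1 - norm z \<le> (1/2) ^ n" using n by linarith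
  next
    assume "n \<le> N \<and> 1 - norm z \<le> (1/2) ^ n"
    then show "n \<le> depth N z" unfolding depth_def by (intro Max_ge fin) auto
  qed
qed

lemma leaf_in_nodes:
  assumes "norm z \<le> 1"
  shows "leaf \<sigma> N z \<in> dyadic_nodes N"
  using le_depth_iff[OF assms, of "depth N z" N] grid_index_bounds[of \<sigma> "depth N z" z]
  by (simp add: leaf_def dyadic_nodes_def)

lemma leaf_le_iff:
  assumes "norm z \<le> 1"
  shows "dyadic_le (leaf \<sigma> N z) \<alpha> \<longleftrightarrow> fst \<alpha> \<le> N \<and> 1 - norm z \<le> (1/2) ^ fst \<alpha> \<and> grid_index \<sigma> (fst \<alpha>) z = snd \<alpha>"
  using grid_index_div[of "fst \<alpha>" "depth N z" \<sigma> z] le_depth_iff[OF assms, of "fst \<alpha>" N]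
  by (auto simp: dyadic_le_def leaf_def)

lemma leaf_eq_iff:
  assumes "norm z \<le> 1"
  shows "leaf \<sigma> N z = x \<longleftrightarrow> fst x \<le> N \<and> 1 - norm z \<le> (1/2) ^ fst x
    \<and> (Suc (fst x) \<le> N \<longrightarrow> \<not> 1 - norm z \<le> (1/2) ^ Suc (fst x)) \<and> grid_index \<sigma> (fst x) z = snd x"
proof -
  have "depth N z = fst x \<longleftrightarrow> fst x \<le> depth N z \<and> \<not> Suc (fst x) \<le> depth N z" by auto
  then show ?thesis
    unfolding le_depth_iff[OF assms] by (auto simp: leaf_def prod_eq_iff)
qed

definition arc_start :: "real \<Rightarrow> nat \<times> int \<Rightarrow> real" where
  "arc_start \<sigma> x = 2 * pi * (of_int (snd x) / 2 ^ fst x - \<sigma>)"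

definition arc_end :: "real \<Rightarrow> nat \<times> int \<Rightarrow> real" where
  "arc_end \<sigma> x = 2 * pi * (of_int (snd x + 1) / 2 ^ fst x - \<sigma>)"

text \<open>The closed arc of a node. The half-open cells partition the circle, but the arcs of the capacity
condition are closed.\<close>

definition grid_arc :: "real \<Rightarrow> nat \<times> int \<Rightarrow> complex set" where
  "grid_arc \<sigma> x = cis ` {arc_start \<sigma> x..arc_end \<sigma> x}"

lemma grid_arc_interval:
  "arc_start \<sigma> x < arc_end \<sigma> x"
  "arc_end \<sigma> x - arc_start \<sigma> x = 2 * pi * (1/2) ^ fst x"
proof -
  show *: "arc_end \<sigma> x - arc_start \<sigma> x = 2 * pi * (1/2) ^ fst x"
    by (simp add: arc_start_def arc_end_def field_simps power_one_over)
  have "2 * pi * (1/2) ^ fst x > 0" by simp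
  with * show "arc_start \<sigma> x < arc_end \<sigma> x" by linarith
qed

lemma grid_arc_interval_le:
  "arc_end \<sigma> x \<le> arc_start \<sigma> x + 2 * pi"
proof -
  have "2 * pi * (1/2) ^ fst x \<le> 2 * pi * 1" by (intro mult_left_mono power_le_one) auto
  then show ?thesis using grid_arc_interval(2)[of \<sigma> x] by linarith
qed

lemma grid_arc_in_circle_arcs: "grid_arc \<sigma> x \<in> circle_arcs"
  unfolding grid_arc_def circle_arcs_def using grid_arc_interval(1) grid_arc_interval_le by blast

lemma direction_in_grid_arc:
  assumes "grid_index \<sigma> n z = k"
  shows "direction z \<in> grid_arc \<sigma> (n, k)"
proof -
  define t where "t = 2 * pi * (phase \<sigma> z - \<sigma>)"
  have "t = Arg z + of_int (- \<lfloor>Arg z / (2 * pi) + \<sigma>\<rfloor>) * (2 * pi)"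
    by (simp add: t_def phase_def frac_def field_simps)
  then have "cis t = direction z" by (metis cis_add_of_int_mult_2pi direction_def)
  moreover have "of_int k / 2 ^ n \<le> phase \<sigma> z" "phase \<sigma> z \<le> of_int (k + 1) / 2 ^ n"
    using assms unfolding grid_index_eq_iff by (auto simp: field_simps)
  then have "t \<in> {2 * pi * (of_int k / 2 ^ n - \<sigma>)..2 * pi * (of_int (k + 1) / 2 ^ n - \<sigma>)}"
    unfolding t_def by (auto simp: mult_left_mono)
  ultimately show ?thesis unfolding grid_arc_def arc_start_def arc_end_def by (metis fst_conv imageI snd_conv)
qed

lemma in_carleson_box_leaf:
  assumes z: "norm z \<le> 1"
  shows "z \<in> carleson_box (grid_arc \<sigma> (leaf \<sigma> N z))"
proof -
  let ?x = "leaf \<sigma> N z"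
  have "1 - norm z \<le> (1/2) ^ fst ?x" "grid_index \<sigma> (fst ?x) z = snd ?x"
    using leaf_eq_iff[OF z, of \<sigma> N ?x] by auto
  moreover have "direction z \<in> grid_arc \<sigma> ?x"
    using direction_in_grid_arc[of \<sigma> "fst ?x" z "snd ?x"] calculation by simp
  ultimately show ?thesis
    using z unfolding grid_arc_def carleson_box_eq[OF grid_arc_interval(1) grid_arc_interval_le] grid_arc_interval(2)
    by simp
qed

lemma angle_grid_arc_le:
  assumes u: "u \<in> grid_arc \<sigma> x" and v: "v \<in> grid_arc \<sigma> x"
  shows "angle u v \<le> 2 * pi * (1/2) ^ fst x"
proof -
  obtain s t where s: "s \<in> {arc_start \<sigma> x..arc_end \<sigma> x}" "u = cis s"
    and t: "t \<in> {arc_start \<sigma> x..arc_end \<sigma> x}" "v = cis t"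
    using u v unfolding grid_arc_def by auto
  have "\<bar>s - t\<bar> \<le> arc_end \<sigma> x - arc_start \<sigma> x"
    using s t by (simp only: atLeastAtMost_iff) linarith
  then show ?thesis
    using angle_cis[of s t] s t unfolding grid_arc_interval(2) by simp
qed

lemma grid_arc_mono:
  assumes "dyadic_le x y"
  shows "grid_arc \<sigma> x \<subseteq> grid_arc \<sigma> y"
proof -
  define d where "d = fst x - fst y"
  have x: "fst x = fst y + d" and y: "snd y = snd x div 2 ^ d" using assms by (auto simp: dyadic_le_def d_def)
  have "snd x = snd y * 2 ^ d + snd x mod 2 ^ d" unfolding y by (rule div_mult_mod_eq[symmetric])
  moreover have "0 \<le> snd x mod 2 ^ d" "snd x mod 2 ^ d < 2 ^ d" by simp_all
  ultimately have "snd y * 2 ^ d \<le> snd x" "snd x + 1 \<le> (snd y + 1) * 2 ^ d"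
    unfolding distrib_right by linarith+
  then have "of_int (snd y * 2 ^ d) \<le> (of_int (snd x) :: real)" "of_int (snd x + 1) \<le> (of_int ((snd y + 1) * 2 ^ d) :: real)"
    by (simp_all only: of_int_le_iff)
  then have "of_int (snd y * 2 ^ d) / 2 ^ fst x \<le> (of_int (snd x) / 2 ^ fst x :: real)"
    "of_int (snd x + 1) / 2 ^ fst x \<le> (of_int ((snd y + 1) * 2 ^ d) / 2 ^ fst x :: real)"
    by (auto intro!: divide_right_mono simp del: of_int_mult of_int_add)
  then have "of_int (snd y) / 2 ^ fst y \<le> (of_int (snd x) / 2 ^ fst x :: real)"
    "of_int (snd x + 1) / 2 ^ fst x \<le> (of_int (snd y + 1) / 2 ^ fst y :: real)"
    by (simp_all add: x power_add)
  then show ?thesis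
    unfolding grid_arc_def by (intro image_mono) (auto simp: arc_start_def arc_end_def mult_left_mono)
qed

text \<open>Starting the period at \<open>- 2 * pi * \<sigma>\<close> turns the phase into a linear function of the parameter.\<close>

lemma emeasure_grid_cell:
  assumes k: "0 \<le> k" "k < 2 ^ n"
  shows "emeasure circle_measure {\<zeta>. grid_index \<sigma> n \<zeta> = k} = ennreal ((1/2) ^ n)"
proof -
  let ?X = "{\<zeta>. grid_index \<sigma> n \<zeta> = k}"
  define c where "c = - (2 * pi * \<sigma>)"
  define a where "a = 2 * pi * (of_int k / 2 ^ n - \<sigma>)"
  define b where "b = 2 * pi * (of_int (k + 1) / 2 ^ n - \<sigma>)"
  have ab: "a \<le> b" "b - a = 2 * pi * (1/2) ^ n"
    using grid_arc_interval[of \<sigma> "(n, k)"] by (auto simp: a_def b_def arc_start_def arc_end_def)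
  have X[measurable]: "?X \<in> sets borel" unfolding grid_index_eq_iff by measurable
  have "emeasure circle_measure ?X = (\<integral>\<^sup>+ \<zeta>. indicator ?X \<zeta> \<partial>circle_measure)"
    by (subst nn_integral_indicator) auto
  also have "\<dots> = (\<integral>\<^sup>+ t. indicator ?X (cis t) * indicator {c..<c + 2 * pi} t \<partial>lborel) / ennreal (2 * pi)"
    by (rule nn_integral_circle_measure) auto
  also have "(\<integral>\<^sup>+ t. indicator ?X (cis t) * indicator {c..<c + 2 * pi} t \<partial>lborel) = (\<integral>\<^sup>+ t. indicator {a..<b} t \<partial>lborel)"
  proof (intro nn_integral_cong)
    fix t
    have ca: "c \<le> a" unfolding c_def a_def using k by (simp add: algebra_simps)
    have bc: "b \<le> c + 2 * pi"
    proof -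
      have "of_int (k + 1) \<le> (of_int (2 ^ n) :: real)" using k by (simp only: of_int_le_iff)
      then have "of_int (k + 1) / 2 ^ n \<le> (1::real)" by (simp add: field_simps)
      then have "2 * pi * (of_int (k + 1) / 2 ^ n - \<sigma>) \<le> 2 * pi * (1 - \<sigma>)" by (intro mult_left_mono) auto
      then show ?thesis by (simp add: b_def c_def algebra_simps)
    qed
    show "indicator ?X (cis t) * indicator {c..<c + 2 * pi} t = (indicator {a..<b} t :: ennreal)"
    proof (cases "t \<in> {c..<c + 2 * pi}")
      case True
      obtain j where j: "Arg (cis t) = t + of_int j * (2 * pi)" using Arg_cis_int by blast
      have "phase \<sigma> (cis t) = frac (t / (2 * pi) + \<sigma> + of_int j)"
        unfolding phase_def j by (simp add: field_simps)
      also have "\<dots> = frac (t / (2 * pi) + \<sigma>)" by (rule frac_add_of_int_right)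
      also have "\<dots> = t / (2 * pi) + \<sigma>"
      proof -
        have "0 \<le> t / (2 * pi) + \<sigma>" "t / (2 * pi) + \<sigma> < 1"
          using True pi_gt_zero by (auto simp: c_def field_simps)
        then show ?thesis by (simp add: frac_eq)
      qed
      finally have ph: "phase \<sigma> (cis t) = t / (2 * pi) + \<sigma>" .
      have "grid_index \<sigma> n (cis t) = k \<longleftrightarrow> t \<in> {a..<b}"
        unfolding grid_index_eq_iff ph a_def b_def using pi_gt_zero by (auto simp: field_simps)
      then show ?thesis using True by (auto simp: indicator_def)
    next
      case False
      then show ?thesis using ca bc by (auto simp: indicator_def)
    qed
  qed
  also have "\<dots> = ennreal (b - a)" using ab by simp
  also have "\<dots> / ennreal (2 * pi) = ennreal ((1/2) ^ n)"
    unfolding ab(2) by (subst divide_ennreal) auto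
  finally show ?thesis .
qed

section \<open>Dyadic potentials on the torus\<close>

definition grid_cell :: "real \<Rightarrow> nat \<times> int \<Rightarrow> complex set" where
  "grid_cell \<sigma> x = {\<zeta>. grid_index \<sigma> (fst x) \<zeta> = snd x}"

lemma grid_cell_measurable [measurable]: "grid_cell \<sigma> x \<in> sets borel"
  unfolding grid_cell_def grid_index_eq_iff by measurable

text \<open>The normalisation is chosen such that the weight times the indicator of the cell of a node has norm \<open>1\<close> in \<open>L\<^sup>2\<close> of the
circle (\<open>node_overlap_self\<close>).\<close>

definition node_weight :: "nat \<times> int \<Rightarrow> real" where
  "node_weight x = sqrt 2 ^ fst x"

lemma node_weight_pos: "node_weight x > 0" by (simp add: node_weight_def)

definition node_overlap :: "real \<Rightarrow> nat \<times> int \<Rightarrow> nat \<times> int \<Rightarrow> real" where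
  "node_overlap \<sigma> x y = node_weight x * node_weight y * measure circle_measure (grid_cell \<sigma> x \<inter> grid_cell \<sigma> y)"

lemma node_overlap_nonneg: "0 \<le> node_overlap \<sigma> x y"
  using node_weight_pos[of x] node_weight_pos[of y] by (simp add: node_overlap_def)

lemma node_overlap_self: "x \<in> dyadic_nodes N \<Longrightarrow> node_overlap \<sigma> x x = 1"
proof -
  assume "x \<in> dyadic_nodes N"
  then have "emeasure circle_measure (grid_cell \<sigma> x) = ennreal ((1/2) ^ fst x)"
    unfolding grid_cell_def by (intro emeasure_grid_cell) (auto simp: dyadic_nodes_def)
  then have "measure circle_measure (grid_cell \<sigma> x) = (1/2) ^ fst x" by (simp add: measure_def)
  then show ?thesis
    by (simp add: node_overlap_def node_weight_def flip: power_mult_distrib)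
qed

definition grid_kernel :: "real \<Rightarrow> nat \<Rightarrow> nat \<times> int \<Rightarrow> complex \<Rightarrow> real" where
  "grid_kernel \<sigma> N x \<zeta> = (\<Sum>\<alpha>\<in>dyadic.up N x. node_weight \<alpha> * indicator (grid_cell \<sigma> \<alpha>) \<zeta>)"

lemma grid_kernel_nonneg: "0 \<le> grid_kernel \<sigma> N x \<zeta>"
  unfolding grid_kernel_def using node_weight_pos by (intro sum_nonneg mult_nonneg_nonneg) (auto intro: less_imp_le)

lemma sum_sqrt2_power_le: "(\<Sum>n\<le>k. sqrt 2 ^ n) \<le> 4 * sqrt 2 ^ k"
proof (induction k)
  case (Suc k)
  have "(4/3)\<^sup>2 \<le> (2::real)" by (simp add: power2_eq_square)
  then have "4/3 \<le> sqrt 2" by (rule real_le_rsqrt)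
  then have "4 * sqrt 2 ^ k \<le> (3 * sqrt 2) * sqrt 2 ^ k" by (intro mult_right_mono) auto
  moreover have "(\<Sum>n\<le>Suc k. sqrt 2 ^ n) = (\<Sum>n\<le>k. sqrt 2 ^ n) + sqrt 2 * sqrt 2 ^ k"
    "4 * sqrt 2 ^ Suc k = 4 * (sqrt 2 * sqrt 2 ^ k)" by simp_all
  ultimately show ?case using Suc.IH by (simp only: mult.assoc)
qed simp

text \<open>The terms of the grid kernel grow geometrically, so it is comparable to the last of them. At the corresponding level
\<open>u\<close> and \<open>\<zeta>\<close> lie in a common arc, which bounds the angle between them.\<close>

lemma grid_kernel_le_riesz_kernel:
  assumes x: "x \<in> dyadic_nodes N" and u: "u \<in> grid_arc \<sigma> x" and \<zeta>: "norm \<zeta> = 1"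
  shows "ennreal (grid_kernel \<sigma> N x \<zeta> / 12) \<le> riesz_kernel u \<zeta>"
proof -
  define Z where "Z = {\<alpha> \<in> dyadic.up N x. \<zeta> \<in> grid_cell \<sigma> \<alpha>}"
  have finZ: "finite Z" unfolding Z_def by simp
  have sum: "grid_kernel \<sigma> N x \<zeta> = (\<Sum>\<alpha>\<in>Z. node_weight \<alpha>)"
    unfolding grid_kernel_def Z_def by (intro sum.mono_neutral_cong_right) auto
  show ?thesis
  proof (cases "Z = {}")
    case True
    then show ?thesis by (simp add: sum)
  next
    case False
    define k where "k = Max (fst ` Z)"
    have "k \<in> fst ` Z" unfolding k_def using False finZ by (intro Max_in) auto
    then obtain \<alpha> where \<alpha>: "\<alpha> \<in> Z" "fst \<alpha> = k" by auto
    have le: "dyadic_le x \<alpha>" using \<alpha> by (simp add: Z_def dyadic.up_def)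
    have "direction \<zeta> \<in> grid_arc \<sigma> (k, snd \<alpha>)"
      using \<alpha> by (intro direction_in_grid_arc) (simp add: Z_def grid_cell_def)
    moreover have "direction \<zeta> = \<zeta>" using unit_eq_cis[OF \<zeta>] by (simp add: direction_def)
    ultimately have "\<zeta> \<in> grid_arc \<sigma> \<alpha>" using \<alpha>(2) by (cases \<alpha>) simp
    moreover have "u \<in> grid_arc \<sigma> \<alpha>" using grid_arc_mono[OF le] u by blast
    ultimately have "angle u \<zeta> \<le> 2 * pi * (1/2) ^ k" using angle_grid_arc_le[of u \<sigma> \<alpha> \<zeta>] \<alpha>(2) by simp
    then have ge: "ennreal (1 / sqrt (2 * pi * (1/2) ^ k)) \<le> riesz_kernel u \<zeta>"
      by (intro riesz_kernel_ge) auto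
    have inj: "inj_on fst Z"
      by (rule inj_onI) (auto simp: Z_def grid_cell_def prod_eq_iff)
    have "grid_kernel \<sigma> N x \<zeta> = (\<Sum>n\<in>fst ` Z. sqrt 2 ^ n)"
      unfolding sum by (subst sum.reindex[OF inj]) (simp add: node_weight_def)
    also have "\<dots> \<le> (\<Sum>n\<le>k. sqrt 2 ^ n)"
      unfolding k_def using finZ by (intro sum_mono2 subsetI) (auto intro: Max_ge[OF finite_imageI] rev_image_eqI)
    also have "\<dots> \<le> 4 * sqrt 2 ^ k" by (rule sum_sqrt2_power_le)
    finally have "grid_kernel \<sigma> N x \<zeta> / 12 \<le> sqrt 2 ^ k / 3" by simp
    also have "\<dots> \<le> 1 / sqrt (2 * pi * (1/2) ^ k)"
    proof -
      have "sqrt (2 * pi) \<le> 3" using pi_less_4 pi_approx(2) by (intro real_le_lsqrt) auto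
      then have "sqrt 2 ^ k / 3 \<le> sqrt 2 ^ k / sqrt (2 * pi)" by (intro divide_left_mono) auto
      also have "\<dots> = 1 / sqrt (2 * pi * (1/2) ^ k)"
        by (simp add: real_sqrt_mult real_sqrt_power real_sqrt_divide power_one_over power_divide field_simps)
      finally show ?thesis .
    qed
    finally show ?thesis using ge ennreal_leI order_trans by blast
  qed
qed

text \<open>The function on the torus with coefficients \<open>p\<close> for the normalised indicators of dyadic rectangles;
\<open>overlap_op\<close> is the Gram matrix of these functions.\<close>

definition grid_sum :: "real \<Rightarrow> real \<Rightarrow> nat \<Rightarrow> (nat \<times> int \<Rightarrow> nat \<times> int \<Rightarrow> real) \<Rightarrow> complex \<times> complex \<Rightarrow> real" where
  "grid_sum \<sigma> \<tau> N p \<zeta> = (\<Sum>\<alpha>\<in>dyadic_nodes N. \<Sum>\<beta>\<in>dyadic_nodes N.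
     p \<alpha> \<beta> * (node_weight \<alpha> * indicator (grid_cell \<sigma> \<alpha>) (fst \<zeta>)) * (node_weight \<beta> * indicator (grid_cell \<tau> \<beta>) (snd \<zeta>)))"

definition overlap_op :: "real \<Rightarrow> real \<Rightarrow> nat \<Rightarrow> (nat \<times> int \<Rightarrow> nat \<times> int \<Rightarrow> real) \<Rightarrow> nat \<times> int \<Rightarrow> nat \<times> int \<Rightarrow> real" where
  "overlap_op \<sigma> \<tau> N p \<alpha> \<beta> = (\<Sum>\<alpha>'\<in>dyadic_nodes N. \<Sum>\<beta>'\<in>dyadic_nodes N.
     node_overlap \<sigma> \<alpha> \<alpha>' * node_overlap \<tau> \<beta> \<beta>' * p \<alpha>' \<beta>')"

lemma grid_sum_measurable [measurable]: "grid_sum \<sigma> \<tau> N p \<in> borel_measurable torus_measure"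
  unfolding grid_sum_def by measurable

lemma grid_sum_nonneg: "bidyadic.nonneg N p \<Longrightarrow> 0 \<le> grid_sum \<sigma> \<tau> N p \<zeta>"
  unfolding grid_sum_def bidyadic.nonneg_def using node_weight_pos
  by (intro sum_nonneg mult_nonneg_nonneg) (auto intro: less_imp_le)

lemma integral_grid_sum_mult:
  "(\<integral>\<zeta>. grid_sum \<sigma> \<tau> N p \<zeta> * grid_sum \<sigma> \<tau> N q \<zeta> \<partial>torus_measure) = bidyadic.pairing N p (overlap_op \<sigma> \<tau> N q)"
  "integrable torus_measure (\<lambda>\<zeta>. grid_sum \<sigma> \<tau> N p \<zeta> * grid_sum \<sigma> \<tau> N q \<zeta>)"
proof -
  let ?A = "dyadic_nodes N"
  define e where "e \<alpha> \<alpha>' \<beta> \<beta>' \<zeta> = indicator (grid_cell \<sigma> \<alpha> \<inter> grid_cell \<sigma> \<alpha>') (fst \<zeta>) * (indicator (grid_cell \<tau> \<beta> \<inter> grid_cell \<tau> \<beta>') (snd \<zeta>) :: real)"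
    for \<alpha> \<alpha>' \<beta> \<beta>' and \<zeta> :: "complex \<times> complex"
  define c where "c \<alpha> \<alpha>' \<beta> \<beta>' = p \<alpha> \<beta> * q \<alpha>' \<beta>' * (node_weight \<alpha> * node_weight \<alpha>') * (node_weight \<beta> * node_weight \<beta>')" for \<alpha> \<alpha>' \<beta> \<beta>'
  have [measurable]: "e \<alpha> \<alpha>' \<beta> \<beta>' \<in> borel_measurable torus_measure" for \<alpha> \<alpha>' \<beta> \<beta>'
    unfolding e_def by measurable
  have int_e: "integrable torus_measure (e \<alpha> \<alpha>' \<beta> \<beta>')" for \<alpha> \<alpha>' \<beta> \<beta>'
    by (rule torus_prob.integrable_const_bound[of _ 1]) (auto simp: e_def indicator_def)
  have e_eq: "(\<integral>\<zeta>. e \<alpha> \<alpha>' \<beta> \<beta>' \<zeta> \<partial>torus_measure)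
      = measure circle_measure (grid_cell \<sigma> \<alpha> \<inter> grid_cell \<sigma> \<alpha>') * measure circle_measure (grid_cell \<tau> \<beta> \<inter> grid_cell \<tau> \<beta>')" for \<alpha> \<alpha>' \<beta> \<beta>'
  proof -
    have "ennreal (\<integral>\<zeta>. e \<alpha> \<alpha>' \<beta> \<beta>' \<zeta> \<partial>torus_measure) = (\<integral>\<^sup>+ \<zeta>. ennreal (e \<alpha> \<alpha>' \<beta> \<beta>' \<zeta>) \<partial>torus_measure)"
      by (intro nn_integral_eq_integral[symmetric] int_e AE_I2) (simp add: e_def)
    also have "\<dots> = (\<integral>\<^sup>+ \<zeta>. indicator (grid_cell \<sigma> \<alpha> \<inter> grid_cell \<sigma> \<alpha>') (fst \<zeta>) * indicator (grid_cell \<tau> \<beta> \<inter> grid_cell \<tau> \<beta>') (snd \<zeta>) \<partial>torus_measure)"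
      by (intro nn_integral_cong) (simp add: e_def indicator_def)
    also have "\<dots> = emeasure circle_measure (grid_cell \<sigma> \<alpha> \<inter> grid_cell \<sigma> \<alpha>') * emeasure circle_measure (grid_cell \<tau> \<beta> \<inter> grid_cell \<tau> \<beta>')"
      by (subst nn_integral_torus_product) auto
    also have "\<dots> = ennreal (measure circle_measure (grid_cell \<sigma> \<alpha> \<inter> grid_cell \<sigma> \<alpha>') * measure circle_measure (grid_cell \<tau> \<beta> \<inter> grid_cell \<tau> \<beta>'))"
      by (simp add: circle.emeasure_eq_measure ennreal_mult)
    finally have eq: "ennreal (\<integral>\<zeta>. e \<alpha> \<alpha>' \<beta> \<beta>' \<zeta> \<partial>torus_measure)
      = ennreal (measure circle_measure (grid_cell \<sigma> \<alpha> \<inter> grid_cell \<sigma> \<alpha>') * measure circle_measure (grid_cell \<tau> \<beta> \<inter> grid_cell \<tau> \<beta>'))" .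
    have "0 \<le> (\<integral>\<zeta>. e \<alpha> \<alpha>' \<beta> \<beta>' \<zeta> \<partial>torus_measure)"
      by (intro integral_nonneg_AE) (simp add: e_def)
    then show ?thesis using eq by (subst (asm) ennreal_inj) auto
  qed
  have expand: "grid_sum \<sigma> \<tau> N p \<zeta> * grid_sum \<sigma> \<tau> N q \<zeta>
     = (\<Sum>\<alpha>\<in>?A. \<Sum>\<beta>\<in>?A. \<Sum>\<alpha>'\<in>?A. \<Sum>\<beta>'\<in>?A. c \<alpha> \<alpha>' \<beta> \<beta>' * e \<alpha> \<alpha>' \<beta> \<beta>' \<zeta>)" for \<zeta>
    unfolding grid_sum_def sum_distrib_right
    unfolding sum_distrib_left
    by (intro sum.cong refl) (auto simp: c_def e_def indicator_def)
  show "integrable torus_measure (\<lambda>\<zeta>. grid_sum \<sigma> \<tau> N p \<zeta> * grid_sum \<sigma> \<tau> N q \<zeta>)"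
    unfolding expand by (intro Bochner_Integration.integrable_sum integrable_mult_right int_e)
  have "(\<integral>\<zeta>. grid_sum \<sigma> \<tau> N p \<zeta> * grid_sum \<sigma> \<tau> N q \<zeta> \<partial>torus_measure)
    = (\<Sum>\<alpha>\<in>?A. \<Sum>\<beta>\<in>?A. \<Sum>\<alpha>'\<in>?A. \<Sum>\<beta>'\<in>?A. c \<alpha> \<alpha>' \<beta> \<beta>' * (\<integral>\<zeta>. e \<alpha> \<alpha>' \<beta> \<beta>' \<zeta> \<partial>torus_measure))"
    unfolding expand using int_e
    by (simp add: Bochner_Integration.integral_sum Bochner_Integration.integrable_sum)
  also have "\<dots> = bidyadic.pairing N p (overlap_op \<sigma> \<tau> N q)"
    unfolding bidyadic.pairing_def overlap_op_def e_eq c_def node_overlap_def sum_distrib_left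
    by (intro sum.cong refl) (simp add: mult_ac)
  finally show "(\<integral>\<zeta>. grid_sum \<sigma> \<tau> N p \<zeta> * grid_sum \<sigma> \<tau> N q \<zeta> \<partial>torus_measure) = bidyadic.pairing N p (overlap_op \<sigma> \<tau> N q)" .
qed

lemma nn_integral_grid_sum_mult:
  assumes "bidyadic.nonneg N p" "bidyadic.nonneg N q"
  shows "(\<integral>\<^sup>+ \<zeta>. ennreal (grid_sum \<sigma> \<tau> N p \<zeta>) * ennreal (grid_sum \<sigma> \<tau> N q \<zeta>) \<partial>torus_measure)
    = ennreal (bidyadic.pairing N p (overlap_op \<sigma> \<tau> N q))"
  unfolding integral_grid_sum_mult(1)[symmetric] 
  using integral_grid_sum_mult(2)[of \<sigma> \<tau> N p q] grid_sum_nonneg[OF assms(1)] grid_sum_nonneg[OF assms(2)]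
  by (subst nn_integral_eq_integral[symmetric]) (auto simp: ennreal_mult)

text \<open>The Gram matrix has nonnegative entries and ones on the diagonal.\<close>

lemma pairing_self_le_overlap:
  assumes p: "bidyadic.nonneg N p"
  shows "bidyadic.pairing N p p \<le> bidyadic.pairing N p (overlap_op \<sigma> \<tau> N p)"
proof (rule bidyadic.pairing_mono, rule mult_left_mono)
  fix a b assume ab: "a \<in> dyadic_nodes N" "b \<in> dyadic_nodes N"
  have nn: "0 \<le> node_overlap \<sigma> a a' * node_overlap \<tau> b b' * p a' b'" if "a' \<in> dyadic_nodes N" "b' \<in> dyadic_nodes N" for a' b'
    using node_overlap_nonneg p that by (simp add: bidyadic.nonneg_def)
  have "p a b = node_overlap \<sigma> a a * node_overlap \<tau> b b * p a b"
    using ab by (simp add: node_overlap_self)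
  also have "\<dots> \<le> (\<Sum>b'\<in>dyadic_nodes N. node_overlap \<sigma> a a * node_overlap \<tau> b b' * p a b')"
    using ab nn finite_dyadic_nodes by (intro member_le_sum[of b _ "\<lambda>b'. node_overlap \<sigma> a a * node_overlap \<tau> b b' * p a b'"]) auto
  also have "\<dots> \<le> overlap_op \<sigma> \<tau> N p a b"
    unfolding overlap_op_def using ab nn finite_dyadic_nodes
    by (intro member_le_sum[of a _ "\<lambda>a'. \<Sum>b'\<in>dyadic_nodes N. node_overlap \<sigma> a a' * node_overlap \<tau> b b' * p a' b'"])
       (auto intro!: sum_nonneg)
  finally show "p a b \<le> overlap_op \<sigma> \<tau> N p a b" .
  show "0 \<le> p a b" using p ab by (simp add: bidyadic.nonneg_def)
qed

lemma overlap_op_nonneg: "bidyadic.nonneg N p \<Longrightarrow> bidyadic.nonneg N (overlap_op \<sigma> \<tau> N p)"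
  unfolding bidyadic.nonneg_def overlap_op_def
  by (auto intro!: sum_nonneg mult_nonneg_nonneg node_overlap_nonneg)

text \<open>The product of the two grid kernels is itself a grid sum, namely for the indicator of the ancestors of \<open>(x, y)\<close>; pairing it with
\<open>p\<close> yields the Hardy operator applied to \<open>overlap_op p\<close>.\<close>

lemma potential_grid_sum_ge:
  assumes p: "bidyadic.nonneg N p" and xy: "x \<in> dyadic_nodes N" "y \<in> dyadic_nodes N"
    and u: "u \<in> grid_arc \<sigma> x" and v: "v \<in> grid_arc \<tau> y"
  shows "ennreal (bidyadic.hardy N (overlap_op \<sigma> \<tau> N p) x y / 144) \<le> potential (\<lambda>\<zeta>. ennreal (grid_sum \<sigma> \<tau> N p \<zeta>)) (u, v)"
proof -
  define q where "q \<alpha> \<beta> = (of_bool (\<alpha> \<in> dyadic.up N x) * of_bool (\<beta> \<in> dyadic.up N y) / 144 :: real)" for \<alpha> \<beta>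
  have q: "bidyadic.nonneg N q" by (simp add: bidyadic.nonneg_def q_def)
  have gk: "grid_sum \<sigma> \<tau> N q \<zeta> = (grid_kernel \<sigma> N x (fst \<zeta>) / 12) * (grid_kernel \<tau> N y (snd \<zeta>) / 12)" for \<zeta>
  proof -
    have "grid_kernel \<sigma> N x (fst \<zeta>) = (\<Sum>\<alpha>\<in>dyadic_nodes N. of_bool (\<alpha> \<in> dyadic.up N x) * (node_weight \<alpha> * indicator (grid_cell \<sigma> \<alpha>) (fst \<zeta>)))"
      unfolding grid_kernel_def using finite_dyadic_nodes dyadic.up_sub
      by (intro sum.mono_neutral_cong_left) auto
    moreover have "grid_kernel \<tau> N y (snd \<zeta>) = (\<Sum>\<beta>\<in>dyadic_nodes N. of_bool (\<beta> \<in> dyadic.up N y) * (node_weight \<beta> * indicator (grid_cell \<tau> \<beta>) (snd \<zeta>)))"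
      unfolding grid_kernel_def using finite_dyadic_nodes dyadic.up_sub
      by (intro sum.mono_neutral_cong_left) auto
    ultimately show ?thesis
      by (simp add: grid_sum_def q_def sum_product sum_divide_distrib mult_ac)
  qed
  have "bidyadic.hardy N (overlap_op \<sigma> \<tau> N p) x y / 144 = bidyadic.pairing N q (overlap_op \<sigma> \<tau> N p)"
  proof -
    have "bidyadic.pairing N q (overlap_op \<sigma> \<tau> N p)
      = (\<Sum>a\<in>dyadic.up N x. \<Sum>b\<in>dyadic_nodes N. q a b * overlap_op \<sigma> \<tau> N p a b)"
      unfolding bidyadic.pairing_def using finite_dyadic_nodes dyadic.up_sub
      by (intro sum.mono_neutral_right) (auto simp: q_def)
    also have "\<dots> = (\<Sum>a\<in>dyadic.up N x. \<Sum>b\<in>dyadic.up N y. overlap_op \<sigma> \<tau> N p a b / 144)"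
      using finite_dyadic_nodes dyadic.up_sub
      by (intro sum.cong refl sum.mono_neutral_cong_right) (auto simp: q_def)
    finally show ?thesis by (simp add: bidyadic.hardy_def sum_divide_distrib)
  qed
  then have "ennreal (bidyadic.hardy N (overlap_op \<sigma> \<tau> N p) x y / 144)
     = (\<integral>\<^sup>+ \<zeta>. ennreal (grid_sum \<sigma> \<tau> N q \<zeta>) * ennreal (grid_sum \<sigma> \<tau> N p \<zeta>) \<partial>torus_measure)"
    by (simp add: nn_integral_grid_sum_mult[OF q p])
  also have "\<dots> \<le> potential (\<lambda>\<zeta>. ennreal (grid_sum \<sigma> \<tau> N p \<zeta>)) (u, v)"
    unfolding potential_def potential_kernel_eq
  proof (rule nn_integral_mono_AE, use AE_torus_norm in eventually_elim)
    case (elim \<zeta>)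
    have "ennreal (grid_sum \<sigma> \<tau> N q \<zeta>) = ennreal (grid_kernel \<sigma> N x (fst \<zeta>) / 12) * ennreal (grid_kernel \<tau> N y (snd \<zeta>) / 12)"
      unfolding gk using grid_kernel_nonneg by (intro ennreal_mult) auto
    also have "\<dots> \<le> riesz_kernel u (fst \<zeta>) * riesz_kernel v (snd \<zeta>)"
      using elim by (intro mult_mono grid_kernel_le_riesz_kernel xy u v) auto
    finally show ?case by (auto intro: mult_right_mono)
  qed
  finally show ?thesis .
qed

context bidisc_measure
begin

section \<open>From the capacity condition to the restricted energy condition\<close>

text \<open>All estimates on the trees see \<open>\<mu>\<close> only through the masses of the sets of points with a given pair of leaves.\<close>

definition leaf_cell :: "real \<Rightarrow> real \<Rightarrow> nat \<Rightarrow> nat \<times> int \<Rightarrow> nat \<times> int \<Rightarrow> (complex \<times> complex) set" where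
  "leaf_cell \<sigma> \<tau> N x y = {z \<in> space \<mu>. leaf \<sigma> N (fst z) = x \<and> leaf \<tau> N (snd z) = y}"

definition cell_mass :: "real \<Rightarrow> real \<Rightarrow> nat \<Rightarrow> nat \<times> int \<Rightarrow> nat \<times> int \<Rightarrow> real" where
  "cell_mass \<sigma> \<tau> N x y = measure \<mu> (leaf_cell \<sigma> \<tau> N x y)"

lemma leaf_cell_sets [measurable]:
  "(leaf_cell \<sigma> \<tau> N x y) \<in> sets \<mu>"
proof -
  have "(leaf_cell \<sigma> \<tau> N x y) = {z \<in> space \<mu>.
      (fst x \<le> N \<and> 1 - norm (fst z) \<le> (1/2) ^ fst x
    \<and> (Suc (fst x) \<le> N \<longrightarrow> \<not> 1 - norm (fst z) \<le> (1/2) ^ Suc (fst x)) \<and> grid_index \<sigma> (fst x) (fst z) = snd x) \<and>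
      (fst y \<le> N \<and> 1 - norm (snd z) \<le> (1/2) ^ fst y
    \<and> (Suc (fst y) \<le> N \<longrightarrow> \<not> 1 - norm (snd z) \<le> (1/2) ^ Suc (fst y)) \<and> grid_index \<tau> (fst y) (snd z) = snd y)}"
    unfolding leaf_cell_def using in_bidisc leaf_eq_iff by blast
  also have "\<dots> \<in> sets \<mu>" unfolding grid_index_eq_iff by measurable
  finally show ?thesis .
qed

lemma cell_mass_nonneg: "bidyadic.nonneg N (cell_mass \<sigma> \<tau> N)"
  by (simp add: bidyadic.nonneg_def cell_mass_def)

lemma mass_restr_cell_mass:
  assumes F: "F \<subseteq> dyadic_nodes N \<times> dyadic_nodes N"
  shows "bidyadic.mass N (bidyadic.restr F (cell_mass \<sigma> \<tau> N))
    = measure \<mu> {z \<in> space \<mu>. (leaf \<sigma> N (fst z), leaf \<tau> N (snd z)) \<in> F}"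
proof -
  define c where "c p = leaf_cell \<sigma> \<tau> N (fst p) (snd p)" for p
  have fin: "finite F" using F finite_dyadic_nodes by (meson finite_SigmaI finite_subset)
  have "bidyadic.mass N (bidyadic.restr F (cell_mass \<sigma> \<tau> N))
     = (\<Sum>p\<in>dyadic_nodes N \<times> dyadic_nodes N. if p \<in> F then measure \<mu> (c p) else 0)"
    unfolding bidyadic.mass_def bidyadic.pairing_def sum.cartesian_product
    by (intro sum.cong refl) (auto simp: bidyadic.restr_def cell_mass_def c_def)
  also have "\<dots> = (\<Sum>p\<in>F. measure \<mu> (c p))"
    using F finite_dyadic_nodes by (intro sum.mono_neutral_cong_right) auto
  also have "\<dots> = measure \<mu> (\<Union>p\<in>F. c p)"
  proof (rule finite_measure_finite_Union[OF fin, symmetric])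
    show "c ` F \<subseteq> sets \<mu>" by (auto simp: c_def simp del: split_paired_All)
    show "disjoint_family_on c F" by (auto simp: c_def leaf_cell_def disjoint_family_on_def prod_eq_iff)
  qed
  also have "(\<Union>p\<in>F. c p) = {z \<in> space \<mu>. (leaf \<sigma> N (fst z), leaf \<tau> N (snd z)) \<in> F}"
    by (auto simp: c_def leaf_cell_def)
  finally show ?thesis .
qed

text \<open>The set where the tree potential exceeds \<open>l\<close> is a union of leaf cells. These lie in the boxes over the arcs of
the leaves, and on these arcs \<open>144 / l\<close> times the grid sum has potential at least \<open>1\<close>, so it is a
test function for the capacity.\<close>

lemma cell_mass_weak_type:
  assumes C: "C > 0" and cap: "capacity_bound \<mu> C" and p: "bidyadic.nonneg N p" and l: "l > 0"
  shows "bidyadic.mass N (bidyadic.restr {(x, y). l < bidyadic.hardy N (overlap_op \<sigma> \<tau> N p) x y} (cell_mass \<sigma> \<tau> N))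
    \<le> 20736 * C * bidyadic.pairing N p (overlap_op \<sigma> \<tau> N p) / l\<^sup>2"
proof -
  let ?A = "dyadic_nodes N"
  define v where "v = bidyadic.hardy N (overlap_op \<sigma> \<tau> N p)"
  define H where "H = bidyadic.pairing N p (overlap_op \<sigma> \<tau> N p)"
  have H0: "0 \<le> H" unfolding H_def by (intro bidyadic.pairing_nonneg p overlap_op_nonneg)
  define X where "X = {(x, y) \<in> ?A \<times> ?A. l < v x y}"
  have X: "X \<subseteq> ?A \<times> ?A" "finite X"
    using finite_dyadic_nodes by (auto simp: X_def intro: finite_subset[of _ "?A \<times> ?A"])
  have "bidyadic.mass N (bidyadic.restr {(x, y). l < v x y} (cell_mass \<sigma> \<tau> N)) = bidyadic.mass N (bidyadic.restr X (cell_mass \<sigma> \<tau> N))"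
    unfolding bidyadic.mass_def bidyadic.pairing_def by (intro sum.cong refl) (auto simp: bidyadic.restr_def X_def)
  also have "\<dots> = measure \<mu> {z \<in> space \<mu>. (leaf \<sigma> N (fst z), leaf \<tau> N (snd z)) \<in> X}" (is "_ = measure \<mu> ?Z")
    by (rule mass_restr_cell_mass[OF X(1)])
  also have "\<dots> \<le> 20736 * C * H / l\<^sup>2"
  proof (cases "X = {}")
    case True
    then show ?thesis using C H0 by simp
  next
    case False
    define n where "n = card X"
    have n: "1 \<le> n" using False X(2) by (simp add: n_def Suc_le_eq card_gt_0_iff)
    obtain f where f: "bij_betw f {1..n} X" using ex_bij_betw_nat_finite_1[OF X(2)] by (auto simp: n_def)
    have fX: "f ` {1..n} = X" using f by (simp add: bij_betw_def)
    define J1 J2 where "J1 k = grid_arc \<sigma> (fst (f k))" and "J2 k = grid_arc \<tau> (snd (f k))" for k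
    let ?S = "\<Union>k\<in>{1..n}. carleson_box (J1 k) \<times> carleson_box (J2 k)" and ?E = "\<Union>k\<in>{1..n}. J1 k \<times> J2 k"
    have comp: "compact (carleson_box (grid_arc s x))" for s x
      unfolding grid_arc_def by (rule compact_carleson_box[OF grid_arc_interval(1) grid_arc_interval_le])
    have "closed ?S" by (intro closed_UN) (auto intro!: compact_imp_closed compact_Times comp simp: J1_def J2_def)
    moreover have "?S \<subseteq> closed_bidisc"
      unfolding J1_def J2_def grid_arc_def carleson_box_eq[OF grid_arc_interval(1) grid_arc_interval_le] by auto
    ultimately have S: "?S \<in> sets \<mu>" by (intro borel_sets_\<mu> borel_closed)
    have sub: "?Z \<subseteq> ?S"
    proof
      fix z assume z: "z \<in> ?Z"
      then have zn: "norm (fst z) \<le> 1" "norm (snd z) \<le> 1" using in_bidisc by auto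
      have "(leaf \<sigma> N (fst z), leaf \<tau> N (snd z)) \<in> f ` {1..n}" using z unfolding fX by simp
      then obtain k where k: "(leaf \<sigma> N (fst z), leaf \<tau> N (snd z)) = f k" "k \<in> {1..n}" by (rule imageE)
      have "z \<in> carleson_box (J1 k) \<times> carleson_box (J2 k)"
        using in_carleson_box_leaf[OF zn(1)] in_carleson_box_leaf[OF zn(2)]
        by (cases z) (simp add: J1_def J2_def k(1)[symmetric])
      then show "z \<in> ?S" using k(2) by (rule UN_I[rotated])
    qed
    define h where "h \<zeta> = ennreal (144 / l) * ennreal (grid_sum \<sigma> \<tau> N p \<zeta>)" for \<zeta>
    have h[measurable]: "h \<in> borel_measurable torus_measure" unfolding h_def by measurable
    have pot: "1 \<le> potential h z" if z: "z \<in> ?E" for z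
    proof -
      from z obtain k where k: "k \<in> {1..n}" "fst z \<in> J1 k" "snd z \<in> J2 k" by auto
      have "f k \<in> X" using imageI[OF k(1), of f] unfolding fX .
      then have xy: "fst (f k) \<in> ?A" "snd (f k) \<in> ?A" and lv: "l < v (fst (f k)) (snd (f k))" by (auto simp: X_def)
      have "ennreal (v (fst (f k)) (snd (f k)) / 144) \<le> potential (\<lambda>\<zeta>. ennreal (grid_sum \<sigma> \<tau> N p \<zeta>)) (fst z, snd z)"
        unfolding v_def using k by (intro potential_grid_sum_ge p xy) (auto simp: J1_def J2_def)
      then have "ennreal (144 / l) * ennreal (v (fst (f k)) (snd (f k)) / 144) \<le> ennreal (144 / l) * potential (\<lambda>\<zeta>. ennreal (grid_sum \<sigma> \<tau> N p \<zeta>)) z"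
        by (intro mult_left_mono) auto
      also have "\<dots> = potential h z"
        unfolding potential_def h_def potential_kernel_eq
        by (subst nn_integral_cmult[symmetric]) (auto simp: mult_ac)
      also have "ennreal (144 / l) * ennreal (v (fst (f k)) (snd (f k)) / 144) = ennreal (144 / l * (v (fst (f k)) (snd (f k)) / 144))"
        using l lv by (intro ennreal_mult[symmetric]) auto
      finally have "ennreal (144 / l * (v (fst (f k)) (snd (f k)) / 144)) \<le> potential h z" .
      moreover have "1 \<le> 144 / l * (v (fst (f k)) (snd (f k)) / 144)" using l lv by simp
      ultimately show ?thesis by (metis ennreal_1 ennreal_leI order_trans)
    qed
    have "ennreal (measure \<mu> ?Z) = emeasure \<mu> ?Z" by (simp add: emeasure_eq_measure)
    also have "\<dots> \<le> emeasure \<mu> ?S" by (rule emeasure_mono[OF sub S])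
    also have "\<dots> \<le> ennreal C * capacity ?E"
      using cap n unfolding capacity_bound_def by (auto simp: J1_def J2_def grid_arc_in_circle_arcs)
    also have "\<dots> \<le> ennreal C * (\<integral>\<^sup>+ \<zeta>. (h \<zeta>)\<^sup>2 \<partial>torus_measure)"
      unfolding capacity_def using pot by (intro mult_left_mono INF_lower) auto
    also have "(\<integral>\<^sup>+ \<zeta>. (h \<zeta>)\<^sup>2 \<partial>torus_measure)
       = (\<integral>\<^sup>+ \<zeta>. ennreal ((144 / l)\<^sup>2) * (ennreal (grid_sum \<sigma> \<tau> N p \<zeta>) * ennreal (grid_sum \<sigma> \<tau> N p \<zeta>)) \<partial>torus_measure)"
    proof (intro nn_integral_cong)
      fix \<zeta>
      have "ennreal ((144 / l)\<^sup>2) = (ennreal (144 / l))\<^sup>2" using l by (intro ennreal_power[symmetric]) auto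
      then show "(h \<zeta>)\<^sup>2 = ennreal ((144 / l)\<^sup>2) * (ennreal (grid_sum \<sigma> \<tau> N p \<zeta>) * ennreal (grid_sum \<sigma> \<tau> N p \<zeta>))"
        by (simp only: h_def power_mult_distrib power2_eq_square mult_ac)
    qed
    also have "\<dots> = ennreal ((144 / l)\<^sup>2) * ennreal H"
      unfolding H_def nn_integral_grid_sum_mult[OF p p, symmetric] by (rule nn_integral_cmult) measurable
    also have "ennreal C * (ennreal ((144 / l)\<^sup>2) * ennreal H) = ennreal (C * ((144 / l)\<^sup>2 * H))"
      using C H0 by (simp add: ennreal_mult)
    finally have "measure \<mu> ?Z \<le> C * ((144 / l)\<^sup>2 * H)"
      using C H0 by (subst (asm) ennreal_le_iff) auto
    then show ?thesis by (simp add: power_divide mult_ac)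
  qed
  finally show ?thesis by (simp add: v_def H_def)
qed

text \<open>The dual of the weak-type inequality. The grid sum is formed with the potential data of \<open>\<mu>\<close> on \<open>F\<close> itself, so that its
square norm \<open>H\<close> equals the integral over \<open>F\<close> of the tree potential, which the weak-type inequality with constant
\<open>20736 * C = 144\<^sup>2 * C\<close> bounds by \<open>t * \<mu>(F)\<close> plus a multiple of \<open>H / t\<close>.\<close>

lemma capacity_imp_restricted_energy_bound:
  assumes C: "C > 0" and cap: "capacity_bound \<mu> C"
  shows "bidyadic.restricted_energy_bound N (cell_mass \<sigma> \<tau> N) (331776 * C)"
  unfolding bidyadic.restricted_energy_bound_def
proof (intro allI impI)
  fix F assume F: "F \<subseteq> dyadic_nodes N \<times> dyadic_nodes N"
  define \<nu> where "\<nu> = bidyadic.restr F (cell_mass \<sigma> \<tau> N)"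
  define p where "p = bidyadic.hardy_adj N \<nu>"
  have \<nu>: "bidyadic.nonneg N \<nu>" unfolding \<nu>_def by (intro bidyadic.restr_nonneg cell_mass_nonneg)
  have p: "bidyadic.nonneg N p" unfolding p_def by (intro bidyadic.hardy_adj_nonneg \<nu>)
  define H where "H = bidyadic.pairing N p (overlap_op \<sigma> \<tau> N p)"
  have H0: "0 \<le> H" unfolding H_def by (intro bidyadic.pairing_nonneg p overlap_op_nonneg)
  have "H = bidyadic.pairing N \<nu> (bidyadic.hardy N (overlap_op \<sigma> \<tau> N p))"
    unfolding H_def p_def bidyadic.pairing_commute[of _ \<nu>] bidyadic.pairing_hardy
    by (rule bidyadic.pairing_commute)
  \<comment> \<open>The choice \<open>t = 8 * 20736 * C\<close> turns the last term into \<open>H / 2\<close>.\<close>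
  also have "\<dots> \<le> (165888 * C) * bidyadic.mass N \<nu> + 4 * (20736 * C * H) / (165888 * C)"
    unfolding \<nu>_def using C H0 cell_mass_weak_type[OF C cap p]
    by (intro bidyadic.weak_type_imp_pairing_le cell_mass_nonneg) (auto simp: H_def)
  also have "4 * (20736 * C * H) / (165888 * C) = H / 2" using C by simp
  finally have "H \<le> 331776 * C * bidyadic.mass N \<nu>" by simp
  moreover have "bidyadic.pairing N p p \<le> H" unfolding H_def by (rule pairing_self_le_overlap[OF p])
  ultimately show "bidyadic.pairing N (bidyadic.hardy_adj N (bidyadic.restr F (cell_mass \<sigma> \<tau> N))) (bidyadic.hardy_adj N (bidyadic.restr F (cell_mass \<sigma> \<tau> N)))
      \<le> 331776 * C * bidyadic.mass N (bidyadic.restr F (cell_mass \<sigma> \<tau> N))"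
    by (simp add: p_def \<nu>_def)
qed

section \<open>The tree energy of a density\<close>

definition cell_integral :: "real \<Rightarrow> real \<Rightarrow> nat \<Rightarrow> (complex \<times> complex \<Rightarrow> real) \<Rightarrow> nat \<times> int \<Rightarrow> nat \<times> int \<Rightarrow> real" where
  "cell_integral \<sigma> \<tau> N f x y = (\<integral>z. f z * indicator (leaf_cell \<sigma> \<tau> N x y) z \<partial>\<mu>)"

lemma integrable_cell:
  assumes [measurable]: "f \<in> borel_measurable \<mu>" and f: "\<And>z. z \<in> space \<mu> \<Longrightarrow> 0 \<le> f z \<and> f z \<le> (B::real)"
  shows "integrable \<mu> (\<lambda>z. f z * indicator (leaf_cell \<sigma> \<tau> N x y) z)"
  using f by (intro integrable_bounded[of _ B]) (force simp: indicator_def)+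

text \<open>The Cauchy--Schwarz inequality on one cell, obtained by expanding the variance of \<open>f\<close> about its mean \<open>q / m\<close>.\<close>

lemma cell_integral_square_le:
  fixes \<sigma> \<tau> :: real and N :: nat and x y :: "nat \<times> int"
  assumes [measurable]: "f \<in> borel_measurable \<mu>" and f: "\<And>z. z \<in> space \<mu> \<Longrightarrow> 0 \<le> f z \<and> f z \<le> (B::real)"
  defines "q \<equiv> cell_integral \<sigma> \<tau> N f x y"
  defines "m \<equiv> cell_mass \<sigma> \<tau> N x y"
  shows "0 \<le> q" and "m = 0 \<Longrightarrow> q = 0" and "q\<^sup>2 / m \<le> cell_integral \<sigma> \<tau> N (\<lambda>z. (f z)\<^sup>2) x y"
proof -
  define c where "c = (leaf_cell \<sigma> \<tau> N x y)"
  have c[measurable]: "c \<in> sets \<mu>" unfolding c_def by measurable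
  have B0: "0 \<le> B" if "z \<in> space \<mu>" for z using f[OF that] by linarith
  have int: "integrable \<mu> (\<lambda>z. f z * indicator c z)" 
    unfolding c_def by (rule integrable_cell[OF assms(1) f])
  have f2: "0 \<le> (f z)\<^sup>2 \<and> (f z)\<^sup>2 \<le> B\<^sup>2" if "z \<in> space \<mu>" for z
    using f[OF that] by (auto intro: power_mono)
  have int2: "integrable \<mu> (\<lambda>z. (f z)\<^sup>2 * indicator c z)"
    unfolding c_def by (rule integrable_cell[OF _ f2]) measurable
  have q: "q = (\<integral>z. f z * indicator c z \<partial>\<mu>)" by (simp add: q_def cell_integral_def c_def)
  have m: "m = (\<integral>z. indicator c z \<partial>\<mu>)" "m = measure \<mu> c" using c by (simp_all add: m_def cell_mass_def c_def)
  show q0: "0 \<le> q" unfolding q using f by (intro integral_nonneg_AE AE_I2) auto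
  have "q \<le> (\<integral>z. B * indicator c z \<partial>\<mu>)"
    unfolding q using f int B0 by (intro integral_mono integrable_bounded[of _ B]) (auto simp: indicator_def)
  then have "q \<le> B * m" using m by simp
  then show m0: "q = 0" if "m = 0" using q0 that by simp
  show "q\<^sup>2 / m \<le> cell_integral \<sigma> \<tau> N (\<lambda>z. (f z)\<^sup>2) x y"
  proof (cases "m = 0")
    case True
    have "0 \<le> cell_integral \<sigma> \<tau> N (\<lambda>z. (f z)\<^sup>2) x y"
      unfolding cell_integral_def by (intro integral_nonneg_AE AE_I2) auto
    then show ?thesis using True by simp
  next
    case False
    then have mpos: "m > 0" using m(2) measure_nonneg[of \<mu> c] by linarith
    have "0 \<le> (\<integral>z. (f z - q / m)\<^sup>2 * indicator c z \<partial>\<mu>)" by (intro integral_nonneg_AE AE_I2) auto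
    also have "\<dots> = (\<integral>z. (f z)\<^sup>2 * indicator c z - 2 * (q / m) * (f z * indicator c z) + (q / m)\<^sup>2 * indicator c z \<partial>\<mu>)"
      by (intro Bochner_Integration.integral_cong refl) (simp add: power2_eq_square algebra_simps)
    also have "\<dots> = (\<integral>z. (f z)\<^sup>2 * indicator c z \<partial>\<mu>) - 2 * (q / m) * q + (q / m)\<^sup>2 * m"
      unfolding q m(1) using int int2 by (simp add: emeasure_eq_measure)
    also have "\<dots> = cell_integral \<sigma> \<tau> N (\<lambda>z. (f z)\<^sup>2) x y - q\<^sup>2 / m"
      using mpos by (simp add: cell_integral_def c_def power2_eq_square field_simps)
    finally show ?thesis by simp
  qed
qed

lemma sum_cell_integral:
  assumes [measurable]: "f \<in> borel_measurable \<mu>" and f: "\<And>z. z \<in> space \<mu> \<Longrightarrow> 0 \<le> f z \<and> f z \<le> (B::real)"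
    and X: "finite X" "finite Y"
  shows "(\<Sum>x\<in>X. \<Sum>y\<in>Y. cell_integral \<sigma> \<tau> N f x y)
    = (\<integral>z. f z * of_bool (leaf \<sigma> N (fst z) \<in> X \<and> leaf \<tau> N (snd z) \<in> Y) \<partial>\<mu>)"
proof -
  have "(\<Sum>x\<in>X. \<Sum>y\<in>Y. cell_integral \<sigma> \<tau> N f x y)
    = (\<integral>z. (\<Sum>x\<in>X. \<Sum>y\<in>Y. f z * indicator (leaf_cell \<sigma> \<tau> N x y) z) \<partial>\<mu>)"
    unfolding cell_integral_def using integrable_cell[OF assms(1) f]
    by (simp add: Bochner_Integration.integral_sum Bochner_Integration.integrable_sum)
  also have "\<dots> = (\<integral>z. f z * of_bool (leaf \<sigma> N (fst z) \<in> X \<and> leaf \<tau> N (snd z) \<in> Y) \<partial>\<mu>)"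
  proof (intro Bochner_Integration.integral_cong refl)
    fix z assume z: "z \<in> space \<mu>"
    have "(\<Sum>x\<in>X. \<Sum>y\<in>Y. f z * indicator (leaf_cell \<sigma> \<tau> N x y) z)
       = (\<Sum>x\<in>X. if leaf \<sigma> N (fst z) = x then (\<Sum>y\<in>Y. if leaf \<tau> N (snd z) = y then f z else 0) else 0)"
      using z by (intro sum.cong refl) (auto simp: indicator_def leaf_cell_def intro!: sum.cong)
    also have "\<dots> = f z * of_bool (leaf \<sigma> N (fst z) \<in> X \<and> leaf \<tau> N (snd z) \<in> Y)"
      using X by (simp add: sum.delta')
    finally show "(\<Sum>x\<in>X. \<Sum>y\<in>Y. f z * indicator (leaf_cell \<sigma> \<tau> N x y) z)
       = f z * of_bool (leaf \<sigma> N (fst z) \<in> X \<and> leaf \<tau> N (snd z) \<in> Y)" .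
  qed
  finally show ?thesis .
qed

text \<open>The dual embedding on the product of the two trees, applied to the mean values of \<open>f\<close> on the leaf cells.
The constant is the product of those of \<open>bitree_embedding\<close>, \<open>49152\<close>, and of the
restricted energy condition, \<open>331776\<close>.\<close>

lemma tree_energy_le:
  assumes C: "C > 0" and cap: "capacity_bound \<mu> C"
    and fm[measurable]: "f \<in> borel_measurable \<mu>" and f: "\<And>z. z \<in> space \<mu> \<Longrightarrow> 0 \<le> f z \<and> f z \<le> (B::real)"
  shows "(\<Sum>\<alpha>\<in>dyadic_nodes N. \<Sum>\<beta>\<in>dyadic_nodes N.
      (\<integral>z. f z * of_bool (dyadic_le (leaf \<sigma> N (fst z)) \<alpha> \<and> dyadic_le (leaf \<tau> N (snd z)) \<beta>) \<partial>\<mu>)\<^sup>2)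
    \<le> 16307453952 * C * (\<integral>z. (f z)\<^sup>2 \<partial>\<mu>)"
proof -
  let ?A = "dyadic_nodes N"
  define q where "q = cell_integral \<sigma> \<tau> N f"
  define m where "m = cell_mass \<sigma> \<tau> N"
  define g where "g x y = q x y / m x y" for x y
  have q0: "0 \<le> q x y" and qm: "m x y = 0 \<Longrightarrow> q x y = 0" 
    and q2: "(q x y)\<^sup>2 / m x y \<le> cell_integral \<sigma> \<tau> N (\<lambda>z. (f z)\<^sup>2) x y" for x y
    unfolding q_def m_def using cell_integral_square_le[OF fm f] by blast+
  have m0: "0 \<le> m x y" for x y by (simp add: m_def cell_mass_def)
  have g: "bidyadic.nonneg N g" using q0 m0 by (simp add: bidyadic.nonneg_def g_def)
  have mg: "(\<lambda>x y. m x y * g x y) = q" using qm by (auto simp: fun_eq_iff g_def)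
  have adj: "bidyadic.hardy_adj N q \<alpha> \<beta> = (\<integral>z. f z * of_bool (dyadic_le (leaf \<sigma> N (fst z)) \<alpha> \<and> dyadic_le (leaf \<tau> N (snd z)) \<beta>) \<partial>\<mu>)" for \<alpha> \<beta>
  proof -
    have "bidyadic.hardy_adj N q \<alpha> \<beta> = (\<integral>z. f z * of_bool (leaf \<sigma> N (fst z) \<in> dyadic.dn N \<alpha> \<and> leaf \<tau> N (snd z) \<in> dyadic.dn N \<beta>) \<partial>\<mu>)"
      unfolding bidyadic.hardy_adj_def q_def by (intro sum_cell_integral[OF fm f]) auto
    also have "\<dots> = (\<integral>z. f z * of_bool (dyadic_le (leaf \<sigma> N (fst z)) \<alpha> \<and> dyadic_le (leaf \<tau> N (snd z)) \<beta>) \<partial>\<mu>)"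
      using in_bidisc leaf_in_nodes by (intro Bochner_Integration.integral_cong refl) (auto simp: dyadic.dn_def)
    finally show ?thesis .
  qed
  have f2: "0 \<le> (f z)\<^sup>2 \<and> (f z)\<^sup>2 \<le> B\<^sup>2" if "z \<in> space \<mu>" for z
    using f[OF that] by (auto intro: power_mono)
  have f2m: "(\<lambda>z. (f z)\<^sup>2) \<in> borel_measurable \<mu>" by measurable
  have "bidyadic.pairing N (bidyadic.hardy_adj N q) (bidyadic.hardy_adj N q) \<le> 49152 * (331776 * C) * bidyadic.pairing N m (\<lambda>a b. (g a b)\<^sup>2)"
    unfolding mg[symmetric]
    using bidyadic.bitree_dual_embedding[OF cell_mass_nonneg _ capacity_imp_restricted_energy_bound[OF C cap] g] C
    unfolding m_def by simp
  also have "bidyadic.pairing N m (\<lambda>a b. (g a b)\<^sup>2) \<le> (\<Sum>x\<in>?A. \<Sum>y\<in>?A. cell_integral \<sigma> \<tau> N (\<lambda>z. (f z)\<^sup>2) x y)"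
    unfolding bidyadic.pairing_def
  proof (intro sum_mono)
    fix x y
    have "m x y * (g x y)\<^sup>2 = (q x y)\<^sup>2 / m x y" by (simp add: g_def power2_eq_square)
    then show "m x y * (g x y)\<^sup>2 \<le> cell_integral \<sigma> \<tau> N (\<lambda>z. (f z)\<^sup>2) x y" using q2[of x y] by simp
  qed
  also have "\<dots> = (\<integral>z. (f z)\<^sup>2 * of_bool (leaf \<sigma> N (fst z) \<in> ?A \<and> leaf \<tau> N (snd z) \<in> ?A) \<partial>\<mu>)"
    by (intro sum_cell_integral[OF f2m f2] finite_dyadic_nodes)
  also have "\<dots> = (\<integral>z. (f z)\<^sup>2 \<partial>\<mu>)"
    using in_bidisc leaf_in_nodes by (intro Bochner_Integration.integral_cong refl) auto
  finally show ?thesis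
    using C by (simp add: bidyadic.pairing_def adj power2_eq_square)
qed

end

section \<open>Two shifted grids dominate the logarithmic kernel\<close>

text \<open>A weak form of Jordan's inequality: the mean value theorem is used up to \<open>pi / 3\<close> and monotonicity
beyond.\<close>

lemma sin_ge_div_pi:
  assumes "0 \<le> x" "x \<le> pi / 2"
  shows "x / pi \<le> sin x"
proof (cases "x \<le> pi / 3")
  case True
  show ?thesis
  proof (cases "x = 0")
    case False
    then have "0 < x" using assms by simp
    then obtain y where y: "0 < y" "y < x" "sin x - sin 0 = (x - 0) * cos y"
      using MVT2[of 0 x sin cos] by (auto intro: derivative_eq_intros)
    have "cos (pi / 3) \<le> cos y" using y True by (intro cos_monotone_0_pi_le) auto
    then have "1 / 2 \<le> cos y" by (simp add: cos_60)
    then have "x * (1 / 2) \<le> x * cos y" using assms by (intro mult_left_mono)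
    then have "x / 2 \<le> sin x" using y by simp
    moreover have "x / pi \<le> x / 2" using assms pi_ge_two by (intro divide_left_mono) auto
    ultimately show ?thesis by linarith
  qed simp
next
  case False
  have "x / pi \<le> 1 / 2" using assms pi_gt_zero by (simp add: field_simps)
  also have "\<dots> \<le> sin (pi / 3)" by (simp add: sin_60 real_le_rsqrt)
  also have "\<dots> \<le> sin x" using False assms by (intro sin_monotone_2pi_le) auto
  finally show ?thesis .
qed

text \<open>The distance of \<open>1\<close> from the ray through \<open>u\<close> is the modulus of the sine if the angle is acute and at least \<open>1\<close> otherwise.\<close>

lemma abs_Arg_le_chord:
  assumes q: "0 \<le> q" "q \<le> 1" and u: "norm u = 1"
  shows "\<bar>Arg u\<bar> \<le> pi * norm (1 - of_real q * u)"
proof -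
  define x where "x = \<bar>Arg u\<bar>"
  have x: "0 \<le> x" "x \<le> pi" using abs_Arg_le_pi by (auto simp: x_def)
  have ucis: "u = cis (Arg u)" by (rule unit_eq_cis[OF u])
  have cosx: "Re u = cos x" by (subst ucis) (simp add: x_def)
  have sinx: "\<bar>Im u\<bar> = sin x"
  proof -
    have "\<bar>Im u\<bar> = \<bar>sin (Arg u)\<bar>" by (subst ucis) simp
    also have "\<dots> = \<bar>sin x\<bar>" by (simp add: x_def abs_if)
    also have "\<dots> = sin x" using x by (simp add: sin_ge_zero)
    finally show ?thesis .
  qed
  have uu: "(cos x)\<^sup>2 + (sin x)\<^sup>2 = 1" by (rule sin_cos_squared_add2)
  show ?thesis
  proof (cases "x \<le> pi / 2")
    case True
    have "(sin x)\<^sup>2 \<le> (norm (1 - of_real q * u))\<^sup>2"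
    proof -
      have "(norm (1 - of_real q * u))\<^sup>2 = (1 - q * cos x)\<^sup>2 + (q * Im u)\<^sup>2"
        by (simp add: cmod_power2 cosx)
      also have "(q * Im u)\<^sup>2 = q\<^sup>2 * (sin x)\<^sup>2" using sinx by (metis power2_abs power_mult_distrib)
      also have "(1 - q * cos x)\<^sup>2 + q\<^sup>2 * (sin x)\<^sup>2 = (q - cos x)\<^sup>2 + (sin x)\<^sup>2 + (q\<^sup>2 - 1) * ((cos x)\<^sup>2 + (sin x)\<^sup>2 - 1)"
        by algebra
      finally show ?thesis using uu by simp
    qed
    then have "sin x \<le> norm (1 - of_real q * u)" by (rule power2_le_imp_le) simp
    moreover have "x / pi \<le> sin x" using x True by (intro sin_ge_div_pi)
    ultimately have "x / pi \<le> norm (1 - of_real q * u)" by linarith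
    then show ?thesis using pi_gt_zero by (simp add: x_def field_simps)
  next
    case False
    have "cos x \<le> 0" using False x cos_monotone_0_pi_le[of "pi/2" x] by simp
    then have "1 \<le> Re (1 - of_real q * u)" using q by (simp add: cosx mult_nonneg_nonpos)
    also have "\<dots> \<le> norm (1 - of_real q * u)" by (rule complex_Re_le_cmod)
    finally have "pi * 1 \<le> pi * norm (1 - of_real q * u)" by (intro mult_left_mono) auto
    then show ?thesis using x unfolding x_def by linarith
  qed
qed

lemma floor_mult_frac_cong:
  fixes s t :: real
  assumes "\<lfloor>2 ^ n * s\<rfloor> = \<lfloor>2 ^ n * t\<rfloor>"
  shows "\<lfloor>2 ^ n * frac s\<rfloor> = \<lfloor>2 ^ n * frac t\<rfloor>"
proof -
  have fl: "\<lfloor>r\<rfloor> = \<lfloor>2 ^ n * r\<rfloor> div 2 ^ n" for r :: real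
  proof -
    have "r = (2 ^ n * r) / of_int (2 ^ n)" by simp
    then show ?thesis by (metis floor_divide_real_eq_div zero_le_numeral zero_le_power)
  qed
  have "\<lfloor>2 ^ n * frac r\<rfloor> = \<lfloor>2 ^ n * r\<rfloor> - 2 ^ n * \<lfloor>r\<rfloor>" for r :: real
  proof -
    have "2 ^ n * frac r = 2 ^ n * r - of_int (2 ^ n * \<lfloor>r\<rfloor>)" by (simp add: frac_def algebra_simps)
    then show ?thesis by (simp only: floor_diff_of_int)
  qed
  then show ?thesis using assms fl[of s] fl[of t] by simp
qed

text \<open>If an integer separates \<open>a\<close> from \<open>b\<close> and another one separates the shifted numbers, then \<open>2 ^ n / 3\<close> is within \<open>1/4\<close> of
an integer; but \<open>2 ^ n\<close> is not divisible by \<open>3\<close>, so its distance to the integers is \<open>1/3\<close>.\<close>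

lemma floor_eq_or_shifted:
  fixes a b :: real
  assumes ab: "\<bar>a - b\<bar> \<le> 1 / 4"
  shows "\<lfloor>a\<rfloor> = \<lfloor>b\<rfloor> \<or> \<lfloor>a + 2 ^ n / 3\<rfloor> = \<lfloor>b + 2 ^ n / 3\<rfloor>"
proof -
  have *: "\<lfloor>a\<rfloor> = \<lfloor>b\<rfloor> \<or> \<lfloor>a + 2 ^ n / 3\<rfloor> = \<lfloor>b + 2 ^ n / 3\<rfloor>" if "a \<le> b" "b \<le> a + 1 / 4" for a b :: real
  proof (rule ccontr)
    assume "\<not> ?thesis"
    then have ne: "\<lfloor>a\<rfloor> < \<lfloor>b\<rfloor>" "\<lfloor>a + 2 ^ n / 3\<rfloor> < \<lfloor>b + 2 ^ n / 3\<rfloor>"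
      using that floor_mono[of a b] floor_mono[of "a + 2 ^ n / 3" "b + 2 ^ n / 3"] by auto
    define m k where "m = \<lfloor>b\<rfloor>" and "k = \<lfloor>b + 2 ^ n / 3\<rfloor>"
    have m: "a < of_int m" "of_int m \<le> b" using ne(1) by (simp_all add: m_def floor_less_iff)
    have k: "a + 2 ^ n / 3 < of_int k" "of_int k \<le> b + 2 ^ n / 3" using ne(2) by (simp_all add: k_def floor_less_iff)
    define X :: real where "X = 2 ^ n"
    have "3 * (of_int k - of_int m) - X < 1" "- 1 < 3 * (of_int k - of_int m) - X"
    proof -
      have gen: "3 * (y - x) - X < 1 \<and> - 1 < 3 * (y - x) - X"
        if "a < x" "x \<le> b" "a + X / 3 < y" "y \<le> b + X / 3" for x y :: real
        using that \<open>a \<le> b\<close> \<open>b \<le> a + 1 / 4\<close> by (intro conjI) argo+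
      show "3 * (of_int k - of_int m) - X < 1" "- 1 < 3 * (of_int k - of_int m) - X"
        using gen[OF m k[folded X_def]] by auto
    qed
    then have "of_int (3 * (k - m) - 2 ^ n) < (1::real)" "-1 < (of_int (3 * (k - m) - 2 ^ n) :: real)"
      by (simp_all add: X_def)
    then have "3 * (k - m) = 2 ^ n" by linarith
    then have "3 dvd (2::int) ^ n" by (metis dvd_triv_left)
    then have "3 dvd (2::int)" by (rule prime_dvd_power[rotated]) simp
    then show False by simp
  qed
  show ?thesis using *[of a b] *[of b a] ab by (cases "a \<le> b") (auto simp: abs_le_iff)
qed

text \<open>Two points at distance at most a quarter of an interval of level \<open>n\<close> lie in the same interval of at least one of the
two grids.\<close>

lemma one_third_trick:
  assumes "angle (direction z) (direction z') \<le> pi * (1/2) ^ Suc n"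
  shows "grid_index 0 n z = grid_index 0 n z' \<or> grid_index (1/3) n z = grid_index (1/3) n z'"
proof -
  define \<delta> where "\<delta> = Arg (direction z / direction z')"
  have "direction z / direction z' = cis (Arg z - Arg z')" by (simp add: direction_def cis_divide)
  then obtain k where k: "\<delta> = Arg z - Arg z' + of_int k * (2 * pi)"
    using Arg_cis_int[of "Arg z - Arg z'"] by (auto simp: \<delta>_def)
  define s where "s = Arg z' / (2 * pi)"
  define d where "d = \<delta> / (2 * pi)"
  have zt: "Arg z / (2 * pi) = s + d - of_int k"
    unfolding s_def d_def k by (simp add: field_simps)
  have "\<bar>\<delta>\<bar> \<le> pi * (1/2) ^ Suc n" using assms by (simp add: angle_def \<delta>_def)
  then have "2 ^ n * \<bar>\<delta>\<bar> \<le> 2 ^ n * (pi * (1/2) ^ Suc n)" by (intro mult_left_mono) auto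
  also have "2 ^ n * (pi * (1/2) ^ Suc n) = pi / 2" by (simp add: power_one_over)
  finally have "2 ^ n * \<bar>\<delta>\<bar> / (2 * pi) \<le> pi / 2 / (2 * pi)" by (intro divide_right_mono) auto
  then have d: "\<bar>2 ^ n * d\<bar> \<le> 1 / 4" by (simp add: d_def abs_mult)
  have ph: "phase \<sigma> z = frac (s + d + \<sigma>)" "phase \<sigma> z' = frac (s + \<sigma>)" for \<sigma>
  proof -
    have "Arg z / (2 * pi) + \<sigma> = (s + d + \<sigma>) + of_int (- k)" by (simp add: zt)
    then show "phase \<sigma> z = frac (s + d + \<sigma>)" unfolding phase_def by (simp only: frac_add_of_int_right)
    show "phase \<sigma> z' = frac (s + \<sigma>)" by (simp add: phase_def s_def)
  qed
  have "\<lfloor>2 ^ n * (s + d)\<rfloor> = \<lfloor>2 ^ n * s\<rfloor> \<or> \<lfloor>2 ^ n * (s + d) + 2 ^ n / 3\<rfloor> = \<lfloor>2 ^ n * s + 2 ^ n / 3\<rfloor>"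
    using d by (intro floor_eq_or_shifted) (simp add: algebra_simps)
  then have "\<lfloor>2 ^ n * (s + d + 0)\<rfloor> = \<lfloor>2 ^ n * (s + 0)\<rfloor> \<or> \<lfloor>2 ^ n * (s + d + 1/3)\<rfloor> = \<lfloor>2 ^ n * (s + 1/3)\<rfloor>"
    by (simp add: algebra_simps)
  then show ?thesis
    unfolding grid_index_def ph using floor_mult_frac_cong by blast
qed

text \<open>The number of nodes whose Carleson boxes contain both points.\<close>

definition common_ancestors :: "real \<Rightarrow> nat \<Rightarrow> complex \<Rightarrow> complex \<Rightarrow> real" where
  "common_ancestors \<sigma> N z z' = (\<Sum>\<alpha>\<in>dyadic_nodes N. of_bool (dyadic_le (leaf \<sigma> N z) \<alpha>) * of_bool (dyadic_le (leaf \<sigma> N z') \<alpha>))"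

lemma common_ancestors_nonneg: "0 \<le> common_ancestors \<sigma> N z z'"
  unfolding common_ancestors_def by (intro sum_nonneg) auto

lemma common_ancestors_ge:
  assumes z: "norm z \<le> 1" "norm z' \<le> 1" and p: "finite P"
    and P: "\<And>n. n \<in> P \<Longrightarrow> n \<le> N \<and> 1 - norm z \<le> (1/2) ^ n \<and> 1 - norm z' \<le> (1/2) ^ n"
  shows "real (card {n \<in> P. grid_index \<sigma> n z = grid_index \<sigma> n z'}) \<le> common_ancestors \<sigma> N z z'"
proof -
  define Q where "Q = {n \<in> P. grid_index \<sigma> n z = grid_index \<sigma> n z'}"
  have Q: "finite Q" using p by (simp add: Q_def)
  define \<iota> where "\<iota> n = (n, grid_index \<sigma> n z)" for n
  have "real (card Q) = (\<Sum>\<alpha>\<in>\<iota> ` Q. 1)"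
    by (simp add: card_image inj_on_def \<iota>_def)
  also have "\<dots> = (\<Sum>\<alpha>\<in>\<iota> ` Q. of_bool (dyadic_le (leaf \<sigma> N z) \<alpha>) * of_bool (dyadic_le (leaf \<sigma> N z') \<alpha>))"
    using P by (intro sum.cong refl) (auto simp: leaf_le_iff[OF z(1)] leaf_le_iff[OF z(2)] \<iota>_def Q_def)
  also have "\<dots> \<le> common_ancestors \<sigma> N z z'"
    unfolding common_ancestors_def using P grid_index_bounds
    by (intro sum_mono2 finite_dyadic_nodes) (auto simp: \<iota>_def Q_def dyadic_nodes_def)
  finally show ?thesis by (simp add: Q_def)
qed

text \<open>Let \<open>\<delta> = \<bar>1 - \<rho> * z * cnj z'\<bar>\<close>, between \<open>(1/2) ^ (p + 1)\<close> and \<open>(1/2) ^ p\<close>. Both points are within \<open>\<delta>\<close> of the circle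
and their directions within \<open>pi * \<delta>\<close> of each other, so at each of the levels below \<open>p\<close> one of the two grids
has a common ancestor. The dilation by \<open>\<rho>\<close> keeps \<open>p\<close> at most \<open>N\<close>. The root is common to all points and accounts for
the constant part of the kernel.\<close>

lemma log_kernel_le_common_ancestors:
  assumes z: "norm z \<le> 1" "norm z' \<le> 1" and \<rho>: "0 \<le> \<rho>" "\<rho> < 1" "(1/2) ^ N \<le> 1 - \<rho>"
  shows "log_kernel (of_real \<rho> * (z * cnj z')) \<le> 22 * (common_ancestors 0 N z z' + common_ancestors (1/3) N z z')"
proof -
  let ?w = "of_real \<rho> * (z * cnj z')"
  define \<delta> where "\<delta> = norm (1 - ?w)"
  define S where "S = common_ancestors 0 N z z' + common_ancestors (1/3) N z z'"
  define e e' where "e = direction z" and "e' = direction z'"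
  have e: "norm e = 1" "norm e' = 1" by (auto simp: e_def e'_def)
  define q where "q = \<rho> * (norm z * norm z')"
  have nz: "norm z * norm z' \<le> norm z" "norm z * norm z' \<le> norm z'"
    using z mult_left_mono[of "norm z'" 1 "norm z"] mult_right_mono[of "norm z" 1 "norm z'"] by auto
  have q: "0 \<le> q" "q \<le> \<rho>" "q \<le> norm z" "q \<le> norm z'"
  proof -
    show "0 \<le> q" using \<rho> by (simp add: q_def)
    have "q \<le> 1 * (norm z * norm z')" unfolding q_def using \<rho> by (intro mult_right_mono) auto
    then show "q \<le> norm z" "q \<le> norm z'" using nz by auto
    have "q \<le> \<rho> * 1" unfolding q_def using \<rho> nz z by (intro mult_left_mono) auto
    then show "q \<le> \<rho>" by simp
  qed
  have w: "?w = of_real q * (e / e')"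
  proof -
    have zz: "z = of_real (norm z) * e" "z' = of_real (norm z') * e'"
      by (simp_all add: e_def e'_def norm_times_direction)
    have "?w = of_real \<rho> * ((of_real (norm z) * e) * cnj (of_real (norm z') * e'))" by (simp only: zz[symmetric])
    also have "\<dots> = of_real q * (e * cnj e')" by (simp add: q_def mult_ac)
    also have "e * cnj e' = e / e'" using e by (subst complex_div_cnj) simp
    finally show ?thesis .
  qed
  have "norm ?w = q" unfolding w using e q by (simp add: norm_mult norm_divide)
  then have \<delta>q: "1 - q \<le> \<delta>" "\<delta> \<le> 1 + q"
    using norm_triangle_ineq2[of 1 ?w] norm_triangle_ineq4[of 1 ?w] unfolding \<delta>_def by auto
  have \<delta>: "0 < \<delta>" "1 - \<rho> \<le> \<delta>" "1 - norm z \<le> \<delta>" "1 - norm z' \<le> \<delta>" "\<delta> \<le> 2"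
    using \<delta>q q \<rho> by auto
  have ang: "angle e e' \<le> pi * \<delta>"
    using abs_Arg_le_chord[of q "e / e'"] q \<rho> e unfolding \<delta>_def w by (simp add: angle_def norm_divide)
  have root: "1 \<le> S"
  proof -
    have "real (card {n \<in> {0}. grid_index 0 n z = grid_index 0 n z'}) \<le> common_ancestors 0 N z z'"
      by (intro common_ancestors_ge z) auto
    moreover have "grid_index 0 0 z = grid_index 0 0 z'"
      using grid_index_bounds[of 0 0 z] grid_index_bounds[of 0 0 z'] by simp
    then have "{n \<in> {0}. grid_index 0 n z = grid_index 0 n z'} = {0}" by auto
    ultimately show ?thesis using common_ancestors_nonneg[of "1/3" N z z'] by (simp add: S_def)
  qed
  have "log_kernel ?w \<le> 12 * S"
  proof (cases "\<delta> \<le> 1")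
    case False
    then have "log_kernel ?w \<le> 10" by (simp add: log_kernel_def \<delta>_def)
    then show ?thesis using root by linarith
  next
    case True
    obtain p where p: "\<delta> \<le> (1/2) ^ p" "(1/2) ^ p < 2 * \<delta>" using dyadic_scale[OF \<delta>(1) True] by blast
    have "(1/2) ^ p / 2 < \<delta>" using p by simp
    then have "ln ((1/2) ^ p / 2) \<le> ln \<delta>" using \<delta> by (subst ln_le_cancel_iff) auto
    also have "ln ((1/2::real) ^ p / 2) = - (real p + 1) * ln 2"
      by (simp add: ln_div ln_realpow algebra_simps)
    finally have "- ln \<delta> \<le> (real p + 1) * ln 2" by (simp add: algebra_simps)
    also have "\<dots> \<le> (real p + 1) * 1" using ln_2_less_1 by (intro mult_left_mono) auto
    finally have M: "log_kernel ?w \<le> 11 + real p" by (simp add: log_kernel_def \<delta>_def)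
    have "real p \<le> S"
    proof -
      let ?Q = "\<lambda>\<sigma>. {n \<in> {..<p}. grid_index \<sigma> n z = grid_index \<sigma> n z'}"
      have good: "n \<le> N \<and> 1 - norm z \<le> (1/2) ^ n \<and> 1 - norm z' \<le> (1/2) ^ n \<and>
           (grid_index 0 n z = grid_index 0 n z' \<or> grid_index (1/3) n z = grid_index (1/3) n z')" if "n \<in> {..<p}" for n
      proof -
        have le: "(1/2::real) ^ p \<le> (1/2) ^ Suc n" using that by (intro power_decreasing) auto
        have le2: "(1/2::real) ^ Suc n \<le> (1/2) ^ n" by simp
        have "angle e e' \<le> pi * (1/2) ^ Suc n"
        proof -
          have "\<delta> \<le> (1/2) ^ Suc n" using p le by linarith
          then have "pi * \<delta> \<le> pi * (1/2) ^ Suc n" by (intro mult_left_mono) auto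
          then show ?thesis using ang by linarith
        qed
        then have "grid_index 0 n z = grid_index 0 n z' \<or> grid_index (1/3) n z = grid_index (1/3) n z'"
          unfolding e_def e'_def by (rule one_third_trick)
        moreover have "(1/2::real) ^ N \<le> (1/2) ^ p" using \<rho> \<delta> p by linarith
        then have "p \<le> N" by (subst (asm) power_decreasing_iff) auto
        moreover have "1 - norm z \<le> (1/2) ^ n" "1 - norm z' \<le> (1/2) ^ n" using \<delta> p le le2 by linarith+
        ultimately show ?thesis using that by (simp del: power_Suc)
      qed
      have "{..<p} \<subseteq> ?Q 0 \<union> ?Q (1/3)" using good by auto
      then have "card {..<p} \<le> card (?Q 0 \<union> ?Q (1/3))" by (intro card_mono) auto
      also have "\<dots> \<le> card (?Q 0) + card (?Q (1/3))" by (rule card_Un_le)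
      finally have "real p \<le> real (card (?Q 0)) + real (card (?Q (1/3)))" by simp
      also have "\<dots> \<le> S" unfolding S_def
        using good by (intro add_mono common_ancestors_ge z) auto
      finally show ?thesis .
    qed
    then show ?thesis using M root by linarith
  qed
  then show ?thesis using root by (simp add: S_def)
qed

section \<open>From the capacity condition to the embedding\<close>

context bidisc_measure
begin

definition cell_indicator :: "real \<Rightarrow> real \<Rightarrow> nat \<Rightarrow> nat \<times> int \<Rightarrow> nat \<times> int \<Rightarrow> complex \<times> complex \<Rightarrow> real" where
  "cell_indicator \<sigma> \<tau> N \<alpha> \<beta> z = of_bool (dyadic_le (leaf \<sigma> N (fst z)) \<alpha> \<and> dyadic_le (leaf \<tau> N (snd z)) \<beta>)"

lemma cell_indicator_measurable [measurable]: "cell_indicator \<sigma> \<tau> N \<alpha> \<beta> \<in> borel_measurable \<mu>"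
proof -
  have "(\<lambda>z. of_bool ((fst \<alpha> \<le> N \<and> 1 - norm (fst z) \<le> (1/2) ^ fst \<alpha> \<and> grid_index \<sigma> (fst \<alpha>) (fst z) = snd \<alpha>)
     \<and> (fst \<beta> \<le> N \<and> 1 - norm (snd z) \<le> (1/2) ^ fst \<beta> \<and> grid_index \<tau> (fst \<beta>) (snd z) = snd \<beta>)) :: real) \<in> borel_measurable \<mu>"
    unfolding grid_index_eq_iff of_bool_def by measurable
  also have "?this \<longleftrightarrow> ?thesis"
    unfolding cell_indicator_def using in_bidisc leaf_le_iff by (intro measurable_cong) simp
  finally show ?thesis .
qed

end

context bidisc_density
begin

text \<open>The kernel of the energy is bounded by a sum over the four pairs of grids of the product of the numbers of common
ancestors, that is by a sum over \<open>K\<close> of products of cell indicators in \<open>z\<close> and in \<open>z'\<close>. So the double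
integral splits into squares of integrals, to which \<open>tree_energy_le\<close> applies.
The constant is \<open>4 * 22\<^sup>2\<close> from \<open>energy_le\<close> and the comparison of kernels, times the four pairs of grids, times
the constant of \<open>tree_energy_le\<close>.\<close>

lemma energy_le_capacity:
  assumes C: "C > 0" and cap: "capacity_bound \<mu> C" and \<rho>: "0 \<le> \<rho>" "\<rho> < 1"
  shows "energy D \<rho> \<le> 126284923404288 * C * (\<integral>z. (norm (\<phi> z))\<^sup>2 \<partial>\<mu>)"
proof -
  obtain N where N: "(1/2::real) ^ N < 1 - \<rho>" using real_arch_pow_inv[of "1 - \<rho>" "1/2"] \<rho> by auto
  define G :: "real set" where "G = {0, 1/3}"
  define A where "A = dyadic_nodes N"
  define K where "K = (G \<times> G) \<times> (A \<times> A)"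
  have finK: "finite K" by (simp add: K_def G_def A_def finite_dyadic_nodes)
  define u where "u k = cell_indicator (fst (fst k)) (snd (fst k)) N (fst (snd k)) (snd (snd k))" for k
  define f where "f z = norm (\<phi> z)" for z
  have um[measurable]: "u k \<in> borel_measurable \<mu>" for k unfolding u_def by measurable
  have fm[measurable]: "f \<in> borel_measurable \<mu>" unfolding f_def by measurable
  have f: "0 \<le> f z \<and> f z \<le> B" if "z \<in> space \<mu>" for z using phi_bounded[OF that] by (simp add: f_def)
  have u01: "u k z = 0 \<or> u k z = 1" for k z by (simp add: u_def cell_indicator_def)
  define I where "I k = (\<integral>z. f z * u k z \<partial>\<mu>)" for k
  have fu: "0 \<le> f z * u k z" for k z using u01[of k z] by (auto simp: f_def)
  have int: "integrable \<mu> (\<lambda>z. f z * u k z)" for k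
  proof (rule integrable_bounded[of _ B])
    fix z assume "z \<in> space \<mu>"
    then show "norm (f z * u k z) \<le> B" using f[of z] u01[of k z] by auto
  qed measurable
  have I: "(\<integral>\<^sup>+ z. ennreal (f z * u k z) \<partial>\<mu>) = ennreal (I k)" for k
    unfolding I_def using fu by (intro nn_integral_eq_integral int) auto
  have I0: "0 \<le> I k" for k unfolding I_def using fu by (intro integral_nonneg_AE) auto
  have point: "4 * (bidisc_kernel \<rho> z z') * f z * f z'
     \<le> 1936 * (\<Sum>k\<in>K. (f z * u k z) * (f z' * u k z'))" if zz: "z \<in> space \<mu>" "z' \<in> space \<mu>" for z z'
  proof -
    let ?w = "of_real \<rho> * (fst z * cnj (fst z'))" and ?v = "of_real \<rho> * (snd z * cnj (snd z'))"
    have "norm ?w \<le> \<rho>" "norm ?v \<le> \<rho>" using norm_dilated_product[OF \<rho>(1)] zz in_bidisc by auto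
    then have "norm ?w < 1" "norm ?v < 1" using \<rho> by linarith+
    then have pos: "log_kernel ?w \<ge> 9" "log_kernel ?v \<ge> 9" by (auto intro!: log_kernel_ge)
    define c1 where "c1 \<sigma> = common_ancestors \<sigma> N (fst z) (fst z')" for \<sigma>
    define c2 where "c2 \<tau> = common_ancestors \<tau> N (snd z) (snd z')" for \<tau>
    have w: "log_kernel ?w \<le> 22 * (\<Sum>\<sigma>\<in>G. c1 \<sigma>)"
      using log_kernel_le_common_ancestors[of "fst z" "fst z'" \<rho> N] zz in_bidisc \<rho> N by (simp add: G_def c1_def)
    have v: "log_kernel ?v \<le> 22 * (\<Sum>\<tau>\<in>G. c2 \<tau>)"
      using log_kernel_le_common_ancestors[of "snd z" "snd z'" \<rho> N] zz in_bidisc \<rho> N by (simp add: G_def c2_def)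
    have "log_kernel ?w * log_kernel ?v \<le> (22 * (\<Sum>\<sigma>\<in>G. c1 \<sigma>)) * (22 * (\<Sum>\<tau>\<in>G. c2 \<tau>))"
      using w v pos by (intro mult_mono) auto
    also have "\<dots> = 484 * (\<Sum>\<sigma>\<in>G. \<Sum>\<tau>\<in>G. c1 \<sigma> * c2 \<tau>)" by (simp add: sum_product)
    also have "(\<Sum>\<sigma>\<in>G. \<Sum>\<tau>\<in>G. c1 \<sigma> * c2 \<tau>) = (\<Sum>k\<in>K. u k z * u k z')"
    proof -
      have eqc: "c1 \<sigma> * c2 \<tau> = (\<Sum>p\<in>A \<times> A. u ((\<sigma>, \<tau>), p) z * u ((\<sigma>, \<tau>), p) z')" for \<sigma> \<tau>
        unfolding c1_def c2_def common_ancestors_def sum_product sum.cartesian_product A_def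
        by (intro sum.cong refl) (auto simp: u_def cell_indicator_def)
      define h where "h q = (\<Sum>p\<in>A \<times> A. u (q, p) z * u (q, p) z')" for q
      have "(\<Sum>\<sigma>\<in>G. \<Sum>\<tau>\<in>G. c1 \<sigma> * c2 \<tau>) = (\<Sum>\<sigma>\<in>G. \<Sum>\<tau>\<in>G. h (\<sigma>, \<tau>))"
        unfolding h_def by (intro sum.cong refl eqc)
      also have "\<dots> = (\<Sum>q\<in>G \<times> G. h q)" by (simp add: sum.cartesian_product case_prod_beta)
      also have "\<dots> = (\<Sum>q\<in>G \<times> G. \<Sum>p\<in>A \<times> A. u (q, p) z * u (q, p) z')" by (simp only: h_def)
      also have "\<dots> = (\<Sum>k\<in>K. u k z * u k z')"
        unfolding K_def sum.cartesian_product by (intro sum.cong refl) auto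
      finally show ?thesis .
    qed
    finally have "4 * (log_kernel ?w * log_kernel ?v) * (f z * f z') \<le> 4 * (484 * (\<Sum>k\<in>K. u k z * u k z')) * (f z * f z')"
      using f[OF zz(1)] f[OF zz(2)] by (intro mult_right_mono mult_left_mono) auto
    also have "\<dots> = 1936 * (\<Sum>k\<in>K. (f z * u k z) * (f z' * u k z'))"
      by (simp add: sum_distrib_left sum_distrib_right mult_ac)
    finally show ?thesis by (simp add: bidisc_kernel_def mult.assoc)
  qed
  have "ennreal (energy D \<rho>) \<le> (\<integral>\<^sup>+ z. \<integral>\<^sup>+ z'. ennreal (4 * (bidisc_kernel \<rho> z z')) * ennreal (f z) * ennreal (f z') \<partial>\<mu> \<partial>\<mu>)"
    unfolding f_def by (rule energy_le[OF \<rho>])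
  also have "\<dots> \<le> (\<integral>\<^sup>+ z. \<integral>\<^sup>+ z'. (\<Sum>k\<in>K. ennreal (1936 * (f z * u k z)) * ennreal (f z' * u k z')) \<partial>\<mu> \<partial>\<mu>)"
  proof (intro nn_integral_mono)
    fix z z' assume zz: "z \<in> space \<mu>" "z' \<in> space \<mu>"
    have nn: "0 \<le> (1936 * (f z * u k z)) * (f z' * u k z')" for k
    proof -
      have "0 \<le> 1936 * ((f z * u k z) * (f z' * u k z'))"
        by (rule mult_nonneg_nonneg[OF _ mult_nonneg_nonneg[OF fu fu]]) simp
      then show ?thesis by (simp only: mult.assoc)
    qed
    have "ennreal (4 * (bidisc_kernel \<rho> z z')) * ennreal (f z) * ennreal (f z')
      = ennreal (4 * (bidisc_kernel \<rho> z z') * f z * f z')"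
      using f[OF zz(1)] f[OF zz(2)] by (simp add: ennreal_mult''[symmetric])
    also have "\<dots> \<le> ennreal (\<Sum>k\<in>K. (1936 * (f z * u k z)) * (f z' * u k z'))"
      using point[OF zz] by (intro ennreal_leI) (simp add: sum_distrib_left mult.assoc)
    also have "\<dots> = (\<Sum>k\<in>K. ennreal ((1936 * (f z * u k z)) * (f z' * u k z')))"
      by (rule sum_ennreal[symmetric]) (rule nn)
    also have "\<dots> = (\<Sum>k\<in>K. ennreal (1936 * (f z * u k z)) * ennreal (f z' * u k z'))"
      using fu[of z] fu[of z'] by (intro sum.cong refl ennreal_mult) auto
    finally show "ennreal (4 * (bidisc_kernel \<rho> z z')) * ennreal (f z) * ennreal (f z')
      \<le> (\<Sum>k\<in>K. ennreal (1936 * (f z * u k z)) * ennreal (f z' * u k z'))" .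
  qed
  also have "\<dots> = (\<integral>\<^sup>+ z. (\<Sum>k\<in>K. ennreal (1936 * (f z * u k z)) * ennreal (I k)) \<partial>\<mu>)"
  proof (intro nn_integral_cong)
    fix z
    have "(\<integral>\<^sup>+ z'. (\<Sum>k\<in>K. ennreal (1936 * (f z * u k z)) * ennreal (f z' * u k z')) \<partial>\<mu>)
       = (\<Sum>k\<in>K. \<integral>\<^sup>+ z'. ennreal (1936 * (f z * u k z)) * ennreal (f z' * u k z') \<partial>\<mu>)"
      by (rule nn_integral_sum) measurable
    also have "\<dots> = (\<Sum>k\<in>K. ennreal (1936 * (f z * u k z)) * (\<integral>\<^sup>+ z'. ennreal (f z' * u k z') \<partial>\<mu>))"
      by (intro sum.cong refl nn_integral_cmult) measurable
    finally show "(\<integral>\<^sup>+ z'. (\<Sum>k\<in>K. ennreal (1936 * (f z * u k z)) * ennreal (f z' * u k z')) \<partial>\<mu>)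
       = (\<Sum>k\<in>K. ennreal (1936 * (f z * u k z)) * ennreal (I k))" by (simp only: I)
  qed
  also have "\<dots> = (\<Sum>k\<in>K. \<integral>\<^sup>+ z. ennreal (1936 * (f z * u k z)) * ennreal (I k) \<partial>\<mu>)"
    by (rule nn_integral_sum) measurable
  also have "\<dots> = (\<Sum>k\<in>K. ennreal (1936 * (I k)\<^sup>2))"
  proof (intro sum.cong refl)
    fix k
    have "(\<integral>\<^sup>+ z. ennreal (1936 * (f z * u k z)) * ennreal (I k) \<partial>\<mu>)
       = (\<integral>\<^sup>+ z. ennreal (1936 * I k) * ennreal (f z * u k z) \<partial>\<mu>)"
      using fu I0[of k] by (intro nn_integral_cong) (simp add: ennreal_mult[symmetric] mult_ac)
    also have "\<dots> = ennreal (1936 * I k) * ennreal (I k)"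
      unfolding I[symmetric] by (rule nn_integral_cmult) measurable
    also have "\<dots> = ennreal (1936 * (I k)\<^sup>2)"
      using I0[of k] by (simp add: ennreal_mult[symmetric] power2_eq_square mult.assoc)
    finally show "(\<integral>\<^sup>+ z. ennreal (1936 * (f z * u k z)) * ennreal (I k) \<partial>\<mu>) = ennreal (1936 * (I k)\<^sup>2)" .
  qed
  also have "\<dots> = ennreal (\<Sum>k\<in>K. 1936 * (I k)\<^sup>2)" by (rule sum_ennreal) simp
  finally have "energy D \<rho> \<le> (\<Sum>k\<in>K. 1936 * (I k)\<^sup>2)"
    by (subst (asm) ennreal_le_iff) (auto intro: sum_nonneg)
  also have "\<dots> = 1936 * (\<Sum>q\<in>G \<times> G. \<Sum>p\<in>A \<times> A. (I (q, p))\<^sup>2)"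
    unfolding K_def sum.cartesian_product sum_distrib_left by (intro sum.cong refl) auto
  also have "\<dots> \<le> 1936 * (\<Sum>q\<in>G \<times> G. 16307453952 * C * (\<integral>z. (f z)\<^sup>2 \<partial>\<mu>))"
  proof (intro mult_left_mono sum_mono)
    fix q :: "real \<times> real"
    have "(\<Sum>p\<in>A \<times> A. (I (q, p))\<^sup>2) = (\<Sum>\<alpha>\<in>A. \<Sum>\<beta>\<in>A. (I (q, (\<alpha>, \<beta>)))\<^sup>2)"
      by (simp add: sum.cartesian_product case_prod_beta)
    also have "\<dots> \<le> 16307453952 * C * (\<integral>z. (f z)\<^sup>2 \<partial>\<mu>)"
      using tree_energy_le[OF C cap fm f, where N = N and \<sigma> = "fst q" and \<tau> = "snd q"]
      by (simp add: I_def u_def cell_indicator_def A_def)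
    finally show "(\<Sum>p\<in>A \<times> A. (I (q, p))\<^sup>2) \<le> 16307453952 * C * (\<integral>z. (f z)\<^sup>2 \<partial>\<mu>)" .
  qed simp
  also have "\<dots> = 126284923404288 * C * (\<integral>z. (f z)\<^sup>2 \<partial>\<mu>)"
    by (simp add: G_def)
  finally show ?thesis by (simp add: f_def)
qed

end

context bidisc_measure
begin

text \<open>With the density \<open>cnj p\<close> the square integral \<open>X\<close> of \<open>p\<close> is the sum of the coefficients of \<open>p\<close> against the moments.
By the Cauchy--Schwarz inequality \<open>X\<^sup>2\<close> is at most the squared Dirichlet norm times the energy, and the energy is bounded by a multiple of \<open>X\<close>.\<close>

lemma capacity_imp_polynomial_embedding:
  assumes C: "C > 0" and cap: "capacity_bound \<mu> C" and r: "0 \<le> r" "r < 1"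
  shows "(\<integral>\<^sup>+ z. ennreal ((norm (bipoly D a (of_real r * fst z, of_real r * snd z)))\<^sup>2) \<partial>\<mu>)
    \<le> ennreal (126284923404288 * C * (\<Sum>m<D. \<Sum>n<D. (norm (a m n))\<^sup>2 * (real m + 1) * (real n + 1)))"
proof -
  define p where "p z = bipoly D a (of_real r * fst z, of_real r * snd z)" for z
  have p: "p z = (\<Sum>m<D. \<Sum>n<D. (a m n * of_real (r ^ m * r ^ n)) * (fst z ^ m * snd z ^ n))" for z
    unfolding p_def bipoly_def by (auto intro!: sum.cong simp: power_mult_distrib mult_ac)
  have pm[measurable]: "p \<in> borel_measurable \<mu>" unfolding p by measurable
  define B where "B = (\<Sum>m<D. \<Sum>n<D. norm (a m n))"
  have pB: "norm (p z) \<le> B" if z: "z \<in> space \<mu>" for z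
    unfolding p B_def
  proof (intro order_trans[OF norm_sum] sum_mono)
    fix m n
    have "norm (fst z) ^ m * norm (snd z) ^ n \<le> 1 * 1"
      using in_bidisc[OF z] by (intro mult_mono power_le_one) auto
    moreover have "r ^ m * r ^ n \<le> 1 * 1" using r by (intro mult_mono power_le_one) auto
    ultimately have "(r ^ m * r ^ n) * (norm (fst z) ^ m * norm (snd z) ^ n) \<le> 1 * 1"
      using r by (intro mult_mono) auto
    then have "norm (a m n) * ((r ^ m * r ^ n) * (norm (fst z) ^ m * norm (snd z) ^ n)) \<le> norm (a m n) * 1"
      by (intro mult_left_mono) auto
    then show "norm ((a m n * of_real (r ^ m * r ^ n)) * (fst z ^ m * snd z ^ n)) \<le> norm (a m n)"
      using r by (simp add: norm_mult norm_power mult_ac)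
  qed
  interpret bidisc_density \<mu> "\<lambda>z. cnj (p z)" B
    by standard (auto intro: pB)
  define X where "X = (\<integral>z. (norm (p z))\<^sup>2 \<partial>\<mu>)"
  have X0: "0 \<le> X" unfolding X_def by simp
  have int: "integrable \<mu> (\<lambda>z. (norm (p z))\<^sup>2)"
    by (rule integrable_bounded[of _ "B\<^sup>2"]) (auto intro!: power_mono pB)
  have "of_real X = (\<integral>z. p z * cnj (p z) \<partial>\<mu>)"
    unfolding X_def integral_complex_of_real[symmetric] complex_norm_square by (rule refl)
  also have "\<dots> = (\<integral>z. (\<Sum>m<D. \<Sum>n<D. (a m n * of_real (r ^ m * r ^ n)) * (fst z ^ m * snd z ^ n * cnj (p z))) \<partial>\<mu>)"
    by (subst (1) p) (simp only: sum_distrib_right mult.assoc)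
  also have "\<dots> = (\<Sum>m<D. \<Sum>n<D. (a m n * of_real (r ^ m * r ^ n)) * moment m n)"
    by (subst integral_double_sum)
       (simp_all only: integral_mult_right_zero moment_def integrable_mult_right integrable_monomial)
  finally have XX: "of_real X = (\<Sum>m<D. \<Sum>n<D. (a m n * of_real (r ^ m * r ^ n)) * moment m n)" .
  define S where "S = (\<Sum>m<D. \<Sum>n<D. (norm (a m n))\<^sup>2 * (real m + 1) * (real n + 1))"
  have S0: "0 \<le> S" unfolding S_def by (intro sum_nonneg) auto
  let ?Q = "{..<D} \<times> {..<D}"
  define x where "x q = norm (a (fst q) (snd q)) * sqrt ((real (fst q) + 1) * (real (snd q) + 1))" for q :: "nat \<times> nat"
  define y where "y q = r ^ fst q * r ^ snd q * norm (moment (fst q) (snd q)) / sqrt ((real (fst q) + 1) * (real (snd q) + 1))" for q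
  have "X = norm (of_real X :: complex)" using X0 by simp
  also have "\<dots> \<le> (\<Sum>m<D. \<Sum>n<D. norm ((a m n * of_real (r ^ m * r ^ n)) * moment m n))"
    unfolding XX by (intro order_trans[OF norm_sum] sum_mono) simp
  also have "\<dots> = (\<Sum>q\<in>?Q. x q * y q)"
    unfolding sum.cartesian_product using r
    by (intro sum.cong refl) (auto simp: x_def y_def norm_mult norm_power)
  finally have "X\<^sup>2 \<le> (\<Sum>q\<in>?Q. x q * y q)\<^sup>2" using X0 by (intro power_mono)
  also have "\<dots> \<le> (\<Sum>q\<in>?Q. (x q)\<^sup>2) * (\<Sum>q\<in>?Q. (y q)\<^sup>2)" by (rule Cauchy_Schwarz_ineq_sum)
  also have "(\<Sum>q\<in>?Q. (x q)\<^sup>2) = S"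
    unfolding S_def sum.cartesian_product
    by (intro sum.cong refl) (auto simp: x_def power_mult_distrib mult.assoc)
  also have "(\<Sum>q\<in>?Q. (y q)\<^sup>2) \<le> energy D (r\<^sup>2)"
    unfolding energy_def sum.cartesian_product
  proof (intro sum_mono, clarify)
    fix m n
    define M where "M = (norm (moment m n))\<^sup>2 * ((r ^ m)\<^sup>2 * (r ^ n)\<^sup>2)"
    have "1 / ((real m + 1) * (real n + 1)) \<le> log_coeff m * log_coeff n"
    proof -
      have "1 * 1 \<le> (log_coeff m * (real m + 1)) * (log_coeff n * (real n + 1))"
        using log_coeff_bounds(1)[of m] log_coeff_bounds(1)[of n] by (intro mult_mono) auto
      also have "\<dots> = (log_coeff m * log_coeff n) * ((real m + 1) * (real n + 1))" by (simp only: mult_ac)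
      finally show ?thesis by (subst pos_divide_le_eq) auto
    qed
    then have "M * (1 / ((real m + 1) * (real n + 1))) \<le> M * (log_coeff m * log_coeff n)"
      by (intro mult_left_mono) (simp_all add: M_def)
    moreover have "(y (m, n))\<^sup>2 = M * (1 / ((real m + 1) * (real n + 1)))"
      by (simp add: y_def M_def power_mult_distrib power_divide)
    moreover have "M * (log_coeff m * log_coeff n) = log_coeff m * log_coeff n * (r\<^sup>2) ^ m * (r\<^sup>2) ^ n * (norm (moment m n))\<^sup>2"
      by (simp add: M_def mult_ac flip: power_mult)
    ultimately show "(y (m, n))\<^sup>2 \<le> log_coeff m * log_coeff n * (r\<^sup>2) ^ m * (r\<^sup>2) ^ n * (norm (moment m n))\<^sup>2" by simp
  qed
  also have "energy D (r\<^sup>2) \<le> 126284923404288 * C * X"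
  proof -
    have "r\<^sup>2 < 1" using r by (simp add: abs_square_less_1)
    then show ?thesis using energy_le_capacity[OF C cap, of "r\<^sup>2" D] by (simp add: X_def)
  qed
  finally have "X\<^sup>2 \<le> S * (126284923404288 * C * X)" using S0 by (simp add: mult_left_mono)
  then have "X * X \<le> X * (126284923404288 * C * S)" by (simp add: power2_eq_square mult_ac)
  then have "X \<le> 126284923404288 * C * S"
    using X0 S0 C by (cases "X = 0") auto
  moreover have "(\<integral>\<^sup>+ z. ennreal ((norm (p z))\<^sup>2) \<partial>\<mu>) = ennreal X"
    unfolding X_def by (intro nn_integral_eq_integral int) auto
  ultimately show ?thesis by (simp add: p_def S_def ennreal_leI)
qed

text \<open>Square partial sums of the expansion converge pointwise on the dilated bidisc; Fatou's lemma passes to the limit.\<close>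

theorem capacity_imp_embedding:
  assumes C: "C > 0" and cap: "capacity_bound \<mu> C"
  shows "embedding_bound \<mu> (126284923404288 * C)"
  unfolding embedding_bound_def
proof (intro ballI SUP_least)
  fix f r assume f: "f \<in> dirichlet_space" and r: "r \<in> {0..<1::real}"
  obtain a where a: "has_bidisc_expansion f a"
    "(\<lambda>(m, n). (norm (a m n))\<^sup>2 * (real m + 1) * (real n + 1)) summable_on UNIV"
    using f by (auto simp: dirichlet_space_def)
  let ?p = "\<lambda>D z. bipoly D a (of_real r * fst z, of_real r * snd z)"
  let ?b = "ennreal (126284923404288 * C * dirichlet_norm_sq f)"
  have squares: "filterlim (\<lambda>D. {..<D} \<times> {..<D}) (finite_subsets_at_top (UNIV :: (nat \<times> nat) set)) sequentially"
    unfolding filterlim_finite_subsets_at_top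
  proof (intro allI impI)
    fix X :: "(nat \<times> nat) set" assume "finite X \<and> X \<subseteq> UNIV"
    then have fin: "finite (fst ` X \<union> snd ` X)" by auto
    show "\<forall>\<^sub>F D in sequentially. finite ({..<D} \<times> {..<D}) \<and> X \<subseteq> {..<D} \<times> {..<D} \<and> {..<D} \<times> {..<D} \<subseteq> (UNIV :: (nat \<times> nat) set)"
      using eventually_ge_at_top[of "Suc (Max (insert 0 (fst ` X \<union> snd ` X)))"]
    proof eventually_elim
      case (elim D)
      have "i < D" if "i \<in> fst ` X \<union> snd ` X" for i
      proof -
        have "i \<le> Max (insert 0 (fst ` X \<union> snd ` X))" using that fin by (intro Max_ge) auto
        then show ?thesis using elim by linarith
      qed
      then show ?case by force
    qed
  qed
  have lim: "(\<lambda>D. ?p D z) \<longlonglongrightarrow> f (of_real r * fst z, of_real r * snd z)" if z: "z \<in> space \<mu>" for z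
  proof -
    have "norm (of_real r * fst z) < 1" "norm (of_real r * snd z) < 1"
      using in_bidisc[OF z] r mult_left_mono[of "norm (fst z)" 1 r] mult_left_mono[of "norm (snd z)" 1 r]
      by (auto simp: norm_mult)
    then have "((\<lambda>(m, n). a m n * (of_real r * fst z) ^ m * (of_real r * snd z) ^ n) has_sum f (of_real r * fst z, of_real r * snd z)) UNIV"
      using a(1) unfolding has_bidisc_expansion_def by auto
    then have "((\<lambda>F. \<Sum>(m, n)\<in>F. a m n * (of_real r * fst z) ^ m * (of_real r * snd z) ^ n) \<longlongrightarrow> f (of_real r * fst z, of_real r * snd z)) (finite_subsets_at_top UNIV)"
      by (simp add: has_sum_def)
    from filterlim_compose[OF this squares] show ?thesis
      by (simp add: bipoly_def sum.cartesian_product)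
  qed
  have "(\<integral>\<^sup>+ (z1, z2). ennreal ((norm (f (of_real r * z1, of_real r * z2)))\<^sup>2) \<partial>\<mu>)
      = (\<integral>\<^sup>+ z. liminf (\<lambda>D. ennreal ((norm (?p D z))\<^sup>2)) \<partial>\<mu>)"
  proof (intro nn_integral_cong)
    fix z assume z: "z \<in> space \<mu>"
    have "(\<lambda>D. ennreal ((norm (?p D z))\<^sup>2)) \<longlonglongrightarrow> ennreal ((norm (f (of_real r * fst z, of_real r * snd z)))\<^sup>2)"
      by (intro tendsto_ennrealI tendsto_power tendsto_norm lim z)
    then have eq: "liminf (\<lambda>D. ennreal ((norm (?p D z))\<^sup>2)) = ennreal ((norm (f (of_real r * fst z, of_real r * snd z)))\<^sup>2)"
      by (rule lim_imp_Liminf[OF sequentially_bot])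
    show "(case z of (z1, z2) \<Rightarrow> ennreal ((norm (f (of_real r * z1, of_real r * z2)))\<^sup>2))
       = liminf (\<lambda>D. ennreal ((norm (?p D z))\<^sup>2))"
      unfolding eq by (simp add: case_prod_beta)
  qed
  also have "\<dots> \<le> liminf (\<lambda>D. \<integral>\<^sup>+ z. ennreal ((norm (?p D z))\<^sup>2) \<partial>\<mu>)"
  proof (rule nn_integral_liminf)
    show "(\<lambda>z. ennreal ((norm (?p D z))\<^sup>2)) \<in> borel_measurable \<mu>" for D
      unfolding bipoly_def case_prod_conv by measurable
  qed
  also have "\<dots> \<le> ?b"
  proof -
    have "(\<integral>\<^sup>+ z. ennreal ((norm (?p D z))\<^sup>2) \<partial>\<mu>) \<le> ?b" for D
    proof -
      have "(\<Sum>m<D. \<Sum>n<D. (norm (a m n))\<^sup>2 * (real m + 1) * (real n + 1))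
          = (\<Sum>(m, n)\<in>{..<D} \<times> {..<D}. (norm (a m n))\<^sup>2 * (real m + 1) * (real n + 1))"
        by (simp add: sum.cartesian_product)
      also have "\<dots> \<le> dirichlet_norm_sq f"
        unfolding dirichlet_norm_sq_def bidisc_coeff_eq[OF a(1)]
        by (intro finite_sum_le_infsum a(2)) auto
      finally have "(\<Sum>m<D. \<Sum>n<D. (norm (a m n))\<^sup>2 * (real m + 1) * (real n + 1)) \<le> dirichlet_norm_sq f" .
      then have "126284923404288 * C * (\<Sum>m<D. \<Sum>n<D. (norm (a m n))\<^sup>2 * (real m + 1) * (real n + 1)) \<le> 126284923404288 * C * dirichlet_norm_sq f"
        using C by (intro mult_left_mono) auto
      moreover have "0 \<le> r" "r < 1" using r by auto
      ultimately show ?thesis by (rule_tac order_trans[OF capacity_imp_polynomial_embedding[OF C cap] ennreal_leI])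
    qed
    then have "liminf (\<lambda>D. \<integral>\<^sup>+ z. ennreal ((norm (?p D z))\<^sup>2) \<partial>\<mu>) \<le> liminf (\<lambda>D::nat. ?b)"
      by (intro Liminf_mono always_eventually) auto
    then show ?thesis by (simp add: Liminf_const)
  qed
  finally show "(\<integral>\<^sup>+ (z1, z2). ennreal ((norm (f (of_real r * z1, of_real r * z2)))\<^sup>2) \<partial>\<mu>) \<le> ?b" .
qed

end

section \<open>Finiteness of the measure and best constants\<close>

lemma space_borel_measure: "borel_measure_on_closed_bidisc \<mu> \<Longrightarrow> space \<mu> = closed_bidisc"
  using sets_eq_imp_space_eq[of \<mu> "restrict_space borel closed_bidisc"]
  by (simp add: borel_measure_on_closed_bidisc_def space_restrict_space)

text \<open>The embedding is tested on the constant function \<open>1\<close>.\<close>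

lemma embedding_imp_finite:
  assumes \<mu>: "borel_measure_on_closed_bidisc \<mu>" and emb: "embedding_bound \<mu> C"
  shows "bidisc_measure \<mu>"
proof -
  let ?f = "bipoly 1 (\<lambda>_ _. 1)"
  have "emeasure \<mu> (space \<mu>) = (\<integral>\<^sup>+ (z1, z2). ennreal ((norm (?f (of_real 0 * z1, of_real 0 * z2)))\<^sup>2) \<partial>\<mu>)"
    by (simp add: bipoly_def case_prod_unfold)
  also have "\<dots> \<le> (SUP r\<in>{0..<1::real}. \<integral>\<^sup>+ (z1, z2). ennreal ((norm (?f (of_real r * z1, of_real r * z2)))\<^sup>2) \<partial>\<mu>)"
    by (rule SUP_upper) simp
  also have "\<dots> \<le> ennreal (C * dirichlet_norm_sq ?f)"
    using emb bipoly_dirichlet(1) unfolding embedding_bound_def by blast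
  also have "\<dots> < \<infinity>" by simp
  finally have "finite_measure \<mu>" by (intro finite_measureI) auto
  then show ?thesis using \<mu> by (simp add: bidisc_measure_def bidisc_measure_axioms_def)
qed

text \<open>The box over the full circle is the whole disc, and a constant function shows that capacities are finite.\<close>

lemma capacity_imp_finite:
  assumes \<mu>: "borel_measure_on_closed_bidisc \<mu>" and cap: "capacity_bound \<mu> C"
  shows "bidisc_measure \<mu>"
proof -
  define J where "J = cis ` {-pi..pi}"
  have J: "J \<in> circle_arcs" unfolding J_def circle_arcs_def by force
  have box: "carleson_box J = cball 0 1"
  proof -
    have "direction z \<in> cis ` {-pi..pi}" for z
      unfolding direction_def using Arg_bounded[of z] by (intro imageI) auto
    then show ?thesis unfolding J_def using carleson_box_eq[of "-pi" pi] by auto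
  qed
  have one: "emeasure torus_measure UNIV = 1" using torus_prob.emeasure_space_1 by simp
  define h :: "complex \<times> complex \<Rightarrow> ennreal" where "h = (\<lambda>_. ennreal pi)"
  have "1 \<le> potential h z" for z
  proof -
    have "ennreal (1 / pi) \<le> potential_kernel z \<zeta>" for \<zeta>
    proof -
      have "ennreal (1 / pi) = ennreal (1 / sqrt pi) * ennreal (1 / sqrt pi)"
        by (simp add: ennreal_mult[symmetric])
      also have "\<dots> \<le> potential_kernel z \<zeta>"
        unfolding potential_kernel_eq by (intro mult_mono riesz_kernel_ge angle_le_pi) auto
      finally show ?thesis .
    qed
    then have "(\<integral>\<^sup>+ \<zeta>. ennreal (1 / pi) * ennreal pi \<partial>torus_measure) \<le> potential h z"
      unfolding potential_def h_def by (intro nn_integral_mono mult_right_mono) auto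
    moreover have "ennreal (1 / pi) * ennreal pi = 1" by (simp add: ennreal_mult[symmetric])
    ultimately show ?thesis by (simp add: one)
  qed
  then have "capacity E \<le> (\<integral>\<^sup>+ \<zeta>. (h \<zeta>)\<^sup>2 \<partial>torus_measure)" for E
    unfolding capacity_def by (intro INF_lower) (auto simp: h_def)
  moreover have "(\<integral>\<^sup>+ \<zeta>. (h \<zeta>)\<^sup>2 \<partial>torus_measure) < \<infinity>"
    by (simp add: h_def one ennreal_power)
  ultimately have fin: "capacity E < \<infinity>" for E by (rule le_less_trans)
  have "emeasure \<mu> (\<Union>k\<in>{1..1::nat}. carleson_box J \<times> carleson_box J) \<le> ennreal C * capacity (\<Union>k\<in>{1..1::nat}. J \<times> J)"
    using cap[unfolded capacity_bound_def, THEN spec, THEN mp, THEN spec, THEN spec, THEN mp, of 1 "\<lambda>_. J" "\<lambda>_. J"] J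
    by simp
  also have "\<dots> < \<infinity>" using fin by (simp add: ennreal_mult_less_top)
  finally have "emeasure \<mu> (space \<mu>) < \<infinity>" by (simp add: box space_borel_measure[OF \<mu>])
  then have "finite_measure \<mu>" by (intro finite_measureI) auto
  then show ?thesis using \<mu> by (simp add: bidisc_measure_def bidisc_measure_axioms_def)
qed

lemma best_constant_le:
  assumes K: "K > 0" and PQ: "\<And>C. C > 0 \<Longrightarrow> P C \<Longrightarrow> Q (K * C)"
  shows "best_constant Q \<le> ennreal K * best_constant P"
proof -
  have "best_constant P = (INF C\<in>{C. 0 < C \<and> P C}. ennreal C)"
    unfolding best_constant_def by (simp add: setcompr_eq_image)
  moreover have "best_constant Q \<le> ennreal K * (INF C\<in>{C. 0 < C \<and> P C}. ennreal C)"
  proof (rule le_ennreal_mult_INF[OF K])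
    fix C assume "C \<in> {C. 0 < C \<and> P C}"
    then have C: "C > 0" "P C" by auto
    have "best_constant Q \<le> ennreal (K * C)"
      unfolding best_constant_def using PQ[OF C] C K by (intro Inf_lower) auto
    also have "\<dots> = ennreal K * ennreal C" using K C by (simp add: ennreal_mult)
    finally show "best_constant Q \<le> ennreal K * ennreal C" .
  qed
  ultimately show ?thesis by simp
qed

theorem theorem1p1:
  "(\<forall>\<mu>. borel_measure_on_closed_bidisc \<mu> \<longrightarrow>
      ((\<exists>C1>0. embedding_bound \<mu> C1) \<longleftrightarrow> (\<exists>C2>0. capacity_bound \<mu> C2))) \<and>
   (\<exists>c C :: real. 0 < c \<and> c \<le> C \<and>
      (\<forall>\<mu>. borel_measure_on_closed_bidisc \<mu> \<longrightarrow>
         ennreal c * best_constant (capacity_bound \<mu>) \<le> best_constant (embedding_bound \<mu>) \<and>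
         best_constant (embedding_bound \<mu>) \<le> ennreal C * best_constant (capacity_bound \<mu>)))"
proof (intro conjI)
  have emb_cap: "capacity_bound \<mu> (4096000000 * C)"
    if "borel_measure_on_closed_bidisc \<mu>" "C > 0" "embedding_bound \<mu> C" for \<mu> C
    using bidisc_measure.embedding_imp_capacity[OF embedding_imp_finite] that by blast
  have cap_emb: "embedding_bound \<mu> (126284923404288 * C)"
    if "borel_measure_on_closed_bidisc \<mu>" "C > 0" "capacity_bound \<mu> C" for \<mu> C
    using bidisc_measure.capacity_imp_embedding[OF capacity_imp_finite] that by blast
  show "\<forall>\<mu>. borel_measure_on_closed_bidisc \<mu> \<longrightarrow>
      ((\<exists>C1>0. embedding_bound \<mu> C1) \<longleftrightarrow> (\<exists>C2>0. capacity_bound \<mu> C2))"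
  proof (intro allI impI iffI)
    fix \<mu> assume \<mu>: "borel_measure_on_closed_bidisc \<mu>"
    show "\<exists>C2>0. capacity_bound \<mu> C2" if "\<exists>C1>0. embedding_bound \<mu> C1"
      using that emb_cap[OF \<mu>] by (metis mult_pos_pos zero_less_numeral)
    show "\<exists>C1>0. embedding_bound \<mu> C1" if "\<exists>C2>0. capacity_bound \<mu> C2"
      using that cap_emb[OF \<mu>] by (metis mult_pos_pos zero_less_numeral)
  qed
  show "\<exists>c C :: real. 0 < c \<and> c \<le> C \<and>
      (\<forall>\<mu>. borel_measure_on_closed_bidisc \<mu> \<longrightarrow>
         ennreal c * best_constant (capacity_bound \<mu>) \<le> best_constant (embedding_bound \<mu>) \<and>
         best_constant (embedding_bound \<mu>) \<le> ennreal C * best_constant (capacity_bound \<mu>))"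
  proof (rule exI[of _ "1 / 4096000000"], rule exI[of _ 126284923404288], intro conjI allI impI)
    fix \<mu> assume \<mu>: "borel_measure_on_closed_bidisc \<mu>"
    show "best_constant (embedding_bound \<mu>) \<le> ennreal 126284923404288 * best_constant (capacity_bound \<mu>)"
      using cap_emb[OF \<mu>] by (intro best_constant_le) auto
    have "best_constant (capacity_bound \<mu>) \<le> ennreal 4096000000 * best_constant (embedding_bound \<mu>)"
      using emb_cap[OF \<mu>] by (intro best_constant_le) auto
    then have "ennreal (1 / 4096000000) * best_constant (capacity_bound \<mu>)
       \<le> ennreal (1 / 4096000000) * (ennreal 4096000000 * best_constant (embedding_bound \<mu>))"
      by (intro mult_left_mono) auto
    also have "\<dots> = (ennreal (1 / 4096000000) * ennreal 4096000000) * best_constant (embedding_bound \<mu>)"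
      by (simp only: mult.assoc)
    also have "ennreal (1 / 4096000000) * ennreal 4096000000 = 1"
      by (subst ennreal_mult[symmetric]) auto
    finally show "ennreal (1 / 4096000000) * best_constant (capacity_bound \<mu>) \<le> best_constant (embedding_bound \<mu>)"
      by simp
  qed auto
qed

end
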